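(* Let $F$ and $G$ be Siegel modular forms of degree $2$ and level $N$ which are Hecke eigenforms, of respective weights $(\lambda_1\ge\lambda_2)$ and $(\mu_1\ge\mu_2)$ with $\lambda_1+\lambda_2\ne\mu_1+\mu_2$. Let $p$ be a prime not dividing $N$, and let $a_F(p^r)$, $a_G(p^r)$ denote the eigenvalues of $F$, $G$ for $T(p^r)$. (i) If $a_F(p)$ and $a_G(p)$ are not both zero, then $(a_F(p),a_F(p^2),a_F(p^3))\ne(a_G(p),a_G(p^2),a_G(p^3))$. (ii) If $a_F(p)=a_G(p)=0$, then $(a_F(p^2),a_F(p^4),a_F(p^6))\ne(a_G(p^2),a_G(p^4),a_G(p^6))$.
   Context: $J=\begin{pmatrix}0&I_2\\-I_2&0\end{pmatrix}$, $\Gamma_0(N)=\{\begin{pmatrix}A&B\\C&D\end{pmatrix}\in\mathrm{Sp}(4,\mathbb{Z}) : C\equiv0\pmod N\}$, $\mathbb{H}^2$ the Siegel upper half space of degree 2. For a polynomial representation $\rho\colon\mathrm{GL}_2(\mathbb{C})\to\mathrm{GL}(V)$ of highest weight $(\lambda_1\ge\lambda_2)$, a Siegel modular form of degree 2, weight $(\lambda_1\ge\lambda_2)$, level $N$ is a holomorphic $F\colon\mathbb{H}^2\to V$ with $F((Az+B)(Cz+D)^{-1})=\rho(Cz+D)F(z)$ for all elements of $\Gamma_0(N)$. For $\gamma=\begin{pmatrix}A&B\\C&D\end{pmatrix}\in\mathrm{GSp}(4,\mathbb{Q})$ with $\gamma J\gamma^t=\eta(\gamma)J$ and positive determinant, $F|_{\gamma,\rho}(z)=\eta(\gamma)^{\lambda_1+\lambda_2-3}\rho(Cz+D)^{-1}F(\gamma\cdot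 z)$. For $p\nmid N$ and $K=\mathrm{Sp}(4,\mathbb{Z}_p)$, a double coset $K\gamma K=\coprod_iK\gamma_i$ acts by $F\mapsto\sum_iF|_{\gamma_i,\rho}$, extended linearly. $T(p^r)$ is the sum of the distinct double cosets $K\gamma K$ with $\gamma^tJ\gamma=p^rJ$, $\gamma$ integral. A Hecke eigenform is an eigenvector of all these operators. *)

theory Defs
  imports "HOL-Analysis.Analysis" "HOL-Number_Theory.Number_Theory"
begin

text \<open>Rows and columns of a \<open>4 \<times> 4\<close> matrix are indexed by the sum type \<open>2 + 2\<close>,
  so that the \<open>2 \<times> 2\<close> blocks are addressed by \<open>Inl\<close> and \<open>Inr\<close>.\<close>

type_synonym 'a mat2 = "'a ^ 2 ^ 2"
type_synonym 'a mat4 = "'a ^ (2 + 2) ^ (2 + 2)"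

definition blockA :: "'a mat4 \<Rightarrow> 'a mat2" where
  "blockA M = (\<chi> i j. M $ Inl i $ Inl j)"

definition blockB :: "'a mat4 \<Rightarrow> 'a mat2" where
  "blockB M = (\<chi> i j. M $ Inl i $ Inr j)"

definition blockC :: "'a mat4 \<Rightarrow> 'a mat2" where
  "blockC M = (\<chi> i j. M $ Inr i $ Inl j)"

definition blockD :: "'a mat4 \<Rightarrow> 'a mat2" where
  "blockD M = (\<chi> i j. M $ Inr i $ Inr j)"

definition Jmat :: "'a::ring_1 mat4" where
  "Jmat = (\<chi> i j. case (i, j) of
      (Inl a, Inr b) \<Rightarrow> of_bool (a = b)
    | (Inr a, Inl b) \<Rightarrow> - of_bool (a = b)
    | _ \<Rightarrow> 0)"

definition Sp4_Z :: "int mat4 set" where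
  "Sp4_Z = {M. M ** Jmat ** transpose M = Jmat}"

definition Gamma0 :: "nat \<Rightarrow> int mat4 set" where
  "Gamma0 N = {M \<in> Sp4_Z. \<forall>i j. int N dvd blockC M $ i $ j}"


subsection \<open>Siegel upper half space\<close>

definition siegel_H2 :: "complex mat2 set" where
  "siegel_H2 = {z. transpose z = z \<and>
     (\<forall>v :: real ^ 2. v \<noteq> 0 \<longrightarrow> v \<bullet> (map_matrix Im z *v v) > 0)}"

definition cocycle :: "complex mat4 \<Rightarrow> complex mat2 \<Rightarrow> complex mat2" where
  "cocycle M z = blockC M ** z + blockD M"

definition moebius4 :: "complex mat4 \<Rightarrow> complex mat2 \<Rightarrow> complex mat2" where
  "moebius4 M z = (blockA M ** z + blockB M) ** matrix_inv (cocycle M z)"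

text \<open>The half space is open in the symmetric matrices, not in the space of all matrices, so its
  derivative is determined only on symmetric directions. A complex linear map there always
  extends to all matrices, hence the condition below is complex differentiability
  in the three coordinates of a symmetric matrix.\<close>

definition holomorphic_H2 :: "(complex mat2 \<Rightarrow> complex ^ 'd) \<Rightarrow> bool" where
  "holomorphic_H2 F \<longleftrightarrow> (\<forall>z\<in>siegel_H2. \<exists>D.
     (F has_derivative D) (at z within siegel_H2) \<and>
     (\<forall>c X. D (map_matrix ((*) c) X) = c *s D X))"


subsection \<open>Polynomial representations\<close>

text \<open>A representation of \<open>GL\<^sub>2(\<complex>)\<close> on \<open>V = \<complex>\<^sup>d\<close> is a matrix-valued function
  of which only the values at invertible matrices matter.\<close>

definition GL2_rep :: "(complex mat2 \<Rightarrow> complex ^ 'd ^ 'd) \<Rightarrow> bool" where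
  "GL2_rep \<rho> \<longleftrightarrow> \<rho> (mat 1) = mat 1 \<and>
     (\<forall>g h. invertible g \<longrightarrow> invertible h \<longrightarrow> \<rho> (g ** h) = \<rho> g ** \<rho> h)"

definition polynomial_rep :: "(complex mat2 \<Rightarrow> complex ^ 'd ^ 'd) \<Rightarrow> bool" where
  "polynomial_rep \<rho> \<longleftrightarrow> GL2_rep \<rho> \<and>
     (\<forall>i j. \<exists>n (c :: nat \<Rightarrow> nat \<Rightarrow> nat \<Rightarrow> nat \<Rightarrow> complex). \<forall>g. invertible g \<longrightarrow>
        \<rho> g $ i $ j = (\<Sum>k\<le>n. \<Sum>l\<le>n. \<Sum>m\<le>n. \<Sum>q\<le>n.
          c k l m q * (g $ 1 $ 1) ^ k * (g $ 1 $ 2) ^ l * (g $ 2 $ 1) ^ m * (g $ 2 $ 2) ^ q))"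

definition irreducible_rep :: "(complex mat2 \<Rightarrow> complex ^ 'd ^ 'd) \<Rightarrow> bool" where
  "irreducible_rep \<rho> \<longleftrightarrow> (\<forall>W. vec.subspace W \<longrightarrow>
     (\<forall>g w. invertible g \<longrightarrow> w \<in> W \<longrightarrow> \<rho> g *v w \<in> W) \<longrightarrow> W = {0} \<or> W = UNIV)"

definition upper2 :: "complex \<Rightarrow> complex \<Rightarrow> complex \<Rightarrow> complex mat2" where
  "upper2 a x b = vector [vector [a, x], vector [0, b]]"

text \<open>The irreducible polynomial representation with a highest weight vector \<open>v\<close>, for the upper
  triangular Borel subgroup, of weight \<open>diag(a, b) \<mapsto> a\<^sup>l\<^sup>1 b\<^sup>l\<^sup>2\<close>. Polynomiality forces
  both weights to be nonnegative, so they are natural numbers.\<close>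

definition highest_weight_rep ::
  "nat \<Rightarrow> nat \<Rightarrow> (complex mat2 \<Rightarrow> complex ^ 'd ^ 'd) \<Rightarrow> bool" where
  "highest_weight_rep l1 l2 \<rho> \<longleftrightarrow>
     l2 \<le> l1 \<and> polynomial_rep \<rho> \<and> irreducible_rep \<rho> \<and>
     (\<exists>v. v \<noteq> 0 \<and> (\<forall>x. \<rho> (upper2 1 x 1) *v v = v) \<and>
        (\<forall>a b. a \<noteq> 0 \<longrightarrow> b \<noteq> 0 \<longrightarrow> \<rho> (upper2 a 0 b) *v v = (a ^ l1 * b ^ l2) *s v))"


subsection \<open>Siegel modular forms and the slash action\<close>

definition siegel_modular_form ::
  "nat \<Rightarrow> nat \<Rightarrow> nat \<Rightarrow> (complex mat2 \<Rightarrow> complex ^ 'd ^ 'd) \<Rightarrow>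
     (complex mat2 \<Rightarrow> complex ^ 'd) \<Rightarrow> bool" where
  "siegel_modular_form N l1 l2 \<rho> F \<longleftrightarrow>
     highest_weight_rep l1 l2 \<rho> \<and> holomorphic_H2 F \<and>
     (\<forall>M\<in>Gamma0 N. \<forall>z\<in>siegel_H2.
        F (moebius4 (map_matrix of_int M) z) = \<rho> (cocycle (map_matrix of_int M) z) *v F z)"

definition similitude :: "rat mat4 \<Rightarrow> rat" where
  "similitude M = (THE e. M ** Jmat ** transpose M = map_matrix ((*) e) Jmat)"

definition slash ::
  "nat \<Rightarrow> nat \<Rightarrow> (complex mat2 \<Rightarrow> complex ^ 'd ^ 'd) \<Rightarrow> (complex mat2 \<Rightarrow> complex ^ 'd) \<Rightarrow>
     rat mat4 \<Rightarrow> complex mat2 \<Rightarrow> complex ^ 'd" where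
  "slash l1 l2 \<rho> F M z =
     (of_rat (similitude M) powi (int l1 + int l2 - 3)) *s
       (matrix_inv (\<rho> (cocycle (map_matrix of_rat M) z)) *v F (moebius4 (map_matrix of_rat M) z))"


subsection \<open>The group \<open>K = Sp(4, \<int>\<^sub>p)\<close> and its cosets\<close>

text \<open>A matrix over \<open>\<int>\<^sub>p = lim \<int>/p\<^sup>n\<close> is given by a coherent sequence of integer
  matrices, the \<open>n\<close>-th one representing its reduction modulo \<open>p\<^sup>n\<close>.\<close>

definition Sp4_Zp :: "nat \<Rightarrow> (nat \<Rightarrow> int mat4) set" where
  "Sp4_Zp p = {U.
     (\<forall>n i j. [U (Suc n) $ i $ j = U n $ i $ j] (mod int p ^ n)) \<and>
     (\<forall>n i j. [(U n ** Jmat ** transpose (U n)) $ i $ j = Jmat $ i $ j] (mod int p ^ n))}"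

definition padic_divides :: "nat \<Rightarrow> nat \<Rightarrow> rat \<Rightarrow> bool" where
  "padic_divides p n x \<longleftrightarrow>
     (\<exists>a b :: int. \<not> int p dvd b \<and> x = of_int (int p ^ n * a) / of_int b)"

definition padic_tendsto :: "nat \<Rightarrow> (nat \<Rightarrow> rat mat4) \<Rightarrow> rat mat4 \<Rightarrow> bool" where
  "padic_tendsto p X L \<longleftrightarrow>
     (\<forall>n. \<exists>m0. \<forall>m\<ge>m0. \<forall>i j. padic_divides p n (X m $ i $ j - L $ i $ j))"

text \<open>For rational matrices, an equation such as \<open>M' = U M V\<close> over \<open>\<rat>\<^sub>p\<close>, with \<open>U\<close> and \<open>V\<close>
  in \<open>K\<close>, says that the rational matrices computed from the approximations of \<open>U\<close> and \<open>V\<close>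
  converge p-adically to \<open>M'\<close>.\<close>

definition in_left_coset :: "nat \<Rightarrow> rat mat4 \<Rightarrow> rat mat4 \<Rightarrow> bool" where
  "in_left_coset p M M' \<longleftrightarrow>
     (\<exists>U\<in>Sp4_Zp p. padic_tendsto p (\<lambda>n. map_matrix of_int (U n) ** M) M')"

definition in_double_coset :: "nat \<Rightarrow> rat mat4 \<Rightarrow> rat mat4 \<Rightarrow> bool" where
  "in_double_coset p M M' \<longleftrightarrow>
     (\<exists>U\<in>Sp4_Zp p. \<exists>V\<in>Sp4_Zp p.
        padic_tendsto p (\<lambda>n. map_matrix of_int (U n) ** M ** map_matrix of_int (V n)) M')"

text \<open>The sum of the \<open>F|\<gamma>\<^sub>i\<close> over \<open>K\<gamma>K = \<Squnion>\<^sub>i K\<gamma>\<^sub>i\<close> is independent of the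
  representatives only if these respect the level structure at the primes other than \<open>p\<close>. They are
  therefore taken in the group of similitudes over \<open>\<int>[1/p]\<close> with lower left block divisible by \<open>N\<close>
  and multiplier a power of \<open>p\<close>. By strong approximation it meets every left coset in \<open>K\<gamma>K\<close>,
  and two of its elements lie in the same left coset of \<open>K\<close> iff they differ by an element of
  \<open>\<Gamma>\<^sub>0(N)\<close> on the left.\<close>

definition Z_inv_p :: "nat \<Rightarrow> rat set" where
  "Z_inv_p p = {x. \<exists>(a :: int) k. x = of_int a / of_nat p ^ k}"

definition hecke_group :: "nat \<Rightarrow> nat \<Rightarrow> rat mat4 set" where
  "hecke_group N p = {M.
     (\<forall>i j. M $ i $ j \<in> Z_inv_p p) \<and>
     (\<forall>i j. \<exists>x\<in>Z_inv_p p. blockC M $ i $ j = of_nat N * x) \<and>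
     (\<exists>k :: int. M ** Jmat ** transpose M = map_matrix ((*) (of_nat p powi k)) Jmat)}"

definition left_coset :: "nat \<Rightarrow> nat \<Rightarrow> rat mat4 \<Rightarrow> rat mat4 set" where
  "left_coset N p M = {M' \<in> hecke_group N p. in_left_coset p M M'}"

definition double_coset :: "nat \<Rightarrow> nat \<Rightarrow> rat mat4 \<Rightarrow> rat mat4 set" where
  "double_coset N p M = {M' \<in> hecke_group N p. in_double_coset p M M'}"


subsection \<open>Hecke operators and eigenforms\<close>

text \<open>The action of a double coset \<open>S\<close>; a double coset consists of finitely many left cosets.\<close>

definition hecke_coset_op ::
  "nat \<Rightarrow> nat \<Rightarrow> nat \<Rightarrow> nat \<Rightarrow> (complex mat2 \<Rightarrow> complex ^ 'd ^ 'd) \<Rightarrow> rat mat4 set \<Rightarrow>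
     (complex mat2 \<Rightarrow> complex ^ 'd) \<Rightarrow> complex mat2 \<Rightarrow> complex ^ 'd" where
  "hecke_coset_op N p l1 l2 \<rho> S F z =
     (\<Sum>X \<in> left_coset N p ` S. slash l1 l2 \<rho> F (SOME M. M \<in> X) z)"

definition integral_double_cosets :: "nat \<Rightarrow> nat \<Rightarrow> nat \<Rightarrow> rat mat4 set set" where
  "integral_double_cosets N p r = double_coset N p `
     {M \<in> hecke_group N p. (\<forall>i j. M $ i $ j \<in> \<int>) \<and>
        transpose M ** Jmat ** M = map_matrix ((*) (of_nat p ^ r)) Jmat}"

definition hecke_T ::
  "nat \<Rightarrow> nat \<Rightarrow> nat \<Rightarrow> nat \<Rightarrow> nat \<Rightarrow> (complex mat2 \<Rightarrow> complex ^ 'd ^ 'd) \<Rightarrow>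
     (complex mat2 \<Rightarrow> complex ^ 'd) \<Rightarrow> complex mat2 \<Rightarrow> complex ^ 'd" where
  "hecke_T N p r l1 l2 \<rho> F z =
     (\<Sum>S \<in> integral_double_cosets N p r. hecke_coset_op N p l1 l2 \<rho> S F z)"

definition hecke_eigenform ::
  "nat \<Rightarrow> nat \<Rightarrow> nat \<Rightarrow> (complex mat2 \<Rightarrow> complex ^ 'd ^ 'd) \<Rightarrow>
     (complex mat2 \<Rightarrow> complex ^ 'd) \<Rightarrow> bool" where
  "hecke_eigenform N l1 l2 \<rho> F \<longleftrightarrow>
     siegel_modular_form N l1 l2 \<rho> F \<and> (\<exists>z\<in>siegel_H2. F z \<noteq> 0) \<and>
     (\<forall>p. prime p \<longrightarrow> \<not> p dvd N \<longrightarrow> (\<forall>M\<in>hecke_group N p. \<exists>c. \<forall>z\<in>siegel_H2.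
        hecke_coset_op N p l1 l2 \<rho> (double_coset N p M) F z = c *s F z))"

end

theory Submission
  imports Defs
begin

text \<open>Write \<open>k = \<lambda>\<^sub>1 + \<lambda>\<^sub>2\<close>. The double coset of the scalar matrix \<open>p\<close> acts on a form of weight
  \<open>(\<lambda>\<^sub>1, \<lambda>\<^sub>2)\<close> by \<open>\<delta> = p\<^sup>k\<^sup>-\<^sup>6\<close>, so it suffices to recover \<open>\<delta>\<close> from the eigenvalues.
  Left cosets of integral similitudes correspond to their row lattices in \<open>\<int>\<^sup>4\<close>, and \<open>T(p\<^sup>r)\<close> is the
  sum over all lattices of multiplier \<open>p\<^sup>r\<close>. Let \<open>R\<^sub>r\<close> be the part of this sum over the lattices whose
  reduction modulo \<open>p\<close> has rank at most one. Counting the intermediate lattices of a product gives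
  \<open>T(p\<^sup>r) T(p) = T(p\<^sup>r\<^sup>+\<^sup>1) + p R\<^sub>r\<^sub>+\<^sub>1 + (p\<^sup>2 + p\<^sup>3) \<delta> T(p\<^sup>r\<^sup>-\<^sup>1)\<close> and a similar formula for
  \<open>T(p\<^sup>r) R\<^sub>2\<close>. Eliminating the \<open>R\<^sub>r\<close> expresses \<open>a(p\<^sup>3)\<close> by \<open>a(p)\<close>, \<open>a(p\<^sup>2)\<close> and \<open>\<delta>\<close>, linearly in \<open>\<delta>\<close>
  with coefficient \<open>(p\<^sup>2 + p\<^sup>3) a(p)\<close>. If \<open>a(p) = 0\<close>, then \<open>a(p\<^sup>4)\<close> is quadratic in \<open>t = p\<^sup>2 \<delta>\<close>; two
  distinct values \<open>t, t'\<close> giving the same \<open>a(p\<^sup>4)\<close> satisfy \<open>a(p\<^sup>2) = p\<^sup>2 (t + t')\<close>, and equality of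
  \<open>a(p\<^sup>6)\<close> then forces \<open>p\<^sup>2 t t' = 0\<close>. The counts are double counts: modulo \<open>p\<close>, two independent
  orthogonal vectors lie in exactly one Lagrangian lattice, and a primitive vector lies in exactly one
  lattice of multiplier \<open>p\<^sup>2\<close> and rank one.\<close>

subsection \<open>The symplectic form modulo a prime\<close>

text \<open>Lattices enter because \<open>F|Y\<close> depends only on the left coset of
  \<open>Y\<close> under Gamma_0(N), and for integral similitudes of multiplier p^r this coset is
  determined by the row lattice. The level costs nothing: if \<open>lat A\<close> lies in
  \<open>lat B\<close>, the factor \<open>X\<close> in \<open>A = X ** B\<close> has its lower left
  block divisible by \<open>N\<close> because \<open>p\<close> is prime to \<open>N\<close>. Since
  \<open>F|X|Y = F|XY\<close> and \<open>lat (X ** Y)\<close> lies in \<open>lat Y\<close>,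
  composing operators becomes counting inclusions. In each product T(p^r) acts first, through its
  eigenvalue, and the result is slashed by representatives of the second operator; the sums R_r are
  compared with \<open>F\<close> in one coordinate at one point where \<open>F\<close> does not
  vanish. The obstacle is that cosets are given by p-adic approximation. As T(p^r) runs over all
  double cosets of its multiplier, their union is what has to be identified. A limit of p-integral
  matrices is p-integral, its entries lie in Z[1/p], and so it is integral. The exponent k - 6
  arises because the scalar matrix \<open>p\<close> has multiplier p^2, which contributes
  p^(2(k-3)), while its central character divides by p^k.\<close>

lemma index4_cases [case_names l1 l2 r1 r2]:
  fixes i :: "2 + 2"
  obtains "i = Inl 1" | "i = Inl 2" | "i = Inr 1" | "i = Inr 2"
proof (cases i)
  case (Inl k)
  then show ?thesis using that exhaust_2[of k] by auto
next
  case (Inr k)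
  then show ?thesis using that exhaust_2[of k] by auto
qed

lemma UNIV_index4: "(UNIV :: (2 + 2) set) = {Inl 1, Inl 2, Inr 1, Inr 2}"
  by (auto intro: index4_cases)

lemma sum_index4: "(\<Sum>i\<in>UNIV. f (i :: 2 + 2)) = f (Inl 1) + f (Inl 2) + f (Inr 1) + f (Inr 2)"
  by (simp add: UNIV_index4 add.assoc)

lemma all_index4: "(\<forall>i :: 2 + 2. P i) \<longleftrightarrow> P (Inl 1) \<and> P (Inl 2) \<and> P (Inr 1) \<and> P (Inr 2)"
  by (metis index4_cases)

definition vec4 :: "'a \<Rightarrow> 'a \<Rightarrow> 'a \<Rightarrow> 'a \<Rightarrow> 'a ^ (2 + 2)" where
  "vec4 a b c d = (\<chi> i. case i of Inl k \<Rightarrow> if k = 1 then a else b | Inr k \<Rightarrow> if k = 1 then c else d)"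

lemma vec4_nth [simp]:
  "vec4 a b c d $ Inl 1 = a" "vec4 a b c d $ Inl 2 = b"
  "vec4 a b c d $ Inr 1 = c" "vec4 a b c d $ Inr 2 = d"
  by (simp_all add: vec4_def)

type_synonym ivec = "int ^ (2 + 2)"

text \<open>The form \<open>u J v^T\<close> on row vectors. Rows are used because left
  multiplication by a unimodular matrix preserves their span.\<close>

definition sp :: "'a::comm_ring_1 ^ (2 + 2) \<Rightarrow> 'a ^ (2 + 2) \<Rightarrow> 'a" where
  "sp u v = u $ Inl 1 * v $ Inr 1 + u $ Inl 2 * v $ Inr 2 - u $ Inr 1 * v $ Inl 1 - u $ Inr 2 * v $ Inl 2"

lemma sp_add_left: "sp (u + u') v = sp u v + sp u' v"
  and sp_add_right: "sp u (v + v') = sp u v + sp u v'"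
  and sp_diff_right: "sp u (v - v') = sp u v - sp u v'"
  and sp_scale_left: "sp (c *s u) v = c * sp u v"
  and sp_scale_right: "sp u (c *s v) = c * sp u v"
  and sp_self [simp]: "sp u u = 0"
  and sp_swap: "sp v u = - sp u v"
  by (simp_all add: sp_def algebra_simps)

lemma Jmat_nth:
  "Jmat $ Inl i $ Inl j = 0" "Jmat $ Inr i $ Inr j = 0"
  "Jmat $ Inl i $ Inr j = of_bool (i = j)" "Jmat $ Inr i $ Inl j = - of_bool (i = j)"
  by (simp_all add: Jmat_def)

lemma Jmat_sandwich_nth:
  fixes A B :: "'a::comm_ring_1 mat4"
  shows "(A ** Jmat ** transpose B) $ i $ j = sp (A $ i) (B $ j)"
  by (simp add: matrix_matrix_mult_def transpose_def sum_index4 Jmat_nth sp_def algebra_simps)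


section \<open>Residue vectors modulo an integer\<close>

definition cube :: "int \<Rightarrow> ivec set" where
  "cube q = {v. \<forall>i. v $ i \<in> {0..<q}}"

definition vmod :: "ivec \<Rightarrow> int \<Rightarrow> ivec" where
  "vmod v q = (\<chi> i. v $ i mod q)"

definition vdvd :: "int \<Rightarrow> ivec \<Rightarrow> bool" where
  "vdvd q v \<longleftrightarrow> (\<forall>i. q dvd v $ i)"

lemma vmod_nth [simp]: "vmod v q $ i = v $ i mod q"
  by (simp add: vmod_def)

lemma vmod_in_cube: "q > 0 \<Longrightarrow> vmod v q \<in> cube q"
  by (simp add: cube_def)

lemma vmod_cube: "v \<in> cube q \<Longrightarrow> vmod v q = v"
  by (simp add: cube_def vec_eq_iff)

lemma vmod_eq_iff: "vmod u q = vmod v q \<longleftrightarrow> vdvd q (u - v)"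
  by (simp add: vdvd_def vec_eq_iff mod_eq_dvd_iff)

lemma vdvd_alt: "vdvd q v \<longleftrightarrow> (\<exists>w. v = q *s w)"
proof
  assume "vdvd q v"
  then have "\<forall>i. \<exists>k. v $ i = q * k" by (simp add: vdvd_def dvd_def)
  then obtain k where "\<forall>i. v $ i = q * k i" by metis
  then have "v = q *s (\<chi> i. k i)" by (simp add: vec_eq_iff)
  then show "\<exists>w. v = q *s w" by blast
qed (auto simp: vdvd_def)

lemma vmod_decomp: "\<exists>w. v = vmod v q + q *s w"
proof -
  have "v = vmod v q + q *s (\<chi> i. v $ i div q)"
    by (simp add: vec_eq_iff)
  then show ?thesis by blast
qed

lemma vdvd_sp: "vdvd q v \<Longrightarrow> q dvd sp u v"
  by (auto simp: vdvd_alt sp_scale_right)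

lemma dvd_sp_vmod: "d dvd q \<Longrightarrow> d dvd sp u (vmod v q) \<longleftrightarrow> d dvd sp u v"
proof -
  assume d: "d dvd q"
  obtain w where w: "v = vmod v q + q *s w" using vmod_decomp by blast
  have "sp u v = sp u (vmod v q) + q * sp u w"
    by (subst w) (simp add: sp_add_right sp_scale_right)
  then show ?thesis using d by (simp add: dvd_add_left_iff)
qed

lemma finite_cube [simp]: "finite (cube q)" and card_cube: "card (cube q) = nat q ^ 4"
proof -
  let ?f = "\<lambda>v :: ivec. (v $ Inl 1, v $ Inl 2, v $ Inr 1, v $ Inr 2)"
  have b: "bij_betw ?f (cube q) ({0..<q} \<times> {0..<q} \<times> {0..<q} \<times> {0..<q})"
    by (rule bij_betwI[where g = "\<lambda>(a, b, c, d). vec4 a b c d"])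
      (auto simp: cube_def vec_eq_iff all_index4)
  show "finite (cube q)" using bij_betw_finite[OF b] by simp
  show "card (cube q) = nat q ^ 4" using bij_betw_same_card[OF b]
    by (simp add: card_cartesian_product power4_eq_xxxx algebra_simps)
qed

lemma cube_zero: "v \<in> cube q \<Longrightarrow> vdvd q v \<Longrightarrow> v = 0"
proof -
  assume "v \<in> cube q" "vdvd q v"
  then have "v $ i = 0" for i
    using zdvd_not_zless[of "v $ i" q] by (force simp: cube_def vdvd_def order_le_less)
  then show "v = 0" by (simp add: vec_eq_iff)
qed

text \<open>A hyperplane section has all its translates of equal size.\<close>

lemma card_hyperplane_section:
  fixes q :: int
  assumes "q > 0"
    and closed: "\<And>v c. P v \<Longrightarrow> P (vmod (v + c *s t) q)"
    and t: "[sp u t = 1] (mod q)"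
  shows "card {v \<in> cube q. P v} = nat q * card {v \<in> cube q. P v \<and> q dvd sp u v}"
proof -
  let ?S = "\<lambda>c. {v \<in> cube q. P v \<and> [sp u v = c] (mod q)}"
  have sp_shift: "[sp u (vmod (v + c *s t) q) = sp u v + c] (mod q)" for v c
  proof -
    obtain w where w: "v + c *s t = vmod (v + c *s t) q + q *s w" using vmod_decomp by blast
    have "sp u (v + c *s t) = sp u (vmod (v + c *s t) q) + q * sp u w"
      by (subst w) (simp add: sp_add_right sp_scale_right)
    then have "[sp u (vmod (v + c *s t) q) = sp u (v + c *s t)] (mod q)"
      by (simp add: cong_iff_dvd_diff)
    also have "sp u (v + c *s t) = sp u v + c * sp u t"
      by (simp add: sp_add_right sp_scale_right)
    also have "[sp u v + c * sp u t = sp u v + c * 1] (mod q)"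
      by (intro cong_add cong_mult t) auto
    finally show ?thesis by simp
  qed
  have shift_back: "vmod (vmod (v + c *s t) q + (- c) *s t) q = v" if "v \<in> cube q" for v c
  proof -
    have "vmod (vmod (v + c *s t) q + (- c) *s t) q = vmod v q"
      by (simp add: vec_eq_iff mod_simps)
    then show ?thesis using vmod_cube[OF that] by simp
  qed
  have shift_back': "vmod (vmod (v + (- c) *s t) q + c *s t) q = v" if "v \<in> cube q" for v c
    using shift_back[OF that, of "- c"] by simp
  have card_S: "card (?S c) = card (?S 0)" for c
  proof -
    have "bij_betw (\<lambda>v. vmod (v + c *s t) q) (?S 0) (?S c)"
    proof (rule bij_betwI[where g = "\<lambda>v. vmod (v + (- c) *s t) q"])
      show "(\<lambda>v. vmod (v + c *s t) q) \<in> ?S 0 \<rightarrow> ?S c"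
      proof
        fix v assume v: "v \<in> ?S 0"
        have "[sp u v + c = 0 + c] (mod q)" using v by (intro cong_add) auto
        then show "vmod (v + c *s t) q \<in> ?S c"
          using v vmod_in_cube[OF assms(1)] closed cong_trans[OF sp_shift[of v c]] by simp
      qed
      show "(\<lambda>v. vmod (v + (- c) *s t) q) \<in> ?S c \<rightarrow> ?S 0"
      proof
        fix v assume v: "v \<in> ?S c"
        have "[sp u v + (- c) = c + (- c)] (mod q)" using v by (intro cong_add) auto
        then show "vmod (v + (- c) *s t) q \<in> ?S 0"
          using v vmod_in_cube[OF assms(1)] closed[of v "- c"] cong_trans[OF sp_shift[of v "- c"]] by simp
      qed
    qed (use shift_back shift_back' in blast)+
    then show ?thesis by (simp add: bij_betw_same_card)
  qed
  have "{v \<in> cube q. P v} = (\<Union>c\<in>{0..<q}. ?S c)"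
  proof (intro equalityI subsetI)
    fix v assume "v \<in> {v \<in> cube q. P v}"
    then have "v \<in> ?S (sp u v mod q)" by (simp add: cong_def)
    moreover have "sp u v mod q \<in> {0..<q}" using assms(1) by simp
    ultimately show "v \<in> (\<Union>c\<in>{0..<q}. ?S c)" by (rule UN_I[rotated])
  qed auto
  also have "card \<dots> = (\<Sum>c\<in>{0..<q}. card (?S c))"
  proof (rule card_UN_disjoint)
    show "\<forall>i\<in>{0..<q}. \<forall>j\<in>{0..<q}. i \<noteq> j \<longrightarrow> ?S i \<inter> ?S j = {}"
      by (auto simp: cong_def)
  qed auto
  also have "\<dots> = (\<Sum>c\<in>{0..<q}. card (?S 0))"
    by (rule sum.cong[OF refl], rule card_S)
  also have "\<dots> = nat q * card (?S 0)"
    by simp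
  finally show ?thesis by (simp add: cong_0_iff)
qed

section \<open>Independence and orthogonality modulo a prime\<close>

definition minor :: "ivec \<Rightarrow> ivec \<Rightarrow> 2 + 2 \<Rightarrow> 2 + 2 \<Rightarrow> int" where
  "minor u v i j = u $ i * v $ j - u $ j * v $ i"

text \<open>For prime \<open>q\<close> this is linear independence of the reductions over Z/q,
  encoded by a nonvanishing Pluecker coordinate so that all vectors stay integral.\<close>

definition indep :: "int \<Rightarrow> ivec \<Rightarrow> ivec \<Rightarrow> bool" where
  "indep q u v \<longleftrightarrow> (\<exists>i j. \<not> q dvd minor u v i j)"

lemma prime_int_inverse:
  fixes q a :: int assumes "prime q" "\<not> q dvd a"
  obtains e where "[e * a = 1] (mod q)"
proof -
  have "coprime a q" using assms by (metis prime_imp_coprime coprime_commute)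
  then show ?thesis using cong_solve_coprime_int that by (metis mult.commute)
qed

text \<open>The basis dual to the standard one under \<open>sp\<close>; it turns a unit coordinate
  of a vector into a partner of pairing 1.\<close>

definition dual :: "2 + 2 \<Rightarrow> ivec" where
  "dual i = (case i of Inl k \<Rightarrow> axis (Inr k) 1 | Inr k \<Rightarrow> axis (Inl k) (-1))"

lemma sp_dual: "sp u (dual i) = u $ i"
  by (cases i rule: index4_cases) (simp_all add: dual_def sp_def axis_def)

lemma indep_imp_nonzero: "indep q u v \<Longrightarrow> \<not> vdvd q u" "indep q u v \<Longrightarrow> \<not> vdvd q v"
  unfolding indep_def vdvd_def minor_def by (meson dvd_diff dvd_mult dvd_mult2)+

lemma sp_unit_vector:
  assumes "prime q" "\<not> vdvd q u"
  obtains t where "[sp u t = 1] (mod q)"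
proof -
  obtain i where "\<not> q dvd u $ i" using assms by (auto simp: vdvd_def)
  then obtain e where "[e * u $ i = 1] (mod q)" using prime_int_inverse assms by metis
  then have "[sp u (e *s dual i) = 1] (mod q)" by (simp add: sp_scale_right sp_dual)
  then show ?thesis by (rule that)
qed

lemma sp_unit_vector_indep:
  assumes "prime q" "indep q u v"
  obtains t where "[sp u t = 1] (mod q)" "sp v t = 0"
proof -
  obtain i j where "\<not> q dvd minor u v i j" using assms by (auto simp: indep_def)
  then obtain e where e: "[e * minor u v i j = 1] (mod q)" using prime_int_inverse assms by metis
  \<comment> \<open>The pairing of any \<open>w\<close> with this vector is
    \<open>e * minor w v i j\<close>, which vanishes for \<open>w = v\<close>.\<close>
  let ?t = "e *s (v $ j *s dual i - v $ i *s dual j)"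
  have "sp u ?t = e * minor u v i j" "sp v ?t = 0"
    by (simp_all add: sp_scale_right sp_diff_right sp_dual minor_def algebra_simps)
  then show ?thesis using e by (intro that[of ?t]) auto
qed

lemma card_orthogonal_1:
  assumes "prime q" "\<not> vdvd q u"
  shows "card {v \<in> cube q. q dvd sp u v} = nat q ^ 3"
proof -
  have q: "q > 0" using assms by (simp add: prime_gt_0_int)
  obtain t where t: "[sp u t = 1] (mod q)" using sp_unit_vector assms by metis
  have "card (cube q) = nat q * card {v \<in> cube q. q dvd sp u v}"
    using card_hyperplane_section[OF q _ t, of "\<lambda>_. True"] by simp
  then have "nat q * nat q ^ 3 = nat q * card {v \<in> cube q. q dvd sp u v}"
    by (simp add: card_cube power4_eq_xxxx power3_eq_cube mult.assoc)
  then show ?thesis using q by simp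
qed

text \<open>The translation vector for \<open>u\<close> can be chosen orthogonal to
  \<open>v\<close>, so the hyperplane orthogonal to \<open>v\<close> is itself cut into
  \<open>q\<close> equal sections by the values of \<open>sp u\<close>.\<close>

lemma card_orthogonal_2:
  assumes "prime q" "indep q u v"
  shows "card {w \<in> cube q. q dvd sp u w \<and> q dvd sp v w} = nat q ^ 2"
proof -
  have q: "q > 0" using assms by (simp add: prime_gt_0_int)
  obtain t where t: "[sp u t = 1] (mod q)" "sp v t = 0" using sp_unit_vector_indep assms by metis
  have "card {w \<in> cube q. q dvd sp v w} = nat q * card {w \<in> cube q. q dvd sp v w \<and> q dvd sp u w}"
    by (rule card_hyperplane_section[OF q _ t(1)])
      (simp add: dvd_sp_vmod sp_add_right sp_scale_right t(2))
  then have "nat q * nat q ^ 2 = nat q * card {w \<in> cube q. q dvd sp u w \<and> q dvd sp v w}"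
    using card_orthogonal_1[OF assms(1) indep_imp_nonzero(2)[OF assms(2)]]
    by (simp add: power2_eq_square power3_eq_cube conj_commute mult.assoc)
  then show ?thesis using q by simp
qed

text \<open>Both sides of the inclusion of the span in the orthogonal complement have \<open>q\<^sup>2\<close> elements.\<close>

lemma orthogonal_eq_span:
  assumes q: "prime q" and ind: "indep q u v" and uv: "q dvd sp u v"
    and w: "q dvd sp u w" "q dvd sp v w"
  obtains a b where "vdvd q (w - (a *s u + b *s v))"
proof -
  have q0: "q > 0" using q by (simp add: prime_gt_0_int)
  let ?f = "\<lambda>(a, b). vmod (a *s u + b *s v) q"
  let ?O = "{w \<in> cube q. q dvd sp u w \<and> q dvd sp v w}"
  have inj: "inj_on ?f ({0..<q} \<times> {0..<q})"
  proof (rule inj_onI, clarify)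
    fix a b a' b'
    assume ab: "a \<in> {0..<q}" "b \<in> {0..<q}" "a' \<in> {0..<q}" "b' \<in> {0..<q}"
      and eq: "vmod (a *s u + b *s v) q = vmod (a' *s u + b' *s v) q"
    obtain i j where m: "\<not> q dvd minor u v i j" using ind by (auto simp: indep_def)
    have d: "q dvd (a - a') * u $ k + (b - b') * v $ k" for k
      using eq unfolding vmod_eq_iff vdvd_def by (auto simp: algebra_simps dest: spec[of _ k])
    \<comment> \<open>Cramer's rule: eliminating the second coefficient leaves the first one times
      the minor, a unit modulo \<open>q\<close>.\<close>
    have "q dvd ((a - a') * u $ i + (b - b') * v $ i) * v $ j - ((a - a') * u $ j + (b - b') * v $ j) * v $ i"
      using d by (intro dvd_diff dvd_mult2)
    then have "q dvd (a - a') * minor u v i j" by (simp add: minor_def algebra_simps)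
    then have 1: "q dvd a - a'" using m q by (simp add: prime_dvd_mult_iff)
    have "q dvd ((a - a') * u $ j + (b - b') * v $ j) * u $ i - ((a - a') * u $ i + (b - b') * v $ i) * u $ j"
      using d by (intro dvd_diff dvd_mult2)
    then have "q dvd (b - b') * minor u v i j" by (simp add: minor_def algebra_simps)
    then have 2: "q dvd b - b'" using m q by (simp add: prime_dvd_mult_iff)
    show "a = a' \<and> b = b'" using 1 2 ab
      by (metis atLeastLessThan_iff mod_eq_dvd_iff mod_pos_pos_trivial)
  qed
  have sub: "?f ` ({0..<q} \<times> {0..<q}) \<subseteq> ?O"
    using vmod_in_cube[OF q0] uv sp_swap[of v u]
    by (auto simp: dvd_sp_vmod sp_add_right sp_scale_right)
  have "?f ` ({0..<q} \<times> {0..<q}) = ?O"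
    by (rule card_subset_eq[OF _ sub])
      (simp_all add: card_image[OF inj] card_orthogonal_2[OF q ind] power2_eq_square)
  moreover have "vmod w q \<in> ?O" using w vmod_in_cube[OF q0] by (simp add: dvd_sp_vmod)
  ultimately have "vmod w q \<in> ?f ` ({0..<q} \<times> {0..<q})" by simp
  then obtain a b where "vmod w q = vmod (a *s u + b *s v) q" by auto
  then show ?thesis using that by (simp add: vmod_eq_iff)
qed

lemma dependent_multiple:
  assumes q: "prime q" and u: "\<not> vdvd q u" and "\<not> indep q u v"
  obtains c where "c \<in> {0..<q}" "vdvd q (v - c *s u)"
proof -
  have q0: "q > 0" using q by (simp add: prime_gt_0_int)
  obtain i where i: "\<not> q dvd u $ i" using u by (auto simp: vdvd_def)
  then obtain e where e: "[e * u $ i = 1] (mod q)" using prime_int_inverse q by metis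
  \<comment> \<open>Coordinate \<open>i\<close> forces this value, \<open>e\<close> being inverse to
    \<open>u $ i\<close>; the vanishing minors against \<open>i\<close> settle the other
    coordinates.\<close>
  let ?c = "(e * v $ i) mod q"
  have "q dvd v $ j - ?c * u $ j" for j
  proof -
    have m: "q dvd minor u v i j" using assms(3) by (auto simp: indep_def)
    have "q dvd e * u $ i - 1" using e by (simp add: cong_iff_dvd_diff)
    then have "q dvd e * minor u v i j - (e * u $ i - 1) * v $ j" using m by (intro dvd_diff) auto
    then have "q dvd v $ j - (e * v $ i) * u $ j" by (simp add: minor_def algebra_simps)
    then have "[v $ j = (e * v $ i) * u $ j] (mod q)" by (simp add: cong_iff_dvd_diff)
    then have "[v $ j = ?c * u $ j] (mod q)" by (simp add: cong_def mod_simps)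
    then show ?thesis by (simp add: cong_iff_dvd_diff)
  qed
  then show ?thesis using q0 by (intro that[of ?c]) (auto simp: vdvd_def)
qed

lemma not_indep_if_multiples:
  assumes "vdvd q (u - a *s z)" "vdvd q (v - b *s z)"
  shows "\<not> indep q u v"
proof -
  obtain x y where "u - a *s z = q *s x" "v - b *s z = q *s y" using assms vdvd_alt by metis
  then have u: "u = a *s z + q *s x" and v: "v = b *s z + q *s y" by (simp_all add: algebra_simps)
  have "minor u v i j = q * (a * (z $ i * y $ j - z $ j * y $ i) + b * (x $ i * z $ j - x $ j * z $ i)
      + q * (x $ i * y $ j - x $ j * y $ i))" for i j
    unfolding minor_def u v by (simp add: algebra_simps)
  then show ?thesis by (simp add: indep_def)
qed

subsection \<open>Similitudes and their row lattices\<close>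

abbreviation mscale :: "'a::times \<Rightarrow> 'a ^ 'n ^ 'm \<Rightarrow> 'a ^ 'n ^ 'm" where
  "mscale c \<equiv> map_matrix ((*) c)"

lemma matrix_scale_left: "mscale e A ** B = mscale (e::'a::comm_ring_1) (A ** B)"
  by (simp add: vec_eq_iff matrix_matrix_mult_def sum_distrib_left mult.assoc)

lemma matrix_scale_right: "A ** mscale e B = mscale (e::'a::comm_ring_1) (A ** B)"
  by (simp add: vec_eq_iff matrix_matrix_mult_def sum_distrib_left mult.left_commute)

lemma matrix_scale_scale:
  "mscale a (mscale b A) = mscale (a * b :: 'a::comm_ring_1) A"
  by (simp add: vec_eq_iff mult.assoc)

lemma Jmat_Jmat: "Jmat ** Jmat = (mscale (-1) (mat 1) :: 'a::comm_ring_1 mat4)"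
  by (simp add: vec_eq_iff matrix_matrix_mult_def mat_def all_index4 sum_index4 Jmat_nth)

lemma transpose_Jmat: "transpose Jmat = (mscale (-1) Jmat :: 'a::comm_ring_1 mat4)"
  by (simp add: vec_eq_iff transpose_def all_index4 Jmat_nth)

lemma matrix_scale_one [simp]: "mscale (1::'a::comm_ring_1) A = A"
  by (simp add: vec_eq_iff)

lemma transpose_scale: "transpose (map_matrix f A) = map_matrix f (transpose A)"
  by (simp add: vec_eq_iff transpose_def)

text \<open>Up to the multiplier, \<open>- J M\<^sup>T J\<close> is the inverse of a similitude.\<close>

lemma similitude_transpose:
  fixes M :: "'a::field mat4"
  assumes M: "M ** Jmat ** transpose M = mscale e Jmat" and e: "e \<noteq> 0"
  shows "transpose M ** Jmat ** M = mscale e Jmat"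
proof -
  define I where "I = mscale (- 1 / e) (Jmat ** transpose M ** Jmat)"
  have "M ** I = mscale (- 1 / e) ((M ** Jmat ** transpose M) ** Jmat)"
    unfolding I_def matrix_scale_right by (simp add: matrix_mul_assoc)
  also have "\<dots> = mat 1"
    unfolding M using e by (simp add: matrix_scale_left matrix_scale_scale Jmat_Jmat)
  finally have "I ** M = mat 1" by (simp add: matrix_left_right_inverse)
  then have "mscale (- 1 / e) (Jmat ** transpose M ** Jmat ** M) = mat 1"
    unfolding I_def matrix_scale_left by (simp add: matrix_mul_assoc)
  then have "mscale e Jmat = mscale e (Jmat ** mscale (- 1 / e) (Jmat ** transpose M ** Jmat ** M))"
    by simp
  also have "\<dots> = mscale (- 1) ((Jmat ** Jmat) ** transpose M ** Jmat ** M)"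
    using e by (simp add: matrix_scale_right matrix_scale_scale matrix_mul_assoc)
  also have "\<dots> = transpose M ** Jmat ** M"
    by (simp add: Jmat_Jmat matrix_scale_left matrix_scale_scale)
  finally show ?thesis by simp
qed

lemma map_matrix_mult:
  assumes "\<And>x y. f (x + y) = f x + f y" "\<And>x y. f (x * y) = f x * f y" "f 0 = 0"
  shows "map_matrix f (A ** B) = map_matrix f A ** map_matrix f B"
  using assms by (simp add: vec_eq_iff matrix_matrix_mult_def sum_comp_morphism[of f, unfolded o_def, symmetric])

lemma map_of_int_mult [simp]:
  "map_matrix of_int (A ** B) = (map_matrix of_int A ** map_matrix of_int B :: 'a::comm_ring_1 ^ 'n ^ 'm)"
  by (rule map_matrix_mult) auto

lemma map_of_int_Jmat: "map_matrix of_int Jmat = (Jmat :: 'a::comm_ring_1 mat4)"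
  by (simp add: vec_eq_iff all_index4 Jmat_nth)

lemma map_of_int_scale:
  "map_matrix of_int (mscale c A) = mscale (of_int c :: 'a::comm_ring_1) (map_matrix of_int A)"
  by (simp add: vec_eq_iff)

lemma map_of_int_transpose:
  "map_matrix of_int (transpose A) = transpose (map_matrix of_int A :: 'a::comm_ring_1 mat4)"
  by (simp add: vec_eq_iff transpose_def)

lemma map_of_int_inj:
  "map_matrix of_int A = (map_matrix of_int B :: 'a::ring_char_0 ^ 'n ^ 'm) \<longleftrightarrow> A = B"
  by (simp add: vec_eq_iff)

lemma similitude_transpose_int:
  fixes M :: "int mat4"
  assumes M: "M ** Jmat ** transpose M = mscale e Jmat" and e: "e \<noteq> 0"
  shows "transpose M ** Jmat ** M = mscale e Jmat"
proof -
  let ?r = "map_matrix of_int :: int mat4 \<Rightarrow> rat mat4"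
  have "?r M ** Jmat ** transpose (?r M) = mscale (of_int e) Jmat"
    using arg_cong[OF M, of ?r] by (simp add: map_of_int_Jmat map_of_int_scale map_of_int_transpose)
  then have "?r (transpose M ** Jmat ** M) = ?r (mscale e Jmat)"
    using similitude_transpose[of "?r M"] e by (simp add: map_of_int_Jmat map_of_int_scale map_of_int_transpose)
  then show ?thesis by (simp only: map_of_int_inj)
qed


section \<open>Integral similitudes of p-power multiplier and level N\<close>

definition simZ :: "nat \<Rightarrow> nat \<Rightarrow> nat \<Rightarrow> int mat4 set" where
  "simZ N p s = {M. M ** Jmat ** transpose M = mscale (int p ^ s) Jmat \<and>
     (\<forall>i j. int N dvd M $ Inr i $ Inl j)}"

text \<open>A label for left cosets: it is unchanged under left multiplication by
  \<open>simZ N p 0\<close>, which is Gamma_0(N).\<close>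

definition lat :: "int mat4 \<Rightarrow> ivec set" where
  "lat M = range (\<lambda>x. x v* M)"

definition lats :: "nat \<Rightarrow> nat \<Rightarrow> nat \<Rightarrow> ivec set set" where
  "lats N p s = lat ` simZ N p s"

lemma simZ_sp:
  assumes "M \<in> simZ N p s" shows "sp (M $ i) (M $ j) = int p ^ s * Jmat $ i $ j"
  using assms Jmat_sandwich_nth[of M M i j] by (simp add: simZ_def)

lemma simZ_iff_sp:
  "M \<in> simZ N p s \<longleftrightarrow> (\<forall>i j. sp (M $ i) (M $ j) = int p ^ s * Jmat $ i $ j) \<and>
     (\<forall>i j. int N dvd M $ Inr i $ Inl j)"
  using simZ_sp[of M] by (auto simp: simZ_def vec_eq_iff Jmat_sandwich_nth)

lemma vec_mult_index4:
  fixes M :: "'a::comm_ring_1 mat4"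
  shows "x v* M = x $ Inl 1 *s M $ Inl 1 + x $ Inl 2 *s M $ Inl 2
     + x $ Inr 1 *s M $ Inr 1 + x $ Inr 2 *s M $ Inr 2"
  by (simp add: vec_eq_iff vector_matrix_mult_def sum_index4 mult.commute)

lemma row_in_lat: "M $ i \<in> lat M"
proof -
  have "M $ i = axis i 1 v* M"
    by (cases i rule: index4_cases) (simp_all add: vec_mult_index4 axis_def vec_eq_iff)
  then show ?thesis by (auto simp: lat_def)
qed

lemma lat_add: "u \<in> lat M \<Longrightarrow> v \<in> lat M \<Longrightarrow> u + v \<in> lat M"
  and lat_scale: "u \<in> lat M \<Longrightarrow> c *s u \<in> lat M"
proof -
  assume "u \<in> lat M" "v \<in> lat M"
  then obtain x y where "u = x v* M" "v = y v* M" by (auto simp: lat_def)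
  then have "u + v = (x + y) v* M" by (simp add: vec_mult_index4 vec_eq_iff algebra_simps)
  then show "u + v \<in> lat M" by (auto simp: lat_def)
next
  assume "u \<in> lat M"
  then obtain x where "u = x v* M" by (auto simp: lat_def)
  then have "c *s u = (c *s x) v* M" by (simp add: vec_mult_index4 vec_eq_iff algebra_simps)
  then show "c *s u \<in> lat M" by (auto simp: lat_def)
qed

lemma lat_diff: "u \<in> lat M \<Longrightarrow> v \<in> lat M \<Longrightarrow> u - v \<in> lat M"
proof -
  assume uv: "u \<in> lat M" "v \<in> lat M"
  have eq: "u - v = u + (- 1) *s v" by (simp add: vec_eq_iff)
  show ?thesis unfolding eq by (intro lat_add lat_scale uv)
qed

text \<open>A similitude of multiplier p^s has a row lattice equal to p^s times its dual under
  \<open>sp\<close>. Membership is thus a set of congruences and depends only on the vector modulo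
  p^s.\<close>

lemma lat_iff:
  assumes M: "M \<in> simZ N p s" and p: "p > 0"
  shows "v \<in> lat M \<longleftrightarrow> (\<forall>i. int p ^ s dvd sp (M $ i) v)"
proof
  assume "v \<in> lat M"
  then obtain x where x: "v = x v* M" by (auto simp: lat_def)
  show "\<forall>i. int p ^ s dvd sp (M $ i) v"
    unfolding x vec_mult_index4 by (simp add: sp_add_right sp_scale_right simZ_sp[OF M])
next
  assume "\<forall>i. int p ^ s dvd sp (M $ i) v"
  then have "\<forall>i. \<exists>c. sp (M $ i) v = int p ^ s * c" by (simp add: dvd_def)
  then obtain c where c: "\<And>i. sp (M $ i) v = int p ^ s * c i" by metis
  have T: "transpose M ** Jmat ** M = mscale (int p ^ s) Jmat"
    using M p by (intro similitude_transpose_int) (auto simp: simZ_def)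
  \<comment> \<open>Pairing with row \<open>Inl k\<close> isolates the coefficient of row
    \<open>Inr k\<close>, and pairing with row \<open>Inr k\<close> gives minus the coefficient of
    row \<open>Inl k\<close>.\<close>
  define x where "x = vec4 (- c (Inr 1)) (- c (Inr 2)) (c (Inl 1)) (c (Inl 2))"
  have ent: "(transpose M ** Jmat ** M) $ i $ j = M $ Inl 1 $ i * M $ Inr 1 $ j + M $ Inl 2 $ i * M $ Inr 2 $ j
      - M $ Inr 1 $ i * M $ Inl 1 $ j - M $ Inr 2 $ i * M $ Inl 2 $ j" for i j
    by (simp add: matrix_matrix_mult_def transpose_def sum_index4 Jmat_nth algebra_simps)
  have ent': "M $ Inl 1 $ i * M $ Inr 1 $ j + M $ Inl 2 $ i * M $ Inr 2 $ j
      - M $ Inr 1 $ i * M $ Inl 1 $ j - M $ Inr 2 $ i * M $ Inl 2 $ j = int p ^ s * Jmat $ i $ j" for i j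
    using ent[of i j] T by simp
  have "int p ^ s * (x v* M) $ i = int p ^ s * v $ i" for i
  proof -
    have "int p ^ s * (x v* M) $ i = - sp (M $ Inr 1) v * M $ Inl 1 $ i - sp (M $ Inr 2) v * M $ Inl 2 $ i
        + sp (M $ Inl 1) v * M $ Inr 1 $ i + sp (M $ Inl 2) v * M $ Inr 2 $ i"
      unfolding vec_mult_index4 x_def c by (simp add: algebra_simps)
    also have "\<dots> = (int p ^ s * Jmat $ Inl 1 $ i) * v $ Inr 1 * (- 1) * (-1) + (int p ^ s * Jmat $ Inl 2 $ i) * v $ Inr 2
         - (int p ^ s * Jmat $ Inr 1 $ i) * v $ Inl 1 - (int p ^ s * Jmat $ Inr 2 $ i) * v $ Inl 2"
      unfolding ent'[symmetric] sp_def by (simp add: algebra_simps)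
    also have "\<dots> = int p ^ s * v $ i"
      by (cases i rule: index4_cases) (simp_all add: Jmat_nth)
    finally show ?thesis .
  qed
  then have "v = x v* M" using p by (simp add: vec_eq_iff)
  then show "v \<in> lat M" by (auto simp: lat_def)
qed

lemma lat_sp:
  assumes M: "M \<in> simZ N p s" and "u \<in> lat M" "v \<in> lat M"
  shows "int p ^ s dvd sp u v"
proof -
  obtain x y where x: "u = x v* M" "v = y v* M" using assms by (auto simp: lat_def)
  show ?thesis
    unfolding x vec_mult_index4 by (simp add: sp_add_right sp_scale_right sp_add_left sp_scale_left simZ_sp[OF M])
qed

lemma multiple_in_lat:
  assumes "M \<in> simZ N p s" "p > 0" "vdvd (int p ^ s) v" shows "v \<in> lat M"
  using assms vdvd_sp by (simp add: lat_iff)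

lemma lat_subset_iff_rows: "lat A \<subseteq> lat B \<longleftrightarrow> (\<forall>i. A $ i \<in> lat B)"
proof
  assume "\<forall>i. A $ i \<in> lat B"
  then show "lat A \<subseteq> lat B"
    unfolding lat_def[of A] vec_mult_index4 by (auto intro!: lat_add lat_scale)
qed (use row_in_lat in blast)

lemma lat_subset_iff_factor: "lat A \<subseteq> lat B \<longleftrightarrow> (\<exists>X. A = X ** B)"
proof
  assume "lat A \<subseteq> lat B"
  then have "\<forall>i. \<exists>x. A $ i = x v* B" using row_in_lat[of A] by (force simp: lat_def)
  then obtain x where x: "\<And>i. A $ i = x i v* B" by metis
  have "A = (\<chi> i. x i) ** B"
    unfolding vec_eq_iff x by (simp add: matrix_matrix_mult_def vector_matrix_mult_def mult.commute)
  then show "\<exists>X. A = X ** B" by blast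
next
  assume "\<exists>X. A = X ** B"
  then obtain X where "A = X ** B" by blast
  then have "A $ i = X $ i v* B" for i
    by (simp add: vec_eq_iff matrix_matrix_mult_def vector_matrix_mult_def mult.commute)
  then show "lat A \<subseteq> lat B" unfolding lat_subset_iff_rows by (auto simp: lat_def)
qed

text \<open>By \<open>lat_iff\<close> a lattice is determined by its residues in the finite set
  \<open>cube (int p ^ s)\<close>.\<close>

lemma finite_lats:
  assumes p: "p > 0" shows "finite (lats N p s)"
proof -
  have q: "int p ^ s > 0" using p by simp
  have "inj_on (\<lambda>L. L \<inter> cube (int p ^ s)) (lats N p s)"
  proof (rule inj_onI)
    fix L L' assume L: "L \<in> lats N p s" "L' \<in> lats N p s"
      and eq: "L \<inter> cube (int p ^ s) = L' \<inter> cube (int p ^ s)"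
    have iff: "v \<in> K \<longleftrightarrow> vmod v (int p ^ s) \<in> K" if K: "K \<in> lats N p s" for v K
    proof -
      obtain M where M: "M \<in> simZ N p s" "K = lat M" using K by (auto simp: lats_def)
      show ?thesis unfolding M(2) lat_iff[OF M(1) p] by (simp add: dvd_sp_vmod)
    qed
    show "L = L'"
      using iff[OF L(1)] iff[OF L(2)] eq vmod_in_cube[OF q] by blast
  qed
  moreover have "finite ((\<lambda>L. L \<inter> cube (int p ^ s)) ` lats N p s)"
    by (rule finite_subset[of _ "Pow (cube (int p ^ s))"]) auto
  ultimately show ?thesis by (rule finite_imageD[rotated])
qed

lemma simZ_mult:
  assumes "A \<in> simZ N p r" "B \<in> simZ N p s" shows "A ** B \<in> simZ N p (r + s)"
proof -
  have "A ** B ** Jmat ** transpose (A ** B) = A ** (B ** Jmat ** transpose B) ** transpose A"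
    by (simp add: matrix_transpose_mul matrix_mul_assoc)
  also have "\<dots> = mscale (int p ^ (r + s)) Jmat"
    using assms by (simp add: simZ_def matrix_scale_left matrix_scale_right matrix_scale_scale power_add mult.commute)
  finally show ?thesis using assms by (simp add: simZ_def matrix_matrix_mult_def sum_index4)
qed

text \<open>The multiplier follows by cancelling that of \<open>B\<close>. For the level,
  \<open>- J B^T J\<close> is p^s times the inverse of \<open>B\<close> and has its lower left block
  divisible by \<open>N\<close> as well; so \<open>N\<close> divides p^s times the block of
  \<open>A\<close>, and p^s is prime to \<open>N\<close>.\<close>

lemma simZ_factor:
  assumes AB: "A ** B \<in> simZ N p (r + s)" and B: "B \<in> simZ N p s" and p: "p > 0" and N: "coprime N p"
  shows "A \<in> simZ N p r"
proof -
  have "mscale (int p ^ s) (A ** Jmat ** transpose A) = A ** (B ** Jmat ** transpose B) ** transpose A"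
    using B by (simp add: simZ_def matrix_scale_left matrix_scale_right)
  also have "\<dots> = A ** B ** Jmat ** transpose (A ** B)"
    by (simp add: matrix_transpose_mul matrix_mul_assoc)
  also have "\<dots> = mscale (int p ^ (r + s)) Jmat" using AB by (simp add: simZ_def)
  finally have 1: "A ** Jmat ** transpose A = mscale (int p ^ r) Jmat"
    using p by (simp add: vec_eq_iff power_add mult.commute)
  have T: "B ** (mscale (- 1) (Jmat ** transpose B ** Jmat)) = mscale (int p ^ s) (mat 1)"
    using B by (simp add: simZ_def matrix_scale_right matrix_scale_left matrix_mul_assoc matrix_scale_scale Jmat_Jmat)
  have "mscale (int p ^ s) A = (A ** B) ** mscale (- 1) (Jmat ** transpose B ** Jmat)"
    by (metis T matrix_mul_assoc matrix_mul_rid matrix_scale_right)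
  moreover have "int N dvd ((A ** B) ** mscale (- 1) (Jmat ** transpose B ** Jmat)) $ Inr i $ Inl j" for i j
  proof -
    have "int N dvd (A ** B) $ Inr i $ Inl k" for k using AB by (simp add: simZ_def)
    moreover have "int N dvd B $ Inr k $ Inl l" for k l using B by (simp add: simZ_def)
    ultimately show ?thesis using exhaust_2[of j]
      by (subst matrix_matrix_mult_def)
        (auto simp: sum_index4 matrix_matrix_mult_def transpose_def Jmat_nth intro!: dvd_add dvd_mult dvd_mult2)
  qed
  ultimately have "int N dvd int p ^ s * A $ Inr i $ Inl j" for i j
    by (metis nth_map_matrix)
  moreover have "coprime (int N) (int p ^ s)" using N by simp
  ultimately show ?thesis using 1 by (simp add: simZ_def coprime_dvd_mult_right_iff)
qed

lemma lat_subset_iff: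
  assumes "A \<in> simZ N p (r + s)" "B \<in> simZ N p s" "p > 0" "coprime N p"
  shows "lat A \<subseteq> lat B \<longleftrightarrow> (\<exists>X\<in>simZ N p r. A = X ** B)"
  using assms simZ_factor by (auto simp: lat_subset_iff_factor)

subsection \<open>Existence of lattices with prescribed reduction\<close>

lemma all_index2: "(\<forall>i :: 2. P i) \<longleftrightarrow> P 1 \<and> P 2"
  by (metis exhaust_2)

lemma lat_mult_right:
  assumes D: "D \<in> simZ N p 0" and D': "D ** D' = mat 1"
  shows "u v* D \<in> lat Y \<Longrightarrow> u \<in> lat (Y ** D')"
proof -
  assume "u v* D \<in> lat Y"
  then obtain x where "u v* D = x v* Y" by (auto simp: lat_def)
  then have "u v* D v* D' = x v* Y v* D'" by simp
  then have "u = x v* (Y ** D')" using D'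
    by (simp add: vector_matrix_mul_assoc)
  then show ?thesis by (auto simp: lat_def)
qed

text \<open>The exchange of the two hyperbolic planes. Together with lower shears by multiples of
  \<open>N\<close> it yields enough elements of Gamma_0(N) to make the first coordinate of a vector
  prime to \<open>p\<close>.\<close>

definition swapM :: "int mat4" where
  "swapM = vec4 (vec4 0 1 0 0) (vec4 1 0 0 0) (vec4 0 0 0 1) (vec4 0 0 1 0)"

definition shearM :: "int \<Rightarrow> int \<Rightarrow> int mat4" where
  "shearM a b = vec4 (vec4 1 0 0 0) (vec4 0 1 0 0) (vec4 a 0 1 0) (vec4 0 b 0 1)"

lemma swapM: "swapM \<in> simZ N p 0" "swapM ** swapM = mat 1"
  by (simp_all add: simZ_iff_sp swapM_def all_index4 all_index2 sp_def Jmat_nth vec_eq_iff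
      matrix_matrix_mult_def sum_index4 mat_def)

lemma shearM:
  "int N dvd a \<Longrightarrow> int N dvd b \<Longrightarrow> shearM a b \<in> simZ N p 0" "shearM a b ** shearM (- a) (- b) = mat 1"
  by (simp_all add: simZ_iff_sp shearM_def all_index4 all_index2 sp_def Jmat_nth vec_eq_iff
      matrix_matrix_mult_def sum_index4 mat_def)

lemma swapM_nth:
  "(u v* swapM) $ Inl 1 = u $ Inl 2" "(u v* swapM) $ Inl 2 = u $ Inl 1"
  "(u v* swapM) $ Inr 1 = u $ Inr 2" "(u v* swapM) $ Inr 2 = u $ Inr 1"
  by (simp_all add: swapM_def vec_mult_index4)

lemma shearM_nth:
  "(u v* shearM a b) $ Inl 1 = u $ Inl 1 + a * u $ Inr 1"
  "(u v* shearM a b) $ Inl 2 = u $ Inl 2 + b * u $ Inr 2"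
  "(u v* shearM a b) $ Inr 1 = u $ Inr 1" "(u v* shearM a b) $ Inr 2 = u $ Inr 2"
  by (simp_all add: shearM_def vec_mult_index4 mult.commute)

lemma sp_simZ0:
  assumes "D \<in> simZ N p 0" shows "sp (u v* D) (v v* D) = sp u v"
  unfolding vec_mult_index4[of u D] vec_mult_index4[of v D] by (simp add: sp_add_left sp_add_right sp_scale_left sp_scale_right simZ_sp[OF assms] Jmat_nth)
    (simp add: sp_def algebra_simps)

lemma indep_transform:
  assumes "D ** D' = mat 1" "indep q u v" "prime q" shows "indep q (u v* D) (v v* D)"
proof (rule ccontr)
  assume n: "\<not> indep q (u v* D) (v v* D)"
  have undo: "w v* D v* D' = w" for w
    using assms(1) by (simp add: vector_matrix_mul_assoc)
  have scale: "vdvd q (w v* E)" if "vdvd q w" for w and E :: "int mat4"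
    using that by (auto simp: vdvd_def vec_mult_index4)
  have diff: "(w - c *s w') v* E = w v* E - c *s (w' v* E)" for w w' c and E :: "int mat4"
    by (simp add: vec_mult_index4 vec_eq_iff algebra_simps)
  show False
  proof (cases "vdvd q (u v* D)")
    case True
    then show False using scale[of "u v* D" D'] indep_imp_nonzero(1)[OF assms(2)] by (simp add: undo)
  next
    case False
    then obtain c where "vdvd q (v v* D - c *s (u v* D))"
      using dependent_multiple[OF assms(3) _ n] by metis
    then have "vdvd q (v - c *s u)" using scale[of _ D'] by (metis undo diff)
    then have "\<not> indep q u v"
      by (intro not_indep_if_multiples[where a = 1 and b = c and z = u]) (auto simp: vdvd_def)
    then show False using assms(2) by simp
  qed
qed


text \<open>Cramer's rule for a symmetric matrix with entries a, b, b, c that sends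
  \<open>(u1, u2)\<close> to \<open>(u3, u4)\<close> and \<open>(v1, v2)\<close> to
  \<open>(v3, v4)\<close> modulo \<open>P\<close>. The factor \<open>e\<close> inverts the minor,
  and the isotropy relation \<open>k\<close> makes the two off-diagonal solutions agree.\<close>

lemma solve_mod_identity:
  fixes P :: int
  assumes e: "e * (u1 * v2 - u2 * v1) = 1 + P * l" and k: "u1 * v3 + u2 * v4 - u3 * v1 - u4 * v2 = P * k"
  shows "u3 - e * (v2 * u3 - u2 * v3) * u1 - e * (v2 * u4 - u2 * v4) * u2 = P * (e * u2 * k - u3 * l)"
    and "v3 - e * (v2 * u3 - u2 * v3) * v1 - e * (v2 * u4 - u2 * v4) * v2 = P * (e * v2 * k - v3 * l)"
    and "u4 - e * (v2 * u4 - u2 * v4) * u1 - e * (u1 * v4 - v1 * u4) * u2 = P * (- (u4 * l))"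
    and "v4 - e * (v2 * u4 - u2 * v4) * v1 - e * (u1 * v4 - v1 * u4) * v2 = P * (- (v4 * l))"
proof -
  have "u3 - e * (v2 * u3 - u2 * v3) * u1 - e * (v2 * u4 - u2 * v4) * u2 =
      u3 - u3 * (e * (u1 * v2 - u2 * v1)) + e * u2 * (u1 * v3 + u2 * v4 - u3 * v1 - u4 * v2)"
    by (simp add: algebra_simps)
  then show "u3 - e * (v2 * u3 - u2 * v3) * u1 - e * (v2 * u4 - u2 * v4) * u2 = P * (e * u2 * k - u3 * l)"
    unfolding e k by (simp add: algebra_simps)
  have "v3 - e * (v2 * u3 - u2 * v3) * v1 - e * (v2 * u4 - u2 * v4) * v2 =
      v3 - v3 * (e * (u1 * v2 - u2 * v1)) + e * v2 * (u1 * v3 + u2 * v4 - u3 * v1 - u4 * v2)"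
    by (simp add: algebra_simps)
  then show "v3 - e * (v2 * u3 - u2 * v3) * v1 - e * (v2 * u4 - u2 * v4) * v2 = P * (e * v2 * k - v3 * l)"
    unfolding e k by (simp add: algebra_simps)
  have "u4 - e * (v2 * u4 - u2 * v4) * u1 - e * (u1 * v4 - v1 * u4) * u2 = u4 - u4 * (e * (u1 * v2 - u2 * v1))"
    by (simp add: algebra_simps)
  then show "u4 - e * (v2 * u4 - u2 * v4) * u1 - e * (u1 * v4 - v1 * u4) * u2 = P * (- (u4 * l))"
    unfolding e by (simp add: algebra_simps)
  have "v4 - e * (v2 * u4 - u2 * v4) * v1 - e * (u1 * v4 - v1 * u4) * v2 = v4 - v4 * (e * (u1 * v2 - u2 * v1))"
    by (simp add: algebra_simps)
  then show "v4 - e * (v2 * u4 - u2 * v4) * v1 - e * (u1 * v4 - v1 * u4) * v2 = P * (- (v4 * l))"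
    unfolding e by (simp add: algebra_simps)
qed

lemma lagrangian_lattice_exists_minor:
  assumes p: "prime p" and uv: "int p dvd sp u v" and m: "\<not> int p dvd minor u v (Inl 1) (Inl 2)"
  shows "\<exists>Y\<in>simZ N p 1. u \<in> lat Y \<and> v \<in> lat Y"
proof -
  obtain e where e: "[e * minor u v (Inl 1) (Inl 2) = 1] (mod int p)"
    using prime_int_inverse m p by (metis prime_nat_int_transfer)
  define a where "a = e * (v $ Inl 2 * u $ Inr 1 - u $ Inl 2 * v $ Inr 1)"
  define b where "b = e * (v $ Inl 2 * u $ Inr 2 - u $ Inl 2 * v $ Inr 2)"
  define c where "c = e * (u $ Inl 1 * v $ Inr 2 - v $ Inl 1 * u $ Inr 2)"
  \<comment> \<open>Modulo \<open>p\<close> the plane of \<open>u\<close> and \<open>v\<close> is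
    the graph of a symmetric matrix S. The rows \<open>(1 | S)\<close> and \<open>(0 | p)\<close>
    span its preimage, and the zero lower left block satisfies every level.\<close>
  define Y :: "int mat4" where
    "Y = vec4 (vec4 1 0 a b) (vec4 0 1 b c) (vec4 0 0 (int p) 0) (vec4 0 0 0 (int p))"
  have Y: "Y \<in> simZ N p 1"
    by (simp add: simZ_iff_sp Y_def all_index4 all_index2 sp_def Jmat_nth)
  obtain l where l: "e * minor u v (Inl 1) (Inl 2) = 1 + int p * l"
    using e by (metis cong_iff_lin cong_sym)
  obtain k where k: "sp u v = int p * k" using uv by (auto simp: dvd_def)
  have e1: "e * (u $ Inl 1 * v $ Inl 2 - u $ Inl 2 * v $ Inl 1) = 1 + int p * l"
    using l by (simp add: minor_def)
  have k1: "u $ Inl 1 * v $ Inr 1 + u $ Inl 2 * v $ Inr 2 - u $ Inr 1 * v $ Inl 1 - u $ Inr 2 * v $ Inl 2 = int p * k"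
    using k by (simp add: sp_def)
  have "u $ Inr 1 - a * u $ Inl 1 - b * u $ Inl 2 = int p * (e * u $ Inl 2 * k - u $ Inr 1 * l)"
    using solve_mod_identity[OF e1 k1] unfolding a_def b_def by simp
  moreover have "v $ Inr 1 - a * v $ Inl 1 - b * v $ Inl 2 = int p * (e * v $ Inl 2 * k - v $ Inr 1 * l)"
    using solve_mod_identity[OF e1 k1] unfolding a_def b_def by simp
  moreover have "u $ Inr 2 - b * u $ Inl 1 - c * u $ Inl 2 = int p * (- (u $ Inr 2 * l))"
    using solve_mod_identity[OF e1 k1] unfolding c_def b_def by simp
  moreover have "v $ Inr 2 - b * v $ Inl 1 - c * v $ Inl 2 = int p * (- (v $ Inr 2 * l))"
    using solve_mod_identity[OF e1 k1] unfolding c_def b_def by simp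
  ultimately have "int p dvd u $ Inr 1 - a * u $ Inl 1 - b * u $ Inl 2"
    "int p dvd v $ Inr 1 - a * v $ Inl 1 - b * v $ Inl 2"
    "int p dvd u $ Inr 2 - b * u $ Inl 1 - c * u $ Inl 2"
    "int p dvd v $ Inr 2 - b * v $ Inl 1 - c * v $ Inl 2"
    by (metis dvd_triv_left)+
  then have "u \<in> lat Y \<and> v \<in> lat Y"
    using p unfolding lat_iff[OF Y prime_gt_0_nat[OF p]] all_index4
    by (simp add: Y_def sp_def algebra_simps)
  then show ?thesis using Y by blast
qed

lemma exists_transform:
  assumes "D \<in> simZ N p 0" "D' \<in> simZ N p 0" "D ** D' = mat 1" 
    and "\<exists>Y\<in>simZ N p s. u v* D \<in> lat Y \<and> v v* D \<in> lat Y"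
  shows "\<exists>Y\<in>simZ N p s. u \<in> lat Y \<and> v \<in> lat Y"
proof -
  obtain Y where Y: "Y \<in> simZ N p s" "u v* D \<in> lat Y" "v v* D \<in> lat Y" using assms by blast
  then show ?thesis
    using simZ_mult[OF Y(1) assms(2)] lat_mult_right[OF assms(1,3)] by (intro bexI[of _ "Y ** D'"]) auto
qed

text \<open>If the minor at \<open>Inl 1\<close>, \<open>Inl 2\<close> vanishes modulo
  \<open>p\<close>, isotropy forces the one at \<open>Inl 1\<close>, \<open>Inr 2\<close> to be
  nonzero. The shear that adds \<open>N\<close> times coordinate \<open>Inr 2\<close> to coordinate
  \<open>Inl 2\<close> then repairs the first minor.\<close>

lemma lagrangian_lattice_exists_lead:
  assumes p: "prime p" and N: "coprime N p" and uv: "int p dvd sp u v" and ind: "indep (int p) u v"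
    and u: "\<not> int p dvd u $ Inl 1"
  shows "\<exists>Y\<in>simZ N p 1. u \<in> lat Y \<and> v \<in> lat Y"
proof (cases "int p dvd minor u v (Inl 1) (Inl 2)")
  case False
  then show ?thesis using lagrangian_lattice_exists_minor p uv by blast
next
  case m: True
  have pp: "prime (int p)" using p by simp
  have m': "\<not> int p dvd minor u v (Inl 1) (Inr 2)"
  proof
    assume m2: "int p dvd minor u v (Inl 1) (Inr 2)"
    \<comment> \<open>Up to a multiple of \<open>sp u v\<close>, isotropy expresses the third minor
      with first index \<open>Inl 1\<close> through the other two.\<close>
    have "minor u v (Inl 1) (Inr 1) * u $ Inl 1 =
        sp u v * u $ Inl 1 - minor u v (Inl 1) (Inr 2) * u $ Inl 2 + minor u v (Inl 1) (Inl 2) * u $ Inr 2"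
      by (simp add: minor_def sp_def algebra_simps)
    also have "int p dvd \<dots>" using uv m m2 by simp
    finally have m3: "int p dvd minor u v (Inl 1) (Inr 1)" using u pp by (simp add: prime_dvd_mult_iff)
    have all: "int p dvd minor u v (Inl 1) i" for i
      using m m2 m3 by (cases i rule: index4_cases) (simp_all add: minor_def mult.commute)
    have "int p dvd minor u v i j" for i j
    proof -
      \<comment> \<open>As \<open>u $ Inl 1\<close> is a unit modulo \<open>p\<close>, the minors
        with first index \<open>Inl 1\<close> control all the others.\<close>
      have "u $ Inl 1 * minor u v i j = u $ i * minor u v (Inl 1) j - u $ j * minor u v (Inl 1) i"
        by (simp add: minor_def algebra_simps)
      then have "int p dvd u $ Inl 1 * minor u v i j" using all by simp
      then show ?thesis using u pp by (simp add: prime_dvd_mult_iff)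
    qed
    then show False using ind by (simp add: indep_def)
  qed
  let ?D = "shearM 0 (int N)" and ?D' = "shearM 0 (- int N)"
  have D: "?D \<in> simZ N p 0" "?D' \<in> simZ N p 0" "?D ** ?D' = mat 1"
    using shearM(1)[of N 0 "int N"] shearM(1)[of N 0 "- int N"] shearM(2)[of 0 "int N"] by simp_all
  have "minor (u v* ?D) (v v* ?D) (Inl 1) (Inl 2) = minor u v (Inl 1) (Inl 2) + int N * minor u v (Inl 1) (Inr 2)"
    by (simp add: minor_def shearM_nth algebra_simps)
  moreover have "\<not> int p dvd int N" using N p
    by (metis coprime_absorb_right int_dvd_int_iff not_prime_unit)
  ultimately have "\<not> int p dvd minor (u v* ?D) (v v* ?D) (Inl 1) (Inl 2)"
    using m m' pp by (simp add: dvd_add_right_iff prime_dvd_mult_iff)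
  then have "\<exists>Y\<in>simZ N p 1. u v* ?D \<in> lat Y \<and> v v* ?D \<in> lat Y"
    using p uv by (intro lagrangian_lattice_exists_minor) (simp_all add: sp_simZ0[OF D(1)])
  then show ?thesis by (rule exists_transform[OF D])
qed

text \<open>Shears in \<open>\<Gamma>\<^sub>0(N)\<close> move vectors into general position because \<open>p\<close> does not divide \<open>N\<close>.\<close>

lemma move_to_lead:
  assumes p: "prime p" and N: "coprime N p" and u: "\<not> vdvd (int p) u"
  obtains D D' where "D \<in> simZ N p 0" "D' \<in> simZ N p 0" "D ** D' = mat 1" "\<not> int p dvd (u v* D) $ Inl 1"
proof -
  have pp: "prime (int p)" using p by simp
  have pN: "\<not> int p dvd int N" using N p
    by (metis coprime_absorb_right int_dvd_int_iff not_prime_unit)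
  let ?S = "shearM (int N) 0" and ?S' = "shearM (- int N) 0"
  have S: "?S \<in> simZ N p 0" "?S' \<in> simZ N p 0" "?S ** ?S' = mat 1"
    using shearM(1)[of N "int N" 0] shearM(1)[of N "- int N" 0] shearM(2)[of "int N" 0] by simp_all
  have one: "mat 1 \<in> simZ N p 0" by (simp add: simZ_def mat_def vec_eq_iff transpose_def matrix_matrix_mult_def sum_index4 all_index4 Jmat_nth)
  have lead: "\<exists>D D'. D \<in> simZ N p 0 \<and> D' \<in> simZ N p 0 \<and> D ** D' = mat 1 \<and> \<not> int p dvd (w v* D) $ Inl 1"
    if w: "\<not> int p dvd w $ Inl 1 \<or> \<not> int p dvd w $ Inr 1" for w
  proof (cases "int p dvd w $ Inl 1")
    case False
    then show ?thesis using one by (intro exI[of _ "mat 1"]) simp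
  next
    case True
    then have "\<not> int p dvd (w v* ?S) $ Inl 1"
      using w pN pp by (simp add: shearM_nth dvd_add_right_iff prime_dvd_mult_iff)
    then show ?thesis using S by blast
  qed
  show ?thesis
  proof (cases "int p dvd u $ Inl 1 \<and> int p dvd u $ Inr 1")
    case False
    then show ?thesis using lead that by blast
  next
    case True
    then have "\<not> int p dvd u $ Inl 2 \<or> \<not> int p dvd u $ Inr 2"
      using u by (auto simp: vdvd_def all_index4)
    then obtain D D' where D: "D \<in> simZ N p 0" "D' \<in> simZ N p 0" "D ** D' = mat 1"
      "\<not> int p dvd (u v* swapM v* D) $ Inl 1" using lead[of "u v* swapM"] by (auto simp: swapM_nth)
    show ?thesis
    proof (rule that[of "swapM ** D" "D' ** swapM"])
      show "swapM ** D \<in> simZ N p 0" "D' ** swapM \<in> simZ N p 0"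
        using simZ_mult[OF swapM(1) D(1)] simZ_mult[OF D(2) swapM(1)] by simp_all
      show "swapM ** D ** (D' ** swapM) = mat 1"
        by (metis D(3) swapM(2) matrix_mul_assoc matrix_mul_rid)
      show "\<not> int p dvd (u v* (swapM ** D)) $ Inl 1"
        using D(4) by (simp add: vector_matrix_mul_assoc)
    qed
  qed
qed

lemma lagrangian_lattice_exists:
  assumes p: "prime p" and N: "coprime N p" and uv: "int p dvd sp u v" and ind: "indep (int p) u v"
  shows "\<exists>Y\<in>simZ N p 1. u \<in> lat Y \<and> v \<in> lat Y"
proof -
  obtain D D' where D: "D \<in> simZ N p 0" "D' \<in> simZ N p 0" "D ** D' = mat 1" "\<not> int p dvd (u v* D) $ Inl 1"
    using move_to_lead[OF p N indep_imp_nonzero(1)[OF ind]] by blast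
  have "\<exists>Y\<in>simZ N p 1. u v* D \<in> lat Y \<and> v v* D \<in> lat Y"
    using p uv by (intro lagrangian_lattice_exists_lead[OF p N _ _ D(4)] indep_transform[OF D(3) ind])
      (simp_all add: sp_simZ0[OF D(1)])
  then show ?thesis by (rule exists_transform[OF D(1-3)])
qed

section \<open>Rank modulo p and existence of line lattices\<close>

definition rank_le1 :: "nat \<Rightarrow> ivec set \<Rightarrow> bool" where
  "rank_le1 p L \<longleftrightarrow> (\<forall>u\<in>L. \<forall>v\<in>L. \<not> indep (int p) u v)"

definition rank0 :: "nat \<Rightarrow> ivec set \<Rightarrow> bool" where
  "rank0 p L \<longleftrightarrow> (\<forall>u\<in>L. vdvd (int p) u)"

lemma rank0_imp_rank_le1: "rank0 p L \<Longrightarrow> rank_le1 p L"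
  unfolding rank0_def rank_le1_def using indep_imp_nonzero by blast

lemma line_lattice_exists_lead:
  assumes p: "prime p" and e: "\<not> int p dvd e $ Inl 1"
  shows "\<exists>Y\<in>simZ N p 2. e \<in> lat Y \<and> (\<exists>z. \<forall>i. \<exists>c. vdvd (int p) (Y $ i - c *s z))"
proof -
  have "coprime (e $ Inl 1) (int p ^ 2)"
    using e p by (metis coprime_commute coprime_power_right_iff prime_imp_coprime prime_nat_int_transfer)
  then obtain f where f: "[e $ Inl 1 * f = 1] (mod (int p ^ 2))" using cong_solve_coprime_int by blast
  define x where "x = f * e $ Inl 2"
  define y where "y = f * e $ Inr 1"
  define w where "w = f * e $ Inr 2"
  define P where "P = int p"
  \<comment> \<open>Modulo p^2, \<open>e\<close> is a multiple of the vector
    \<open>(1, x, y, w)\<close>. The other rows are \<open>p\<close> times vectors orthogonal to it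
    modulo \<open>p\<close>, arranged so that the rows form a symplectic basis scaled by p^2; the
    lower left block is zero.\<close>
  define Y :: "int mat4" where
    "Y = vec4 (vec4 1 x y w) (vec4 0 P (P * w) 0) (vec4 0 0 (P^2) 0) (vec4 0 0 (- P * x) P)"
  have Y: "Y \<in> simZ N p 2"
    by (simp add: simZ_iff_sp Y_def all_index4 all_index2 sp_def Jmat_nth P_def power2_eq_square)
  obtain l where l: "e $ Inl 1 * f = 1 + P ^ 2 * l"
    using f unfolding P_def by (metis cong_iff_lin cong_sym)
  have l2: "P ^ 2 dvd t - f * t * e $ Inl 1" for t
  proof -
    have "t - f * t * e $ Inl 1 = t * (1 - e $ Inl 1 * f)" by (simp add: algebra_simps)
    then have "t - f * t * e $ Inl 1 = P ^ 2 * (- (l * t))" unfolding l by (simp add: algebra_simps)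
    then show ?thesis by (metis dvd_triv_left)
  qed
  note l2 = l2[of "e $ Inr 1", folded y_def] l2[of "e $ Inr 2", folded w_def] l2[of "e $ Inl 2", folded x_def]
  have "P ^ 2 dvd (e $ Inr 1 - y * e $ Inl 1) + (e $ Inr 2 - w * e $ Inl 1) * x - w * (e $ Inl 2 - x * e $ Inl 1)"
    by (rule dvd_diff[OF dvd_add[OF l2(1) dvd_mult2[OF l2(2)]] dvd_mult[OF l2(3)]])
  then have "P ^ 2 dvd sp (Y $ Inl 1) e" by (simp add: Y_def sp_def algebra_simps)
  moreover have "P ^ 2 dvd P * (e $ Inr 2 - w * e $ Inl 1)" using l2 by simp
  then have "P ^ 2 dvd sp (Y $ Inl 2) e" by (simp add: Y_def sp_def algebra_simps)
  moreover have "P ^ 2 dvd sp (Y $ Inr 1) e" by (simp add: Y_def sp_def)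
  moreover have "P ^ 2 dvd P * (e $ Inl 2 - x * e $ Inl 1)" using l2 by simp
  then have "P ^ 2 dvd - (P * (e $ Inl 2 - x * e $ Inl 1))" by simp
  then have "P ^ 2 dvd sp (Y $ Inr 2) e" by (simp add: Y_def sp_def algebra_simps)
  ultimately have "e \<in> lat Y"
    unfolding lat_iff[OF Y prime_gt_0_nat[OF p]] by (simp add: all_index4 P_def)
  moreover have "vdvd (int p) (Y $ i - (of_bool (i = Inl 1)) *s vec4 1 x y w)" for i
    by (cases i rule: index4_cases) (simp_all add: Y_def vdvd_def all_index4 P_def power2_eq_square)
  ultimately show ?thesis using Y by blast
qed

lemma vdvd_vec_mult: "vdvd q w \<Longrightarrow> vdvd q (w v* E)"
  by (auto simp: vdvd_def vector_matrix_mult_def intro!: dvd_sum)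

lemma vdvd_row_comb: "(\<And>i. vdvd q (E $ i)) \<Longrightarrow> vdvd q (x v* E)"
  by (auto simp: vdvd_def vector_matrix_mult_def intro!: dvd_sum)

lemma rank_le1_if_rows:
  assumes "\<And>i. vdvd (int p) (Y $ i - c i *s z)" shows "rank_le1 p (lat Y)"
proof -
  have "\<exists>a. vdvd (int p) (u - a *s z)" if u: "u \<in> lat Y" for u
  proof -
    obtain x where x: "u = x v* Y" using u by (auto simp: lat_def)
    have "u - (\<Sum>i\<in>UNIV. x $ i * c i) *s z = x v* (\<chi> i. Y $ i - c i *s z)"
      unfolding x vec_mult_index4 sum_index4 by (simp add: vec_eq_iff algebra_simps)
    moreover have "vdvd (int p) (x v* (\<chi> i. Y $ i - c i *s z))"
      using assms by (intro vdvd_row_comb) simp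
    ultimately show ?thesis by metis
  qed
  then show ?thesis unfolding rank_le1_def using not_indep_if_multiples by metis
qed

lemma line_lattice_exists:
  assumes p: "prime p" and N: "coprime N p" and e: "\<not> vdvd (int p) e"
  shows "\<exists>L\<in>lats N p 2. rank_le1 p L \<and> e \<in> L"
proof -
  obtain D D' where D: "D \<in> simZ N p 0" "D' \<in> simZ N p 0" "D ** D' = mat 1" "\<not> int p dvd (e v* D) $ Inl 1"
    using move_to_lead[OF p N e] by blast
  obtain Y z c where Y: "Y \<in> simZ N p 2" "e v* D \<in> lat Y" "\<And>i. vdvd (int p) (Y $ i - c i *s z)"
    using line_lattice_exists_lead[OF p D(4)] by metis
  have "(Y ** D') $ i - c i *s (z v* D') = (Y $ i - c i *s z) v* D'" for i
    by (simp add: vec_eq_iff matrix_matrix_mult_def vector_matrix_mult_def sum_index4 algebra_simps)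
  then have "vdvd (int p) ((Y ** D') $ i - c i *s (z v* D'))" for i
    using Y(3)[of i] vdvd_vec_mult by simp
  then have "rank_le1 p (lat (Y ** D'))" by (rule rank_le1_if_rows)
  moreover have "e \<in> lat (Y ** D')" by (rule lat_mult_right[OF D(1,3) Y(2)])
  moreover have "lat (Y ** D') \<in> lats N p 2" using simZ_mult[OF Y(1) D(2)] by (simp add: lats_def)
  ultimately show ?thesis by blast
qed

subsection \<open>Counting Lagrangian lattices\<close>

locale prime_level =
  fixes N p :: nat
  assumes prime: "prime p" and coprime: "coprime N p"
begin

abbreviation lats_N_p ("\<L>") where "\<L> \<equiv> lats N p"
abbreviation simZ_N_p ("\<S>") where "\<S> \<equiv> simZ N p"
abbreviation hecke_N_p ("\<H>") where "\<H> \<equiv> hecke_group N p"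
abbreviation q :: int where "q \<equiv> int p"

lemma p_gt_0: "p > 0" and p_gt_1: "p > 1" and P_gt_0: "q > 0" and prime_int: "prime q"
  using prime prime_gt_0_nat[OF prime] prime_gt_1_nat[OF prime] by auto

lemma lats_sp: "L \<in> \<L> s \<Longrightarrow> u \<in> L \<Longrightarrow> v \<in> L \<Longrightarrow> q ^ s dvd sp u v"
  unfolding lats_def using lat_sp by blast

lemma lats_closed:
  assumes "L \<in> \<L> s"
  shows "u \<in> L \<Longrightarrow> v \<in> L \<Longrightarrow> u + v \<in> L" "u \<in> L \<Longrightarrow> v \<in> L \<Longrightarrow> u - v \<in> L" "u \<in> L \<Longrightarrow> c *s u \<in> L"
    and "vdvd (q ^ s) v \<Longrightarrow> v \<in> L"
  using assms lat_add lat_diff lat_scale multiple_in_lat[OF _ p_gt_0] unfolding lats_def by blast+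

lemma lats_sp_dvd: "L \<in> \<L> s \<Longrightarrow> s > 0 \<Longrightarrow> u \<in> L \<Longrightarrow> v \<in> L \<Longrightarrow> q dvd sp u v"
  using lats_sp[of L s u v] by (meson dvd_power dvd_trans)

lemma lats_vmod:
  assumes "L \<in> \<L> s" shows "vmod w (q ^ s) \<in> L \<longleftrightarrow> w \<in> L"
proof -
  obtain x where x: "w = vmod w (q ^ s) + q ^ s *s x" using vmod_decomp by blast
  have "q ^ s *s x \<in> L" using lats_closed(4)[OF assms] by (simp add: vdvd_def)
  then show ?thesis
    using lats_closed(1,2)[OF assms] x by (metis add_diff_cancel_right')
qed

lemma not_rank_le1E:
  assumes "\<not> rank_le1 p L" obtains u v where "u \<in> L" "v \<in> L" "indep q u v"
  using assms by (auto simp: rank_le1_def)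

lemma not_rank0E:
  assumes "\<not> rank0 p L" obtains e where "e \<in> L" "\<not> vdvd q e"
  using assms by (auto simp: rank0_def)

lemma rank_le1_multiple:
  assumes "rank_le1 p L" "e \<in> L" "\<not> vdvd q e" "w \<in> L"
  obtains c f where "c \<in> {0..<q}" "w = c *s e + q *s f"
proof -
  obtain c where c: "c \<in> {0..<q}" "vdvd q (w - c *s e)"
    using dependent_multiple[OF prime_int assms(3)] assms unfolding rank_le1_def by metis
  then obtain f where "w - c *s e = q *s f" by (auto simp: vdvd_alt)
  then show ?thesis using c by (intro that[of c f]) (auto simp: algebra_simps)
qed

text \<open>If the rows were multiples of a single vector modulo \<open>p\<close>, then \<open>J\<close> would be a
  decomposable alternating form modulo \<open>p\<close>, against the Pluecker relation.\<close>

lemma lats_1_not_rank_le1: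
  assumes "L \<in> \<L> 1" shows "\<not> rank_le1 p L"
proof
  assume r: "rank_le1 p L"
  obtain Y where Y: "Y \<in> \<S> 1" "L = lat Y" using assms by (auto simp: lats_def)
  have "\<exists>z c y. \<forall>i. Y $ i = c i *s z + q *s y i"
  proof (cases "rank0 p L")
    case True
    then have "\<forall>i. \<exists>y. Y $ i = 0 *s 0 + q *s y" 
      using row_in_lat Y unfolding rank0_def by (metis vdvd_alt vector_smult_lzero add_0)
    then obtain y where "\<forall>i. Y $ i = 0 *s 0 + q *s y i" by metis
    then show ?thesis by (intro exI[of _ 0] exI[of _ "\<lambda>_. 0"] exI[of _ y])
  next
    case False
    then obtain e where e: "e \<in> L" "\<not> vdvd q e" by (rule not_rank0E)
    have "\<forall>i. \<exists>c y. Y $ i = c *s e + q *s y"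
      using rank_le1_multiple[OF r e] row_in_lat Y by metis
    then show ?thesis by metis
  qed
  then obtain z c y where zcy: "\<And>i. Y $ i = c i *s z + q *s y i" by blast
  \<comment> \<open>The Gram matrix of the rows divided by \<open>p\<close>, taken modulo
    \<open>p\<close>, is a wedge of two vectors. Its Pfaffian vanishes identically, whereas that of
    \<open>J\<close> is -1.\<close>
  define g where "g i j = c i * sp z (y j) - c j * sp z (y i)" for i j
  have "[g i j = Jmat $ i $ j] (mod q)" for i j
  proof -
    have "q * Jmat $ i $ j = q * (g i j + q * sp (y i) (y j))"
      using simZ_sp[OF Y(1), of i j] sp_swap[of z "y i"] unfolding zcy g_def
      by (simp add: sp_add_left sp_add_right sp_scale_left sp_scale_right algebra_simps)
    then have "Jmat $ i $ j = g i j + q * sp (y i) (y j)" using p_gt_0 by simp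
    then show ?thesis by (simp add: cong_iff_dvd_diff)
  qed
  then have "[g (Inl 1) (Inl 2) * g (Inr 1) (Inr 2) - g (Inl 1) (Inr 1) * g (Inl 2) (Inr 2)
        + g (Inl 1) (Inr 2) * g (Inl 2) (Inr 1) =
      Jmat $ Inl 1 $ Inl 2 * Jmat $ Inr 1 $ Inr 2 - Jmat $ Inl 1 $ Inr 1 * Jmat $ Inl 2 $ Inr 2
        + Jmat $ Inl 1 $ Inr 2 * Jmat $ Inl 2 $ Inr 1] (mod q)"
    by (intro cong_add cong_diff cong_mult)
  also have "g (Inl 1) (Inl 2) * g (Inr 1) (Inr 2) - g (Inl 1) (Inr 1) * g (Inl 2) (Inr 2)
        + g (Inl 1) (Inr 2) * g (Inl 2) (Inr 1) = 0"
    by (simp add: g_def algebra_simps)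
  finally show False using p_gt_1 by (simp add: Jmat_nth cong_iff_dvd_diff)
qed

text \<open>The lattice is isotropic modulo \<open>p\<close>, hence orthogonal to \<open>u\<close>
  and \<open>v\<close>; conversely the plane spanned by \<open>u\<close> and \<open>v\<close> is its
  own orthogonal complement, and the lattice contains all multiples of \<open>p\<close>.\<close>

lemma lagrangian_eq:
  assumes L: "L \<in> \<L> 1" and uv: "u \<in> L" "v \<in> L" "indep q u v"
  shows "L = {w. q dvd sp u w \<and> q dvd sp v w}"
proof (intro equalityI subsetI)
  fix w assume "w \<in> L"
  then show "w \<in> {w. q dvd sp u w \<and> q dvd sp v w}" using lats_sp[OF L] uv by auto
next
  fix w assume w: "w \<in> {w. q dvd sp u w \<and> q dvd sp v w}"
  obtain a b where ab: "vdvd q (w - (a *s u + b *s v))"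
    using orthogonal_eq_span[OF prime_int uv(3)] lats_sp[OF L uv(1,2)] w by auto
  have "w = (w - (a *s u + b *s v)) + (a *s u + b *s v)" by simp
  then show "w \<in> L" using ab lats_closed[OF L] uv by (metis power_one_right)
qed

lemma lagrangian_unique:
  assumes "indep q u v" "q dvd sp u v"
  shows "card {L \<in> \<L> 1. u \<in> L \<and> v \<in> L} = 1"
proof -
  obtain Y where "Y \<in> \<S> 1" "u \<in> lat Y" "v \<in> lat Y"
    using lagrangian_lattice_exists[OF prime coprime assms(2,1)] by blast
  then have Y: "lat Y \<in> \<L> 1" "u \<in> lat Y" "v \<in> lat Y" by (auto simp: lats_def)
  have "{L \<in> \<L> 1. u \<in> L \<and> v \<in> L} = {lat Y}"
    using Y lagrangian_eq[OF _ _ _ assms(1)] by blast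
  then show ?thesis by simp
qed

lemma card_lagrangian_mod:
  assumes L: "L \<in> \<L> 1" shows "card {w \<in> cube q. w \<in> L} = p ^ 2"
proof -
  obtain u v where uv: "u \<in> L" "v \<in> L" "indep q u v"
    using lats_1_not_rank_le1[OF L] by (rule not_rank_le1E)
  show ?thesis
    using card_orthogonal_2[OF prime_int uv(3)] by (subst lagrangian_eq[OF L uv]) simp
qed

lemma card_multiples:
  assumes e: "\<not> vdvd q e" shows "card {w \<in> cube q. \<not> indep q e w} = p"
proof -
  have "bij_betw (\<lambda>c. vmod (c *s e) q) {0..<q} {w \<in> cube q. \<not> indep q e w}"
    unfolding bij_betw_def
  proof (intro conjI inj_onI equalityI subsetI)
    fix a b assume ab: "a \<in> {0..<q}" "b \<in> {0..<q}" "vmod (a *s e) q = vmod (b *s e) q"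
    obtain i where i: "\<not> q dvd e $ i" using e by (auto simp: vdvd_def)
    have "q dvd (a - b) * e $ i" using ab(3) unfolding vmod_eq_iff vdvd_def by (simp add: algebra_simps)
    then have "q dvd a - b" using i prime_int by (simp add: prime_dvd_mult_iff)
    then show "a = b" using ab(1,2) by (metis atLeastLessThan_iff mod_eq_dvd_iff mod_pos_pos_trivial)
  next
    fix w assume "w \<in> (\<lambda>c. vmod (c *s e) q) ` {0..<q}"
    then obtain c where w: "w = vmod (c *s e) q" by blast
    have "vdvd q (w - c *s e)" unfolding w by (simp add: vdvd_def mod_eq_dvd_iff[symmetric])
    then have "\<not> indep q e w"
      by (intro not_indep_if_multiples[where a = 1 and z = e]) (auto simp: vdvd_def)
    then show "w \<in> {w \<in> cube q. \<not> indep q e w}" using w vmod_in_cube[OF P_gt_0] by simp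
  next
    fix w assume "w \<in> {w \<in> cube q. \<not> indep q e w}"
    then obtain c where "c \<in> {0..<q}" "vdvd q (w - c *s e)" "w \<in> cube q"
      using dependent_multiple[OF prime_int e] by blast
    then have "c \<in> {0..<q}" "w = vmod (c *s e) q"
      using vmod_eq_iff[of w "q" "c *s e"] vmod_cube[of w "q"] by auto
    then show "w \<in> (\<lambda>c. vmod (c *s e) q) ` {0..<q}" by blast
  qed
  from bij_betw_same_card[OF this] show ?thesis by simp
qed

lemma card_dependent_sub:
  assumes e: "\<not> vdvd q e" and "\<And>w. \<not> indep q e w \<Longrightarrow> P w"
  shows "card {w \<in> cube q. P w \<and> indep q e w} = card {w \<in> cube q. P w} - p"
proof -
  have "{w \<in> cube q. P w \<and> indep q e w} =
      {w \<in> cube q. P w} - {w \<in> cube q. \<not> indep q e w}" by auto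
  also have "card \<dots> = card {w \<in> cube q. P w} - card {w \<in> cube q. \<not> indep q e w}"
    using assms(2) by (intro card_Diff_subset) auto
  finally show ?thesis using card_multiples[OF e] by simp
qed

lemma not_indepD:
  assumes e: "\<not> vdvd q e" and "\<not> indep q e w"
  shows "q dvd sp e w" and "L \<in> \<L> 1 \<Longrightarrow> e \<in> L \<Longrightarrow> w \<in> L"
proof -
  obtain c f where cf: "vdvd q (w - c *s e)" using dependent_multiple[OF prime_int assms] by blast
  have eq: "w = (w - c *s e) + c *s e" by simp
  have "sp e w = sp e (w - c *s e)" by (simp add: sp_diff_right sp_scale_right)
  then show "q dvd sp e w" using vdvd_sp[OF cf] by metis
  show "w \<in> L" if "L \<in> \<L> 1" "e \<in> L"
    using lats_closed(1,3,4)[OF that(1)] that(2) cf eq by (metis power_one_right)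
qed

text \<open>Double count of pairs of such a lattice and a residue vector orthogonal to
  \<open>e\<close> and independent of it. There are \<open>p^3 - p\<close> vectors, each in one
  lattice, and each lattice holds \<open>p^2 - p\<close> of them.\<close>

lemma card_lagrangians_through:
  assumes e: "\<not> vdvd q e"
  shows "card {L \<in> \<L> 1. e \<in> L} = p + 1"
proof -
  let ?A = "{L \<in> \<L> 1. e \<in> L}" and ?E = "{w \<in> cube q. q dvd sp e w \<and> indep q e w}"
  have "(\<Sum>L\<in>?A. card {w \<in> ?E. w \<in> L}) = 1 * card ?E"
  proof (rule sum_multicount)
    show "\<forall>w\<in>?E. card {L \<in> ?A. w \<in> L} = 1"
      using lagrangian_unique[of e] by (simp add: conj_assoc)
  qed (use finite_lats[OF p_gt_0] in auto)
  moreover have "card {w \<in> ?E. w \<in> L} = p ^ 2 - p" if L: "L \<in> ?A" for L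
  proof -
    have "{w \<in> ?E. w \<in> L} = {w \<in> cube q. w \<in> L \<and> indep q e w}"
      using L lats_sp[of L 1 e] by auto
    also have "card \<dots> = card {w \<in> cube q. w \<in> L} - p"
      using not_indepD[OF e] L by (intro card_dependent_sub[OF e]) auto
    finally show ?thesis using card_lagrangian_mod L by simp
  qed
  moreover have "card ?E = p ^ 3 - p"
    using card_dependent_sub[OF e, of "\<lambda>w. q dvd sp e w"] not_indepD[OF e] card_orthogonal_1[OF prime_int e]
    by simp
  ultimately have "card ?A * (p ^ 2 - p) = p ^ 3 - p" by simp
  also have "\<dots> = (p + 1) * (p ^ 2 - p)"
    by (simp add: power2_eq_square power3_eq_cube algebra_simps)
  finally have eq: "card ?A * (p ^ 2 - p) = (p + 1) * (p ^ 2 - p)" .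
  have "p ^ 2 - p \<noteq> 0" using p_gt_1 by (simp add: power2_eq_square)
  then show ?thesis using eq by (rule iffD1[OF mult_right_cancel])
qed

text \<open>Double count of pairs of a Lagrangian lattice and a nonzero residue vector in it: the
  number is \<open>(p + 1) (p^4 - 1) / (p^2 - 1)\<close>.\<close>

lemma card_lagrangians: "card (\<L> 1) = 1 + p + p ^ 2 + p ^ 3"
proof -
  let ?E = "{w \<in> cube q. \<not> vdvd q w}"
  have cube0: "{w \<in> cube q. vdvd q w} = {0}"
    using cube_zero P_gt_0 by (auto simp: cube_def vdvd_def)
  have sub: "card {w \<in> cube q. P w \<and> \<not> vdvd q w} = card {w \<in> cube q. P w} - 1" 
    if "P 0" for P
  proof -
    have "{w \<in> cube q. P w \<and> \<not> vdvd q w} = {w \<in> cube q. P w} - {0}"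
      using cube0 by auto
    moreover have "0 \<in> {w \<in> cube q. P w}" using that cube0 by auto
    ultimately show ?thesis by (simp add: card_Diff_subset)
  qed
  have "(\<Sum>L\<in>\<L> 1. card {w \<in> ?E. w \<in> L}) = (p + 1) * card ?E"
    by (rule sum_multicount) (use finite_lats[OF p_gt_0] card_lagrangians_through in auto)
  moreover have "card {w \<in> ?E. w \<in> L} = p ^ 2 - 1" if L: "L \<in> \<L> 1" for L
  proof -
    have "{w \<in> ?E. w \<in> L} = {w \<in> cube q. w \<in> L \<and> \<not> vdvd q w}" by auto
    then show ?thesis using sub[of "\<lambda>w. w \<in> L"] card_lagrangian_mod[OF L] lats_closed(4)[OF L, of 0]
      by (simp add: vdvd_def)
  qed
  moreover have "card ?E = p ^ 4 - 1" using sub[of "\<lambda>_. True"] by (simp add: card_cube)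
  ultimately have "card (\<L> 1) * (p ^ 2 - 1) = (p + 1) * (p ^ 4 - 1)" by simp
  also have "\<dots> = (1 + p + p ^ 2 + p ^ 3) * (p ^ 2 - 1)"
    using p_gt_0 by (cases p) (simp_all add: algebra_simps power2_eq_square power3_eq_cube power4_eq_xxxx)
  finally have eq: "card (\<L> 1) * (p ^ 2 - 1) = (1 + p + p ^ 2 + p ^ 3) * (p ^ 2 - 1)" .
  have "p ^ 2 - 1 \<noteq> 0" using p_gt_1 power_gt_expt[of p 2] by simp
  then show ?thesis using eq by (rule iffD1[OF mult_right_cancel])
qed

text \<open>A Lagrangian lattice contains all multiples of \<open>p\<close>, so only the reduction
  of \<open>Z\<close> matters: rank two determines the lattice, rank one leaves \<open>p + 1\<close>
  choices, rank zero leaves all. The indicators are nested, so each coefficient is the increment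
  over the previous rank.\<close>

lemma card_lagrangians_above:
  assumes Z: "Z \<in> \<L> s" and s: "s > 0"
  shows "card {L \<in> \<L> 1. Z \<subseteq> L} =
    1 + p * of_bool (rank_le1 p Z) + (p ^ 2 + p ^ 3) * of_bool (rank0 p Z)"
proof -
  consider "rank0 p Z" | "\<not> rank0 p Z" "rank_le1 p Z" | "\<not> rank_le1 p Z" by blast
  then show ?thesis
  proof cases
    case 1
    then have "{L \<in> \<L> 1. Z \<subseteq> L} = \<L> 1"
      using lats_closed(4)[of _ 1] unfolding rank0_def by auto
    then show ?thesis using 1 rank0_imp_rank_le1[OF 1] card_lagrangians by simp
  next
    case 2
    then obtain e where e: "e \<in> Z" "\<not> vdvd q e" by (elim not_rank0E)
    have "{L \<in> \<L> 1. Z \<subseteq> L} = {L \<in> \<L> 1. e \<in> L}"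
      using e not_indepD(2)[OF e(2)] 2(2) unfolding rank_le1_def by blast
    then show ?thesis using 2 card_lagrangians_through[OF e(2)] by simp
  next
    case 3
    then obtain u v where uv: "u \<in> Z" "v \<in> Z" "indep q u v" by (elim not_rank_le1E)
    have "{L \<in> \<L> 1. Z \<subseteq> L} = {L \<in> \<L> 1. u \<in> L \<and> v \<in> L}"
      using uv lagrangian_eq[OF _ _ _ uv(3)] lats_sp_dvd[OF Z s] by blast
    then show ?thesis
      using 3 rank0_imp_rank_le1 lagrangian_unique[OF uv(3) lats_sp_dvd[OF Z s uv(1,2)]] by auto
  qed
qed

end

subsection \<open>Counting line lattices\<close>

context prime_level begin

text \<open>The row lattices of the cosets in \<open>K diag(1, p, p\<^sup>2, p) K\<close> and \<open>K p K\<close>.\<close>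

definition line_lats :: "ivec set set" where
  "line_lats = {L \<in> \<L> 2. rank_le1 p L}"

definition stretch :: "ivec set \<Rightarrow> ivec set" where
  "stretch L = (\<lambda>v. q *s v) ` L"

text \<open>A line lattice is \<open>Z e + p e^perp\<close>, with orthogonality taken modulo
  \<open>p\<close>. Writing \<open>w = c e + p f\<close> by the rank condition, divisibility of
  \<open>sp e w\<close> by p^2 is orthogonality of \<open>f\<close>; conversely such
  \<open>p f\<close> pairs with every row to a multiple of p^2.\<close>

lemma line_lattice_eq:
  assumes L: "L \<in> line_lats" and e: "e \<in> L" "\<not> vdvd q e"
  shows "w \<in> L \<longleftrightarrow> (\<exists>c f. c \<in> {0..<q} \<and> w = c *s e + q *s f \<and> q dvd sp e f)"
    and "q dvd sp e f \<Longrightarrow> c *s e + q *s f \<in> L"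
proof -
  have L2: "L \<in> \<L> 2" and r: "rank_le1 p L" using L by (auto simp: line_lats_def)
  have dec: "\<exists>c f. c \<in> {0..<q} \<and> w = c *s e + q *s f \<and> q dvd sp e f" if w: "w \<in> L" for w
  proof -
    obtain c f where cf: "c \<in> {0..<q}" "w = c *s e + q *s f"
      by (rule rank_le1_multiple[OF r e w])
    have "q ^ 2 dvd q * sp e f"
      using lats_sp[OF L2 e(1) w] unfolding cf by (simp add: sp_add_right sp_scale_right)
    then have "q dvd sp e f" using p_gt_0 by (simp add: power2_eq_square)
    then show ?thesis using cf by blast
  qed
  have mem: "c *s e + q *s f \<in> L" if f: "q dvd sp e f" for c f
  proof -
    obtain Y where Y: "Y \<in> \<S> 2" "L = lat Y" using L2 by (auto simp: lats_def)
    have "q ^ 2 dvd sp (Y $ i) (q *s f)" for i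
    proof -
      obtain a g where ag: "Y $ i = a *s e + q *s g" 
        using dec[of "Y $ i"] row_in_lat Y(2) by blast
      have "q dvd sp (Y $ i) f" using f unfolding ag by (simp add: sp_add_left sp_scale_left)
      then show ?thesis by (simp add: sp_scale_right power2_eq_square)
    qed
    then have "q *s f \<in> L" using lat_iff[OF Y(1) p_gt_0] Y(2) by simp
    then show ?thesis using lats_closed(1,3)[OF L2] e(1) by blast
  qed
  show "w \<in> L \<longleftrightarrow> (\<exists>c f. c \<in> {0..<q} \<and> w = c *s e + q *s f \<and> q dvd sp e f)"
    using dec mem by blast
  show "q dvd sp e f \<Longrightarrow> c *s e + q *s f \<in> L" by (rule mem)
qed

lemma line_lattice_unique:
  assumes e: "\<not> vdvd q e" shows "card {L \<in> line_lats. e \<in> L} = 1"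
proof -
  obtain L where L: "L \<in> line_lats" "e \<in> L"
    using line_lattice_exists[OF prime coprime e] unfolding line_lats_def by blast
  have "{L \<in> line_lats. e \<in> L} = {L}"
  proof (intro equalityI subsetI)
    fix K assume "K \<in> {L \<in> line_lats. e \<in> L}"
    then have "w \<in> K \<longleftrightarrow> w \<in> L" for w
      using line_lattice_eq(1)[OF _ _ e, of K w] line_lattice_eq(1)[OF L e, of w] by blast
    then show "K \<in> {L}" by auto
  qed (use L in auto)
  then show ?thesis by simp
qed

lemma stretch_lat: "stretch (lat Y) = lat (mscale q Y)"
proof -
  have "q *s (x v* Y) = x v* mscale q Y" for x
    by (simp add: vec_eq_iff vector_matrix_mult_def sum_distrib_left mult.left_commute mult.commute)
  then show ?thesis by (auto simp: stretch_def lat_def image_image)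
qed

lemma simZ_stretch_iff: "mscale q Y \<in> \<S> (s + 2) \<longleftrightarrow> Y \<in> \<S> s"
proof -
  have row: "mscale q Y $ i = q *s Y $ i" for i by (simp add: vec_eq_iff)
  have "algebraic_semidom_class.coprime (int N) q" using coprime by simp
  then show ?thesis using p_gt_0
    by (simp add: simZ_iff_sp row sp_scale_left sp_scale_right power_add power2_eq_square
        coprime_dvd_mult_right_iff ac_simps)
qed

lemma stretch_in_lats: "Z \<in> \<L> s \<Longrightarrow> stretch Z \<in> \<L> (s + 2)"
  unfolding lats_def using stretch_lat simZ_stretch_iff by auto

lemma rank0_stretch: "rank0 p (stretch Z)"
  by (auto simp: rank0_def stretch_def vdvd_def)

lemma rank0_lats:
  assumes Z: "Z \<in> \<L> (s + 2)" and "rank0 p Z" shows "Z \<in> stretch ` \<L> s"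
proof -
  obtain Y where Y: "Y \<in> \<S> (s + 2)" "Z = lat Y" using Z by (auto simp: lats_def)
  have "\<forall>i. \<exists>y. Y $ i = q *s y"
    using assms(2) row_in_lat Y(2) unfolding rank0_def vdvd_alt by blast
  then obtain y where y: "\<And>i. Y $ i = q *s y i" by metis
  then have "Y = mscale q (\<chi> i. y i)" by (simp add: vec_eq_iff)
  then show ?thesis
    using Y simZ_stretch_iff stretch_lat unfolding lats_def by (metis image_eqI)
qed

lemma rank0_lats_eq: "{Z \<in> \<L> (s + 2). rank0 p Z} = stretch ` \<L> s"
  using rank0_lats stretch_in_lats rank0_stretch by blast

lemma inj_stretch: "inj stretch"
proof (rule injI)
  have *: "q *s v \<in> stretch A \<longleftrightarrow> v \<in> A" for v A
  proof
    assume "q *s v \<in> stretch A"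
    then obtain u where u: "u \<in> A" "q *s v = q *s u" by (auto simp: stretch_def)
    have "v = u" using u(2) p_gt_0 by (simp add: vec_eq_iff)
    then show "v \<in> A" using u(1) by simp
  qed (simp add: stretch_def)
  fix A B assume "stretch A = stretch B"
  then show "A = B" using *[of _ A] *[of _ B] by blast
qed

lemma rank0_lats_1: "{Z \<in> \<L> 1. rank0 p Z} = {}" "{Z \<in> \<L> 1. rank_le1 p Z} = {}"
  using lats_1_not_rank_le1 rank0_imp_rank_le1 by auto

lemma rank0_line_lats: "{L \<in> line_lats. rank0 p L} = {{v. vdvd q v}}"
proof -
  have one: "mat 1 \<in> \<S> 0"
    by (simp add: simZ_iff_sp all_index4 all_index2 mat_def sp_def Jmat_nth)
  have "lat (mat 1) = UNIV" by (auto simp: lat_def)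
  then have "stretch UNIV \<in> \<L> 2"
    using stretch_in_lats[of "lat (mat 1)" 0] one by (auto simp: lats_def numeral_2_eq_2)
  moreover have P: "stretch UNIV = {v. vdvd q v}" by (auto simp: stretch_def vdvd_alt)
  moreover have "L = stretch UNIV" if L: "L \<in> \<L> 2" "rank0 p L" for L
  proof -
    obtain Y where Y: "Y \<in> \<S> 2" "L = lat Y" using L by (auto simp: lats_def)
    \<comment> \<open>The rows and \<open>v\<close> are all multiples of \<open>p\<close>, so their
      pairings are divisible by p^2 and \<open>lat_iff\<close> applies.\<close>
    have "v \<in> L" if "vdvd q v" for v
    proof -
      obtain w where w: "v = q *s w" using \<open>vdvd q v\<close> unfolding vdvd_alt by blast
      have "q ^ 2 dvd sp (Y $ i) v" for i
      proof -
        have "Y $ i \<in> L" using row_in_lat Y(2) by blast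
        then obtain y where "Y $ i = q *s y" using L(2) unfolding rank0_def vdvd_alt by blast
        then show ?thesis by (simp add: w sp_scale_left sp_scale_right power2_eq_square)
      qed
      then show ?thesis using lat_iff[OF Y(1) p_gt_0] Y(2) by simp
    qed
    then show ?thesis using L(2) unfolding P rank0_def by blast
  qed
  ultimately have "K = stretch UNIV \<longleftrightarrow> K \<in> {L \<in> line_lats. rank0 p L}" for K
    using rank0_stretch[of UNIV] rank0_imp_rank_le1[of p K] unfolding line_lats_def by blast
  then show ?thesis using P by blast
qed

text \<open>Modulo p^2 such a vector is uniquely \<open>c e + p f\<close> with \<open>c\<close>
  nonzero modulo \<open>p\<close> and \<open>f\<close> one of the p^3 residues orthogonal to
  \<open>e\<close>.\<close>

lemma card_primitive_line:
  assumes L: "L \<in> line_lats" and r: "\<not> rank0 p L"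
  shows "card {w \<in> cube (q ^ 2). \<not> vdvd q w \<and> w \<in> L} = (p - 1) * p ^ 3"
proof -
  obtain e where e: "e \<in> L" "\<not> vdvd q e" using r by (rule not_rank0E)
  obtain i where i: "\<not> q dvd e $ i" using e by (auto simp: vdvd_def)
  have L2: "L \<in> \<L> 2" using L by (simp add: line_lats_def)
  have P2: "q ^ 2 > 0" using p_gt_0 by simp
  have dd: "q dvd q ^ 2" by (simp add: power2_eq_square)
  let ?F = "\<lambda>(c, f). vmod (c *s e + q *s f) (q ^ 2)"
  have "bij_betw ?F ({1..<q} \<times> {f \<in> cube q. q dvd sp e f})
     {w \<in> cube (q ^ 2). \<not> vdvd q w \<and> w \<in> L}"
    unfolding bij_betw_def
  proof (intro conjI inj_onI equalityI subsetI)
    fix x y assume xy: "x \<in> {1..<q} \<times> {f \<in> cube q. q dvd sp e f}"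
      "y \<in> {1..<q} \<times> {f \<in> cube q. q dvd sp e f}" "?F x = ?F y"
    obtain c f c' f' where [simp]: "x = (c, f)" "y = (c', f')" by (metis surj_pair)
    have d: "q ^ 2 dvd (c - c') * e $ j + q * (f $ j - f' $ j)" for j
      using xy(3) by (simp add: vmod_eq_iff vdvd_def algebra_simps)
    have "q dvd (c - c') * e $ i + q * (f $ i - f' $ i)" by (rule dvd_trans[OF dd d])
    then have "q dvd (c - c') * e $ i" by (simp add: dvd_add_left_iff)
    then have "q dvd c - c'" using i prime_int by (simp add: prime_dvd_mult_iff)
    then have c: "c = c'" using xy(1,2)
      by simp (metis mod_eq_dvd_iff mod_pos_pos_trivial order_trans zero_le_one)
    have "q dvd f $ j - f' $ j" for j using d[of j] p_gt_0 by (simp add: c power2_eq_square)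
    then have "vmod f q = vmod f' q" by (simp add: vmod_eq_iff vdvd_def)
    then have "f = f'" using xy(1,2) vmod_cube by simp
    then show "x = y" using c by simp
  next
    fix w assume "w \<in> ?F ` ({1..<q} \<times> {f \<in> cube q. q dvd sp e f})"
    then obtain c f where cf: "c \<in> {1..<q}" "q dvd sp e f" "w = vmod (c *s e + q *s f) (q ^ 2)"
      by auto
    have "c *s e + q *s f \<in> L" by (rule line_lattice_eq(2)[OF L e cf(2)])
    then have wL: "w \<in> L" using lats_vmod[OF L2] cf(3) by simp
    have "\<not> q dvd c" using cf(1) zdvd_not_zless[of c "q"] by auto
    then have "\<not> q dvd c * e $ i" using i prime_int by (simp add: prime_dvd_mult_iff)
    then have "\<not> q dvd w $ i"
      using dd unfolding cf(3) by (simp add: dvd_mod_iff dvd_add_left_iff)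
    then have "\<not> vdvd q w" by (auto simp: vdvd_def)
    then show "w \<in> {w \<in> cube (q ^ 2). \<not> vdvd q w \<and> w \<in> L}"
      using wL vmod_in_cube[OF P2] cf(3) by simp
  next
    fix w assume w: "w \<in> {w \<in> cube (q ^ 2). \<not> vdvd q w \<and> w \<in> L}"
    then obtain c f where cf: "c \<in> {0..<q}" "w = c *s e + q *s f" "q dvd sp e f"
      using line_lattice_eq(1)[OF L e, of w] by blast
    have "c \<noteq> 0" using w cf(2) by (auto simp: vdvd_def)
    then have c: "c \<in> {1..<q}" using cf(1) by auto
    obtain g where g: "f = vmod f q + q *s g" using vmod_decomp by blast
    have "w - (c *s e + q *s vmod f q) = q ^ 2 *s g"
      unfolding cf(2) by (subst g) (simp add: vec_eq_iff algebra_simps power2_eq_square)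
    then have "vmod w (q ^ 2) = vmod (c *s e + q *s vmod f q) (q ^ 2)"
      unfolding vmod_eq_iff by (simp add: vdvd_def)
    then have "w = ?F (c, vmod f q)" using w vmod_cube by simp
    moreover have "vmod f q \<in> {f \<in> cube q. q dvd sp e f}"
      using cf(3) vmod_in_cube[OF P_gt_0] by (simp add: dvd_sp_vmod)
    ultimately show "w \<in> ?F ` ({1..<q} \<times> {f \<in> cube q. q dvd sp e f})"
      using c by blast
  qed
  from bij_betw_same_card[OF this] show ?thesis
    using p_gt_0 by (simp add: card_cartesian_product card_orthogonal_1[OF prime_int e(2)] nat_diff_distrib)
qed

text \<open>Each nonzero residue has p^4 lifts to a vector modulo p^2, and the residue 0 is the one
  excluded by primitivity.\<close>

lemma card_primitive_lifts:
  fixes S :: "ivec set"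
  assumes "S \<subseteq> cube q" "0 \<in> S"
  shows "card {w \<in> cube (q ^ 2). \<not> vdvd q w \<and> vmod w q \<in> S} = (card S - 1) * p ^ 4"
proof -
  let ?F = "\<lambda>(s, t). s + q *s t"
  have vm: "vmod (s + q *s t) q = s" if "s \<in> cube q" for s t
    using vmod_cube[OF that] by (simp add: vec_eq_iff)
  have "bij_betw ?F ((S - {0}) \<times> cube q) {w \<in> cube (q ^ 2). \<not> vdvd q w \<and> vmod w q \<in> S}"
    unfolding bij_betw_def
  proof (intro conjI inj_onI equalityI subsetI)
    fix x y assume xy: "x \<in> (S - {0}) \<times> cube q" "y \<in> (S - {0}) \<times> cube q" "?F x = ?F y"
    obtain s t s' t' where [simp]: "x = (s, t)" "y = (s', t')" by (metis surj_pair)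
    have "s = s'" using xy vm[of s t] vm[of s' t'] assms(1) by auto
    then show "x = y" using xy(3) p_gt_0 by (simp add: vec_eq_iff)
  next
    fix w assume "w \<in> ?F ` ((S - {0}) \<times> cube q)"
    then obtain s t where st: "s \<in> S" "s \<noteq> 0" "t \<in> cube q" "w = s + q *s t" by auto
    have sc: "s \<in> cube q" using st assms by auto
    have "0 \<le> s $ i + q * t $ i \<and> s $ i + q * t $ i < q ^ 2" for i
    proof -
      have "0 \<le> s $ i" "s $ i < q" "0 \<le> t $ i" "t $ i + 1 \<le> q" using sc st(3) by (auto simp: cube_def zless_imp_add1_zle)
      moreover have "q * (t $ i + 1) \<le> q * q" using calculation by (intro mult_left_mono) auto
      ultimately show ?thesis by (simp add: power2_eq_square algebra_simps)
    qed
    then have "w \<in> cube (q ^ 2)" by (simp add: cube_def st(4))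
    moreover have "\<not> vdvd q w"
    proof
      assume "vdvd q w"
      then have "vdvd q s" unfolding st(4) by (simp add: vdvd_def dvd_add_left_iff)
      then show False using cube_zero[OF sc] st(2) by simp
    qed
    ultimately show "w \<in> {w \<in> cube (q ^ 2). \<not> vdvd q w \<and> vmod w q \<in> S}"
      using vm[OF sc] st by simp
  next
    fix w assume w: "w \<in> {w \<in> cube (q ^ 2). \<not> vdvd q w \<and> vmod w q \<in> S}"
    define t where "t = (\<chi> i. w $ i div q)"
    have "w = vmod w q + q *s t" by (simp add: t_def vec_eq_iff)
    moreover have "vmod w q \<noteq> 0"
      using w by (auto simp: vdvd_def vec_eq_iff dvd_eq_mod_eq_0)
    moreover have "t $ i \<in> {0..<q}" for i
    proof -
      have b: "0 \<le> w $ i" "w $ i < q * q" using w by (auto simp: cube_def power2_eq_square)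
      have "q * (w $ i div q) \<le> w $ i"
        using mult_div_mod_eq[of "q" "w $ i"] pos_mod_sign[OF P_gt_0, of "w $ i"] by linarith
      then have "q * (w $ i div q) < q * q" using b by linarith
      then show ?thesis using b P_gt_0 by (simp add: t_def pos_imp_zdiv_nonneg_iff)
    qed
    then have "t \<in> cube q" by (simp add: cube_def)
    ultimately show "w \<in> ?F ` ((S - {0}) \<times> cube q)" using w by (force intro!: image_eqI[of _ _ "(vmod w q, t)"])
  qed
  from bij_betw_same_card[OF this] show ?thesis
    using assms by (simp add: card_cartesian_product card_cube)
qed

section \<open>Line lattices above a given lattice\<close>

definition perp :: "ivec set \<Rightarrow> ivec set" where
  "perp Z = {v \<in> cube q. \<forall>f\<in>Z. q dvd sp f v}"

text \<open>As \<open>s > 0\<close>, the reduction of \<open>Z\<close> is isotropic, of dimension 0,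
  1 or 2; its orthogonal complement has the complementary dimension.\<close>

lemma card_perp:
  assumes Z: "Z \<in> \<L> s" and s: "s > 0"
  shows "card (perp Z) = (if rank0 p Z then p ^ 4 else if rank_le1 p Z then p ^ 3 else p ^ 2)"
proof -
  consider "rank0 p Z" | "\<not> rank0 p Z" "rank_le1 p Z" | "\<not> rank_le1 p Z" by blast
  then show ?thesis
  proof cases
    case 1
    have "q dvd sp f v" if "f \<in> Z" for f v
      using 1 that vdvd_sp[of "q" f v] sp_swap[of f v] unfolding rank0_def by simp
    then have "perp Z = cube q" by (auto simp: perp_def)
    then show ?thesis using 1 by (simp add: card_cube)
  next
    case 2
    then obtain e where e: "e \<in> Z" "\<not> vdvd q e" by (elim not_rank0E)
    have "q dvd sp f v" if f: "f \<in> Z" and v: "q dvd sp e v" for f v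
    proof -
      obtain c g where "f = c *s e + q *s g" by (rule rank_le1_multiple[OF 2(2) e f])
      then show ?thesis using v by (simp add: sp_add_left sp_scale_left)
    qed
    then have "perp Z = {v \<in> cube q. q dvd sp e v}" using e by (auto simp: perp_def)
    then show ?thesis using 2 card_orthogonal_1[OF prime_int e(2)] by simp
  next
    case 3
    then obtain u v where uv: "u \<in> Z" "v \<in> Z" "indep q u v" by (elim not_rank_le1E)
    note sp0 = lats_sp_dvd[OF Z s]
    have "q dvd sp f w" if f: "f \<in> Z" and w: "q dvd sp u w" "q dvd sp v w" for f w
    proof -
      obtain a b where "vdvd q (f - (a *s u + b *s v))"
        using orthogonal_eq_span[OF prime_int uv(3) sp0[OF uv(1,2)] sp0[OF uv(1) f] sp0[OF uv(2) f]] by blast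
      then obtain g where "f - (a *s u + b *s v) = q *s g" by (auto simp: vdvd_alt)
      then have "f = a *s u + b *s v + q *s g" by (simp add: algebra_simps)
      then show ?thesis using w by (simp add: sp_add_left sp_scale_left)
    qed
    then have "perp Z = {w \<in> cube q. q dvd sp u w \<and> q dvd sp v w}"
      using uv by (auto simp: perp_def)
    then show ?thesis using 3 rank0_imp_rank_le1 card_orthogonal_2[OF prime_int uv(3)] by auto
  qed
qed

text \<open>In \<open>Z e + p e^perp\<close> the vector \<open>p f\<close> occurs exactly when
  \<open>f\<close> is orthogonal to \<open>e\<close> modulo \<open>p\<close>.\<close>

lemma stretch_subset_line:
  assumes L: "L \<in> line_lats" and e: "e \<in> L" "\<not> vdvd q e"
  shows "stretch Z \<subseteq> L \<longleftrightarrow> vmod e q \<in> perp Z"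
proof -
  have "q *s f \<in> L \<longleftrightarrow> q dvd sp f e" for f
  proof
    assume "q *s f \<in> L"
    then obtain c g where cg: "q *s f = c *s e + q *s g" "q dvd sp e g"
      using line_lattice_eq(1)[OF L e] by blast
    obtain i where i: "\<not> q dvd e $ i" using e by (auto simp: vdvd_def)
    have "c * e $ i = q * (f $ i - g $ i)"
      using cg(1) by (simp add: vec_eq_iff algebra_simps)
    then have "q dvd c * e $ i" by simp
    then obtain d where d: "c = q * d" using i prime_int by (auto simp: prime_dvd_mult_iff)
    have "q * sp e f = q * sp e g"
      using arg_cong[OF cg(1), of "sp e"] by (simp add: sp_add_right sp_scale_right)
    then have "q dvd sp e f" using cg(2) p_gt_0 by simp
    then show "q dvd sp f e" using sp_swap[of f e] by simp
  next
    assume "q dvd sp f e"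
    then have "q dvd sp e f" using sp_swap[of f e] by simp
    then show "q *s f \<in> L" using line_lattice_eq(2)[OF L e, of f 0] by simp
  qed
  then show ?thesis
    using vmod_in_cube[OF P_gt_0, of e] by (auto simp: stretch_def perp_def dvd_sp_vmod)
qed

text \<open>Double count over primitive vectors modulo p^2: those reducing into
  \<open>perp Z\<close> lie in exactly one line lattice each, and a line lattice of rank one
  contains \<open>(p - 1) p^3\<close> primitive vectors. This gives
  \<open>p (card (perp Z) - 1) / (p - 1)\<close> lattices of rank one; the remaining 1 is the
  lattice of all multiples of \<open>p\<close>.\<close>

lemma card_lines_above_stretch:
  assumes Z: "Z \<in> \<L> s" and s: "s > 0"
  shows "card {L \<in> line_lats. stretch Z \<subseteq> L} =
    1 + (p + p ^ 2) + p ^ 3 * of_bool (rank_le1 p Z) + p ^ 4 * of_bool (rank0 p Z)"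
proof -
  let ?A = "{L \<in> line_lats. \<not> rank0 p L \<and> stretch Z \<subseteq> L}"
  let ?E = "{w \<in> cube (q ^ 2). \<not> vdvd q w \<and> vmod w q \<in> perp Z}"
  have fin: "finite line_lats" using finite_lats[OF p_gt_0, of N 2] by (simp add: line_lats_def)
  have "(\<Sum>L\<in>?A. card {w \<in> ?E. w \<in> L}) = 1 * card ?E"
  proof (rule sum_multicount)
    show "\<forall>w\<in>?E. card {L \<in> ?A. w \<in> L} = 1"
    proof
      fix w assume w: "w \<in> ?E"
      then have "{L \<in> ?A. w \<in> L} = {L \<in> line_lats. w \<in> L}"
        using stretch_subset_line[of _ w Z] by (auto simp: rank0_def)
      then show "card {L \<in> ?A. w \<in> L} = 1" using line_lattice_unique w by simp
    qed
  qed (use fin in auto)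
  moreover have "card {w \<in> ?E. w \<in> L} = (p - 1) * p ^ 3" if L: "L \<in> ?A" for L
  proof -
    have "{w \<in> ?E. w \<in> L} = {w \<in> cube (q ^ 2). \<not> vdvd q w \<and> w \<in> L}"
      using L stretch_subset_line[of L _ Z] by auto
    then show ?thesis using card_primitive_line L by simp
  qed
  moreover have "card ?E = (card (perp Z) - 1) * p ^ 4"
    by (rule card_primitive_lifts) (auto simp: perp_def cube_def sp_def P_gt_0 p_gt_0)
  ultimately have "card ?A * ((p - 1) * p ^ 3) = (card (perp Z) - 1) * p ^ 4" by simp
  also have "\<dots> = (p + p ^ 2 + p ^ 3 * of_bool (rank_le1 p Z) + p ^ 4 * of_bool (rank0 p Z)) * ((p - 1) * p ^ 3)"
  proof -
    have "p ^ 2 - 1 = (1 + p) * (p - 1)" "p ^ 3 - 1 = (1 + p + p ^ 2) * (p - 1)"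
      "p ^ 4 - 1 = (1 + p + p ^ 2 + p ^ 3) * (p - 1)"
      using p_gt_0 by (cases p; simp add: algebra_simps power2_eq_square power3_eq_cube power4_eq_xxxx)+
    then have "card (perp Z) - 1 = (1 + p + p ^ 2 * of_bool (rank_le1 p Z) + p ^ 3 * of_bool (rank0 p Z)) * (p - 1)"
      using rank0_imp_rank_le1[of p Z] unfolding card_perp[OF Z s] by simp
    moreover have "(1 + p + p ^ 2 * a + p ^ 3 * b) * c * p ^ 4 = (p + p ^ 2 + p ^ 3 * a + p ^ 4 * b) * (c * p ^ 3)" for a b c
      by (simp add: algebra_simps power2_eq_square power3_eq_cube power4_eq_xxxx)
    ultimately show ?thesis by simp
  qed
  finally have eq: "card ?A * ((p - 1) * p ^ 3) =
    (p + p ^ 2 + p ^ 3 * of_bool (rank_le1 p Z) + p ^ 4 * of_bool (rank0 p Z)) * ((p - 1) * p ^ 3)" .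
  have "(p - 1) * p ^ 3 \<noteq> 0" using p_gt_1 by simp
  then have "card ?A = p + p ^ 2 + p ^ 3 * of_bool (rank_le1 p Z) + p ^ 4 * of_bool (rank0 p Z)"
    using eq by (rule iffD1[OF mult_right_cancel])
  moreover have "stretch Z \<subseteq> L" if "L \<in> line_lats" "rank0 p L" for L
  proof -
    have "L = {v. vdvd q v}" using that rank0_line_lats by blast
    then show ?thesis using rank0_stretch[of Z] by (auto simp: rank0_def)
  qed
  then have "{L \<in> line_lats. stretch Z \<subseteq> L} = ?A \<union> {L \<in> line_lats. rank0 p L}" by blast
  moreover have "card (?A \<union> {L \<in> line_lats. rank0 p L}) = card ?A + card {L \<in> line_lats. rank0 p L}"
    using fin by (intro card_Un_disjoint) auto
  ultimately show ?thesis using rank0_line_lats by simp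
qed

text \<open>A line lattice containing \<open>Z\<close> is fixed by any primitive vector
  \<open>e\<close> of \<open>Z\<close>. It does contain \<open>Z\<close> when \<open>Z\<close> has
  rank one, because \<open>s \<ge> 2\<close> makes pairings within \<open>Z\<close> divisible by
  p^2.\<close>

lemma card_lines_above:
  assumes Z: "Z \<in> \<L> s" and s: "s \<ge> 2" and r: "\<not> rank0 p Z"
  shows "card {L \<in> line_lats. Z \<subseteq> L} = of_bool (rank_le1 p Z)"
proof (cases "rank_le1 p Z")
  case False
  then have "{L \<in> line_lats. Z \<subseteq> L} = {}" unfolding line_lats_def rank_le1_def by blast
  then have "card {L \<in> line_lats. Z \<subseteq> L} = 0" by (simp only: card.empty)
  then show ?thesis using False by simp
next
  case True
  obtain e where e: "e \<in> Z" "\<not> vdvd q e" using r by (rule not_rank0E)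
  have "w \<in> L" if L: "L \<in> line_lats" "e \<in> L" and w: "w \<in> Z" for L w
  proof -
    obtain c f where cf: "c \<in> {0..<q}" "w = c *s e + q *s f"
      by (rule rank_le1_multiple[OF True e w])
    have "q ^ s dvd q * sp e f"
      using lats_sp[OF Z e(1) w] unfolding cf by (simp add: sp_add_right sp_scale_right)
    then have "q ^ 2 dvd q * sp e f" using s by (meson dvd_trans le_imp_power_dvd)
    then have "q dvd sp e f" using p_gt_0 by (simp add: power2_eq_square)
    then show ?thesis unfolding cf(2) by (rule line_lattice_eq(2)[OF L e(2)])
  qed
  then have "{L \<in> line_lats. Z \<subseteq> L} = {L \<in> line_lats. e \<in> L}" using e(1) by blast
  then show ?thesis using line_lattice_unique[OF e(2)] True by simp
qed

end

subsection \<open>The action on the half space\<close>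

text \<open>A point \<open>z\<close> is encoded by the subspace of vectors \<open>(z u, u)\<close>.
  A similitude maps it to the subspace of the transformed point, with \<open>u\<close> multiplied by
  the cocycle, so the action is handled by linear algebra on columns.\<close>

definition pair_vec :: "'a ^ 2 \<Rightarrow> 'a ^ 2 \<Rightarrow> 'a ^ (2 + 2)" where
  "pair_vec a b = (\<chi> i. case i of Inl k \<Rightarrow> a $ k | Inr k \<Rightarrow> b $ k)"

definition numer :: "complex mat4 \<Rightarrow> complex mat2 \<Rightarrow> complex mat2" where
  "numer M z = blockA M ** z + blockB M"

lemma pair_vec_nth [simp]: "pair_vec a b $ Inl k = a $ k" "pair_vec a b $ Inr k = b $ k"
  by (simp_all add: pair_vec_def)

lemma pair_vec_eq_iff: "pair_vec a b = pair_vec c d \<longleftrightarrow> a = c \<and> b = d"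
  by (auto simp: vec_eq_iff all_index4 forall_2)

lemma mult_pair_vec:
  "M *v pair_vec a b = pair_vec (blockA M *v a + blockB M *v b) (blockC M *v a + blockD M *v b)"
  by (simp add: vec_eq_iff all_index4 matrix_vector_mult_def sum_index4 sum_2 blockA_def blockB_def
      blockC_def blockD_def add.assoc)

lemma mult_pair_vec_point:
  "M *v pair_vec (z *v u) u = pair_vec (numer M z *v u) (cocycle M z *v u)"
  by (simp add: mult_pair_vec numer_def cocycle_def matrix_vector_mult_add_rdistrib matrix_vector_mul_assoc)

lemma sp_pair_vec: "sp (pair_vec a b) (pair_vec c d) = (\<Sum>k\<in>UNIV. a $ k * d $ k - b $ k * c $ k)"
  by (simp add: sp_def sum_2 algebra_simps)

lemma sp_mult:
  fixes M :: "'a::field mat4"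
  assumes M: "M ** Jmat ** transpose M = mscale e Jmat" and e: "e \<noteq> 0"
  shows "sp (M *v a) (M *v b) = e * sp a b"
proof -
  have T: "transpose M ** Jmat ** transpose (transpose M) = mscale e Jmat"
    using similitude_transpose[OF M e] by simp
  have ent: "sp (transpose M $ i) (transpose M $ j) = e * Jmat $ i $ j" for i j
    using T Jmat_sandwich_nth[of "transpose M" "transpose M" i j] by simp
  have mv: "M *v a = a $ Inl 1 *s transpose M $ Inl 1 + a $ Inl 2 *s transpose M $ Inl 2
     + a $ Inr 1 *s transpose M $ Inr 1 + a $ Inr 2 *s transpose M $ Inr 2" for a
    by (simp add: vec_eq_iff matrix_vector_mult_def transpose_def sum_index4 mult.commute)
  show ?thesis
    unfolding mv by (simp add: sp_add_left sp_add_right sp_scale_left sp_scale_right ent Jmat_nth)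
      (simp add: sp_def algebra_simps)
qed

section \<open>Positive similitudes acting on the half space\<close>

definition GSp_pos :: "rat mat4 set" where
  "GSp_pos = {M. \<exists>e > 0. M ** Jmat ** transpose M = mscale e Jmat}"

lemma Jmat_scale_inj:
  assumes "mscale a Jmat = mscale (b::'a::field) Jmat" shows "a = b"
proof -
  have "mscale a Jmat $ Inl 1 $ Inr 1 = mscale b Jmat $ Inl 1 $ Inr 1" using assms by simp
  then show ?thesis by (simp add: Jmat_nth)
qed

lemma similitude_eq:
  "M ** Jmat ** transpose M = mscale e Jmat \<Longrightarrow> similitude M = e"
  unfolding similitude_def using Jmat_scale_inj by (metis (mono_tags, lifting) the_equality)

lemma GSp_posE:
  assumes "M \<in> GSp_pos"
  shows "similitude M > 0" "M ** Jmat ** transpose M = mscale (similitude M) Jmat"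
  using assms similitude_eq unfolding GSp_pos_def by auto

lemma GSp_pos_mult:
  assumes "A \<in> GSp_pos" "B \<in> GSp_pos"
  shows "A ** B \<in> GSp_pos" "similitude (A ** B) = similitude A * similitude B"
proof -
  have "A ** B ** Jmat ** transpose (A ** B) = A ** (B ** Jmat ** transpose B) ** transpose A"
    by (simp add: matrix_transpose_mul matrix_mul_assoc)
  also have "\<dots> = mscale (similitude A * similitude B) Jmat"
    unfolding GSp_posE(2)[OF assms(2)]
    by (simp add: matrix_scale_left matrix_scale_right GSp_posE(2)[OF assms(1)] matrix_scale_scale mult.commute)
  finally have eq: "A ** B ** Jmat ** transpose (A ** B) = mscale (similitude A * similitude B) Jmat" .
  then show "similitude (A ** B) = similitude A * similitude B" by (rule similitude_eq)
  show "A ** B \<in> GSp_pos" using eq GSp_posE(1)[OF assms(1)] GSp_posE(1)[OF assms(2)]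
    unfolding GSp_pos_def by (metis (mono_tags, lifting) mem_Collect_eq mult_pos_pos)
qed

abbreviation cmat :: "rat mat4 \<Rightarrow> complex mat4" where
  "cmat M \<equiv> map_matrix of_rat M"

lemma cmat_mult: "cmat (A ** B) = cmat A ** cmat B"
  by (rule map_matrix_mult) (auto simp: of_rat_add of_rat_mult)

lemma sp_cmat:
  assumes "M \<in> GSp_pos"
  shows "sp (cmat M *v a) (cmat M *v b) = of_rat (similitude M) * sp a b"
proof (rule sp_mult)
  have J: "cmat Jmat = Jmat" by (simp add: vec_eq_iff all_index4 Jmat_nth)
  have T: "cmat (transpose M) = transpose (cmat M)" by (simp add: vec_eq_iff transpose_def)
  have "cmat (M ** Jmat ** transpose M) = cmat (mscale (similitude M) Jmat)"
    using GSp_posE(2)[OF assms] by simp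
  also have "\<dots> = mscale (of_rat (similitude M)) (cmat Jmat)"
    by (simp add: vec_eq_iff of_rat_mult)
  finally show "cmat M ** Jmat ** transpose (cmat M) = mscale (of_rat (similitude M)) Jmat"
    by (simp add: cmat_mult J T)
  show "of_rat (similitude M) \<noteq> (0::complex)" using GSp_posE(1)[OF assms] by simp
qed

definition vcnj :: "complex ^ 'n \<Rightarrow> complex ^ 'n" where
  "vcnj u = (\<chi> i. cnj (u $ i))"

lemma vcnj_nth [simp]: "vcnj u $ i = cnj (u $ i)"
  by (simp add: vcnj_def)

lemma cnj_of_rat [simp]: "cnj (of_rat x) = of_rat x"
  by (cases x) (simp add: of_rat_rat)

lemma of_real_of_rat [simp]: "complex_of_real (of_rat x) = of_rat x"
  by (cases x) (simp add: of_rat_rat)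

lemma vcnj_cmat: "vcnj (cmat M *v a) = cmat M *v vcnj a"
  by (simp add: vec_eq_iff matrix_vector_mult_def)

lemma vcnj_pair_vec: "vcnj (pair_vec a b) = pair_vec (vcnj a) (vcnj b)"
  by (simp add: vec_eq_iff all_index4)

text \<open>The Hermitian form \<open>i (cnj t)\<^sup>T J t\<close> at the vector \<open>t = (z u, u)\<close> is twice \<open>u\<^sup>* (Im z) u\<close>.\<close>

lemma herm_point:
  fixes z :: "complex mat2"
  assumes z: "transpose z = z"
  shows "sp (vcnj (pair_vec (z *v u) u)) (pair_vec (z *v u) u) = - 2 * \<i> * of_real (
     (\<chi> i. Re (u $ i)) \<bullet> (map_matrix Im z *v (\<chi> i. Re (u $ i))) +
     (\<chi> i. Im (u $ i)) \<bullet> (map_matrix Im z *v (\<chi> i. Im (u $ i))))"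
proof -
  have s: "z $ 2 $ 1 = z $ 1 $ 2" using arg_cong[OF z, of "\<lambda>m. m $ 1 $ 2"] by (simp add: transpose_def)
  show ?thesis
    by (simp add: vcnj_pair_vec sp_pair_vec sum_2 matrix_vector_mult_def inner_vec_def s complex_eq_iff algebra_simps)
qed

lemma siegel_herm_pos:
  assumes z: "z \<in> siegel_H2" and u: "u \<noteq> 0"
  obtains r where "r > 0" "sp (vcnj (pair_vec (z *v u) u)) (pair_vec (z *v u) u) = - 2 * \<i> * of_real r"
proof -
  let ?a = "\<chi> i. Re (u $ i)" and ?b = "\<chi> i. Im (u $ i)"
  have pos: "v \<bullet> (map_matrix Im z *v v) > 0" if "v \<noteq> 0" for v
    using z that by (simp add: siegel_H2_def)
  have nn: "v \<bullet> (map_matrix Im z *v v) \<ge> 0" for v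
    using pos[of v] by (cases "v = 0") auto
  have "?a \<noteq> 0 \<or> ?b \<noteq> 0" using u by (auto simp: vec_eq_iff complex_eq_iff)
  then have "?a \<bullet> (map_matrix Im z *v ?a) + ?b \<bullet> (map_matrix Im z *v ?b) > 0"
    using pos nn by (meson add_pos_nonneg add_nonneg_pos)
  then show ?thesis using herm_point[of z u] z by (intro that) (auto simp: siegel_H2_def)
qed

text \<open>A vector \<open>u\<close> in the kernel would send \<open>(z u, u)\<close> to a vector
  with zero second half, on which the Hermitian form vanishes. The form at \<open>(z u, u)\<close>
  is nonzero and is only scaled by the multiplier.\<close>

lemma cocycle_invertible:
  assumes M: "M \<in> GSp_pos" and z: "z \<in> siegel_H2"
  shows "invertible (cocycle (cmat M) z)"
proof -
  have "u = 0" if u: "cocycle (cmat M) z *v u = 0" for u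
  proof (rule ccontr)
    assume "u \<noteq> 0"
    then obtain r where r: "r > 0"
      "sp (vcnj (pair_vec (z *v u) u)) (pair_vec (z *v u) u) = - 2 * \<i> * of_real r"
      using siegel_herm_pos[OF z] by blast
    have "sp (vcnj (cmat M *v pair_vec (z *v u) u)) (cmat M *v pair_vec (z *v u) u) =
        of_rat (similitude M) * (- 2 * \<i> * of_real r)"
      unfolding vcnj_cmat sp_cmat[OF M] r(2) ..
    moreover have "sp (vcnj (cmat M *v pair_vec (z *v u) u)) (cmat M *v pair_vec (z *v u) u) = 0"
      unfolding mult_pair_vec_point u by (simp add: vcnj_pair_vec sp_pair_vec)
    ultimately show False using r(1) GSp_posE(1)[OF M] by simp
  qed
  then have "\<exists>B. B ** cocycle (cmat M) z = mat 1" by (simp add: matrix_left_invertible_ker)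
  then show ?thesis by (simp add: invertible_left_inverse)
qed

lemma matrix_inv_cancel:
  fixes A :: "'a::field ^ 'n ^ 'n"
  assumes "invertible A"
  shows "A ** matrix_inv A = mat 1" "matrix_inv A ** A = mat 1"
  using someI_ex[OF assms[unfolded invertible_def]] by (simp_all add: matrix_inv_def)

lemma matrix_inv_mult:
  fixes A B :: "'a::field ^ 'n ^ 'n"
  assumes "invertible A" "invertible B"
  shows "matrix_inv (A ** B) = matrix_inv B ** matrix_inv A"
proof -
  have "(A ** B) ** (matrix_inv B ** matrix_inv A) = A ** (B ** matrix_inv B) ** matrix_inv A"
    by (simp add: matrix_mul_assoc)
  also have "\<dots> = mat 1"
    by (simp add: matrix_inv_cancel(1)[OF assms(1)] matrix_inv_cancel(1)[OF assms(2)])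
  finally have 1: "(A ** B) ** (matrix_inv B ** matrix_inv A) = mat 1" .
  then have "invertible (A ** B)" by (metis invertible_right_inverse)
  then have "matrix_inv (A ** B) ** (A ** B) = mat 1" by (rule matrix_inv_cancel)
  then show ?thesis using 1 by (metis matrix_mul_assoc matrix_mul_lid matrix_mul_rid)
qed

lemma moebius_pair_vec:
  assumes M: "M \<in> GSp_pos" and z: "z \<in> siegel_H2"
  shows "cmat M *v pair_vec (z *v u) u =
    pair_vec (moebius4 (cmat M) z *v (cocycle (cmat M) z *v u)) (cocycle (cmat M) z *v u)"
  using matrix_inv_cancel(2)[OF cocycle_invertible[OF M z]]
  by (simp add: mult_pair_vec_point moebius4_def numer_def[symmetric] matrix_vector_mul_assoc
      matrix_mul_assoc[symmetric])

text \<open>Symmetry of a point means that its subspace is isotropic, and positivity is a sign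
  condition on the Hermitian form there. A similitude multiplies both forms by its positive
  multiplier.\<close>

lemma moebius_in_siegel:
  assumes M: "M \<in> GSp_pos" and z: "z \<in> siegel_H2"
  shows "moebius4 (cmat M) z \<in> siegel_H2"
proof -
  let ?w = "moebius4 (cmat M) z" and ?j = "cocycle (cmat M) z"
  note inv = matrix_inv_cancel[OF cocycle_invertible[OF M z]]
  have zt: "transpose z = z" using z by (simp add: siegel_H2_def)
  have j: "?j *v (matrix_inv ?j *v v) = v" for v by (simp add: matrix_vector_mul_assoc inv)
  have pt: "cmat M *v pair_vec (z *v (matrix_inv ?j *v v)) (matrix_inv ?j *v v) = pair_vec (?w *v v) v" for v
    using moebius_pair_vec[OF M z, of "matrix_inv ?j *v v"] by (simp add: j)
  have sym0: "sp (pair_vec (z *v a) a) (pair_vec (z *v b) b) = 0" for a b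
  proof -
    have s: "z $ 2 $ 1 = z $ 1 $ 2" using arg_cong[OF zt, of "\<lambda>m. m $ 1 $ 2"] by (simp add: transpose_def)
    show ?thesis by (simp add: sp_pair_vec sum_2 matrix_vector_mult_def s algebra_simps)
  qed
  have symw: "sp (pair_vec (?w *v a) a) (pair_vec (?w *v b) b) = 0" for a b
    using sp_cmat[OF M] sym0 by (simp flip: pt)
  have "?w $ 1 $ 2 = ?w $ 2 $ 1"
    using symw[of "axis 2 1" "axis 1 1"]
    by (simp add: sp_pair_vec sum_2 axis_def matrix_vector_mult_def)
  then have wt: "transpose ?w = ?w" by (simp add: vec_eq_iff transpose_def forall_2)
  have "v \<bullet> (map_matrix Im ?w *v v) > 0" if v: "v \<noteq> 0" for v :: "real ^ 2"
  proof -
    define c where "c = (\<chi> i. complex_of_real (v $ i))"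
    have "c \<noteq> 0" using v by (auto simp: c_def vec_eq_iff)
    then have "matrix_inv ?j *v c \<noteq> 0" using j[of c] by (metis matrix_vector_mult_0_right)
    then obtain r where r: "r > 0" "sp (vcnj (pair_vec (z *v (matrix_inv ?j *v c)) (matrix_inv ?j *v c)))
       (pair_vec (z *v (matrix_inv ?j *v c)) (matrix_inv ?j *v c)) = - 2 * \<i> * of_real r"
      using siegel_herm_pos[OF z] by blast
    have "sp (vcnj (pair_vec (?w *v c) c)) (pair_vec (?w *v c) c) =
        of_rat (similitude M) * (- 2 * \<i> * of_real r)"
      unfolding pt[symmetric] vcnj_cmat sp_cmat[OF M] r(2) ..
    moreover have "(\<chi> i. Re (c $ i)) = v" "(\<chi> i. Im (c $ i)) = 0"
      by (simp_all add: c_def vec_eq_iff)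
    ultimately have "- 2 * \<i> * of_real (v \<bullet> (map_matrix Im ?w *v v)) =
        of_rat (similitude M) * (- 2 * \<i> * of_real r)"
      using herm_point[OF wt, of c] by simp
    then have "complex_of_real (v \<bullet> (map_matrix Im ?w *v v)) = of_rat (similitude M) * of_real r"
      by (simp add: algebra_simps)
    also have "\<dots> = complex_of_real (of_rat (similitude M) * r)" by simp
    finally have "v \<bullet> (map_matrix Im ?w *v v) = of_rat (similitude M) * r" by (simp only: of_real_eq_iff)
    then show ?thesis using r(1) GSp_posE(1)[OF M] by simp
  qed
  then show ?thesis using wt by (simp add: siegel_H2_def)
qed

text \<open>The image of \<open>(z u, u)\<close> under \<open>A ** B\<close> is computed in one step
  and in two; comparing the halves for all \<open>u\<close> gives both identities.\<close>

lemma cocycle_mult: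
  assumes A: "A \<in> GSp_pos" and B: "B \<in> GSp_pos" and z: "z \<in> siegel_H2"
  shows "cocycle (cmat (A ** B)) z = cocycle (cmat A) (moebius4 (cmat B) z) ** cocycle (cmat B) z"
    and "moebius4 (cmat (A ** B)) z = moebius4 (cmat A) (moebius4 (cmat B) z)"
proof -
  let ?w = "moebius4 (cmat B) z" and ?j = "cocycle (cmat B) z"
  have AB: "pair_vec (numer (cmat (A ** B)) z *v u) (cocycle (cmat (A ** B)) z *v u) =
      pair_vec ((numer (cmat A) ?w ** ?j) *v u) ((cocycle (cmat A) ?w ** ?j) *v u)" for u
  proof -
    have "cmat (A ** B) *v pair_vec (z *v u) u = cmat A *v pair_vec (?w *v (?j *v u)) (?j *v u)"
      by (simp only: cmat_mult matrix_vector_mul_assoc[symmetric] moebius_pair_vec[OF B z])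
    also have "\<dots> = pair_vec (numer (cmat A) ?w *v (?j *v u)) (cocycle (cmat A) ?w *v (?j *v u))"
      by (rule mult_pair_vec_point)
    finally show ?thesis by (simp only: mult_pair_vec_point matrix_vector_mul_assoc)
  qed
  from AB have n: "numer (cmat (A ** B)) z = numer (cmat A) ?w ** ?j"
    and c: "cocycle (cmat (A ** B)) z = cocycle (cmat A) ?w ** ?j"
    unfolding pair_vec_eq_iff by (simp_all add: matrix_eq)
  show "cocycle (cmat (A ** B)) z = cocycle (cmat A) ?w ** ?j" by (rule c)
  have ij: "invertible ?j" "invertible (cocycle (cmat A) ?w)"
    using cocycle_invertible moebius_in_siegel A B z by blast+
  have "moebius4 (cmat (A ** B)) z = numer (cmat (A ** B)) z ** matrix_inv (cocycle (cmat (A ** B)) z)"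
    by (simp only: moebius4_def numer_def)
  also have "\<dots> = numer (cmat A) ?w ** ?j ** (matrix_inv ?j ** matrix_inv (cocycle (cmat A) ?w))"
    by (simp only: n c matrix_inv_mult[OF ij(2,1)])
  also have "\<dots> = numer (cmat A) ?w ** (?j ** matrix_inv ?j) ** matrix_inv (cocycle (cmat A) ?w)"
    by (simp add: matrix_mul_assoc)
  also have "\<dots> = moebius4 (cmat A) ?w"
    by (simp only: matrix_inv_cancel[OF ij(1)] moebius4_def numer_def matrix_mul_rid)
  finally show "moebius4 (cmat (A ** B)) z = moebius4 (cmat A) ?w" .
qed


section \<open>The slash action and the central character\<close>

lemma rep_invertible:
  assumes "GL2_rep \<rho>" "invertible g" shows "invertible (\<rho> g)"
proof -
  have "invertible (matrix_inv g)"
    using matrix_inv_cancel[OF assms(2)] by (metis invertible_def)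
  then have "\<rho> g ** \<rho> (matrix_inv g) = mat 1"
    using assms matrix_inv_cancel[OF assms(2)] unfolding GL2_rep_def by metis
  then show ?thesis by (metis invertible_right_inverse)
qed

lemma matrix_vector_mult_smult: "A *v (c *s x) = c *s (A *v x :: 'a::field ^ 'n)"
  by (simp add: vec_eq_iff matrix_vector_mult_def sum_distrib_left mult.left_commute)

lemma slash_mult:
  assumes \<rho>: "GL2_rep \<rho>" and A: "A \<in> GSp_pos" and B: "B \<in> GSp_pos" and z: "z \<in> siegel_H2"
  shows "slash l1 l2 \<rho> (slash l1 l2 \<rho> F A) B z = slash l1 l2 \<rho> F (A ** B) z"
proof -
  let ?w = "moebius4 (cmat B) z"
  have ij: "invertible (cocycle (cmat B) z)" "invertible (cocycle (cmat A) ?w)"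
    using cocycle_invertible moebius_in_siegel A B z by blast+
  have "\<rho> (cocycle (cmat (A ** B)) z) = \<rho> (cocycle (cmat A) ?w) ** \<rho> (cocycle (cmat B) z)"
    using \<rho> ij unfolding cocycle_mult(1)[OF A B z] GL2_rep_def by blast
  then have "matrix_inv (\<rho> (cocycle (cmat (A ** B)) z)) =
      matrix_inv (\<rho> (cocycle (cmat B) z)) ** matrix_inv (\<rho> (cocycle (cmat A) ?w))"
    using matrix_inv_mult rep_invertible[OF \<rho>] ij by metis
  then show ?thesis
    unfolding slash_def cocycle_mult(2)[OF A B z] GSp_pos_mult(2)[OF A B]
    by (simp add: matrix_vector_mul_assoc matrix_vector_mult_smult of_rat_mult power_int_mult_distrib
        mult.commute)
qed

lemma slash_smult: "slash l1 l2 \<rho> (\<lambda>z. c *s F z) A z = c *s slash l1 l2 \<rho> F A z"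
  by (simp add: slash_def matrix_vector_mult_smult mult.commute)

lemma slash_sum:
  fixes F :: "'i \<Rightarrow> complex mat2 \<Rightarrow> complex ^ 'd"
  shows "slash l1 l2 \<rho> (\<lambda>z. \<Sum>i\<in>I. F i z) A z = (\<Sum>i\<in>I. slash l1 l2 \<rho> (F i) A z)"
proof -
  have "B *v (\<Sum>i\<in>I. f i) = (\<Sum>i\<in>I. B *v f i)" for B :: "complex ^ 'd ^ 'd" and f :: "'i \<Rightarrow> complex ^ 'd"
    by (induction I rule: infinite_finite_induct) (auto simp: matrix_vector_right_distrib)
  moreover have "c *s (\<Sum>i\<in>I. f i) = (\<Sum>i\<in>I. c *s f i)" for c and f :: "'i \<Rightarrow> complex ^ 'd"
    by (simp add: vec_eq_iff sum_distrib_left)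
  ultimately show ?thesis by (simp add: slash_def)
qed

lemma slash_cong:
  assumes "A \<in> GSp_pos" "z \<in> siegel_H2" "\<And>z. z \<in> siegel_H2 \<Longrightarrow> F z = G z"
  shows "slash l1 l2 \<rho> F A z = slash l1 l2 \<rho> G A z"
  using assms moebius_in_siegel by (simp add: slash_def)

text \<open>Schur's argument: scalar matrices commute with everything, so the eigenspace is an
  invariant subspace. It contains the highest weight vector and is therefore everything by
  irreducibility.\<close>

lemma central_character:
  assumes \<rho>: "highest_weight_rep l1 l2 \<rho>" and c: "c \<noteq> 0"
  shows "\<rho> (mscale c (mat 1)) *v w = c ^ (l1 + l2) *s w"
proof -
  let ?c = "mscale c (mat 1) :: complex mat2"
  have up: "upper2 c 0 c = ?c"
    by (simp add: vec_eq_iff forall_2 upper2_def mat_def)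
  have rep: "GL2_rep \<rho>" using \<rho> by (simp add: highest_weight_rep_def polynomial_rep_def)
  have "?c ** mscale (1 / c) (mat 1) = mat 1"
    using c by (simp add: matrix_scale_left matrix_scale_right matrix_scale_scale)
  then have inv: "invertible ?c" by (metis invertible_right_inverse)
  let ?W = "{w. \<rho> ?c *v w = c ^ (l1 + l2) *s w}"
  have "vec.subspace ?W"
    by (auto simp: vec.subspace_def matrix_vector_right_distrib vector_add_ldistrib matrix_vector_mult_smult
        mult.commute)
  moreover have "\<rho> g *v w \<in> ?W" if "invertible g" "w \<in> ?W" for g w
  proof -
    have "\<rho> ?c ** \<rho> g = \<rho> (?c ** g)" using rep inv that by (simp add: GL2_rep_def)
    also have "?c ** g = g ** ?c" by (simp add: matrix_scale_left matrix_scale_right)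
    also have "\<rho> (g ** ?c) = \<rho> g ** \<rho> ?c" using rep inv that by (simp add: GL2_rep_def)
    finally show ?thesis using that(2)
      by (simp add: matrix_vector_mul_assoc) (simp add: matrix_vector_mul_assoc[symmetric] matrix_vector_mult_smult)
  qed
  ultimately have "?W = {0} \<or> ?W = UNIV"
    using \<rho> unfolding highest_weight_rep_def irreducible_rep_def by blast
  moreover obtain v where "v \<noteq> 0" "\<rho> (upper2 c 0 c) *v v = (c ^ l1 * c ^ l2) *s v"
    using \<rho> c unfolding highest_weight_rep_def by blast
  then have "v \<in> ?W" "v \<noteq> 0" by (simp_all add: up power_add)
  ultimately show ?thesis by blast
qed

text \<open>With k the sum of the weights, the multiplier grows by c^2 and contributes exponent 2(k
  - 3), the inverse central character contributes -k, and the point is unchanged.\<close>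

lemma slash_scale:
  assumes \<rho>: "highest_weight_rep l1 l2 \<rho>" and A: "A \<in> GSp_pos" and z: "z \<in> siegel_H2" and c: "c > 0"
  shows "mscale c A \<in> GSp_pos"
    and "slash l1 l2 \<rho> F (mscale c A) z =
      of_rat c powi (int l1 + int l2 - 6) *s slash l1 l2 \<rho> F A z"
proof -
  let ?s = "mscale c A" and ?k = "of_rat c :: complex"
  have k: "?k \<noteq> 0" using c by simp
  have "?s ** Jmat ** transpose ?s = mscale (c^2 * similitude A) Jmat"
    by (simp add: transpose_scale matrix_scale_left matrix_scale_right matrix_scale_scale GSp_posE(2)[OF A]
        power2_eq_square mult.assoc)
  then have sim: "similitude ?s = c^2 * similitude A" and "?s \<in> GSp_pos"
    using c GSp_posE(1)[OF A] unfolding GSp_pos_def by (auto intro: similitude_eq exI[of _ "c^2 * similitude A"])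
  then show "?s \<in> GSp_pos" by simp
  have coc: "cocycle (cmat ?s) z = mscale ?k (cocycle (cmat A) z)"
    and num: "numer (cmat ?s) z = mscale ?k (numer (cmat A) z)"
    by (simp_all add: vec_eq_iff cocycle_def numer_def blockA_def blockB_def blockC_def blockD_def
        matrix_matrix_mult_def sum_2 of_rat_mult algebra_simps)
  let ?c = "mscale ?k (mat 1) :: complex mat2"
  have rep: "GL2_rep \<rho>" using \<rho> by (simp add: highest_weight_rep_def polynomial_rep_def)
  have "?c ** mscale (1 / ?k) (mat 1) = mat 1"
    using k by (simp add: matrix_scale_left matrix_scale_right matrix_scale_scale)
  then have inv: "invertible ?c" by (metis invertible_right_inverse)
  note ij = cocycle_invertible[OF A z]
  have coc': "cocycle (cmat ?s) z = cocycle (cmat A) z ** ?c"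
    unfolding coc by (simp add: matrix_scale_right)
  have "moebius4 (cmat ?s) z = numer (cmat A) z ** ?c ** (matrix_inv ?c ** matrix_inv (cocycle (cmat A) z))"
    unfolding moebius4_def numer_def[symmetric] coc' num matrix_inv_mult[OF ij inv] by (simp add: matrix_scale_right)
  also have "\<dots> = numer (cmat A) z ** (?c ** matrix_inv ?c) ** matrix_inv (cocycle (cmat A) z)"
    by (simp add: matrix_mul_assoc)
  finally have moe: "moebius4 (cmat ?s) z = moebius4 (cmat A) z"
    by (simp add: matrix_inv_cancel[OF inv] moebius4_def numer_def)
  have "\<rho> (cocycle (cmat ?s) z) = \<rho> (cocycle (cmat A) z) ** \<rho> ?c"
    using rep ij inv unfolding coc' GL2_rep_def by blast
  then have rinv: "matrix_inv (\<rho> (cocycle (cmat ?s) z)) = matrix_inv (\<rho> ?c) ** matrix_inv (\<rho> (cocycle (cmat A) z))"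
    using matrix_inv_mult rep_invertible[OF rep] ij inv by metis
  have rc: "matrix_inv (\<rho> ?c) *v w = inverse (?k ^ (l1 + l2)) *s w" for w
  proof -
    have "\<rho> ?c *v (inverse (?k ^ (l1 + l2)) *s w) = w"
      using k by (simp add: central_character[OF \<rho> k])
    then have "matrix_inv (\<rho> ?c) *v w = (matrix_inv (\<rho> ?c) ** \<rho> ?c) *v (inverse (?k ^ (l1 + l2)) *s w)"
      by (metis matrix_vector_mul_assoc)
    then show ?thesis using matrix_inv_cancel(2)[OF rep_invertible[OF rep inv]] by simp
  qed
  have pw: "(?k ^ 2) powi (int l1 + int l2 - 3) * inverse (?k ^ (l1 + l2)) = ?k powi (int l1 + int l2 - 6)"
  proof -
    have "inverse (?k ^ (l1 + l2)) = ?k powi (- (int l1 + int l2))"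
      by (simp add: power_int_minus flip: of_nat_add)
    moreover have "(?k ^ 2) powi (int l1 + int l2 - 3) = ?k powi (2 * (int l1 + int l2 - 3))"
      using power_int_mult[of ?k 2 "int l1 + int l2 - 3"] by simp
    moreover have "?k powi (2 * (int l1 + int l2 - 3)) * ?k powi (- (int l1 + int l2)) =
        ?k powi (2 * (int l1 + int l2 - 3) + - (int l1 + int l2))"
      using k by (subst power_int_add) auto
    moreover have "2 * (int l1 + int l2 - 3) + - (int l1 + int l2) = int l1 + int l2 - 6" by simp
    ultimately show ?thesis by (metis (no_types))
  qed
  show "slash l1 l2 \<rho> F ?s z = ?k powi (int l1 + int l2 - 6) *s slash l1 l2 \<rho> F A z"
    unfolding slash_def moe sim rinv matrix_vector_mul_assoc[symmetric] rc
    by (simp add: of_rat_mult of_rat_power power_int_mult_distrib pw[symmetric] mult_ac)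
qed

subsection \<open>Symplectic matrices over the p-adic integers\<close>

definition mcong :: "int \<Rightarrow> int mat4 \<Rightarrow> int mat4 \<Rightarrow> bool" where
  "mcong q A B \<longleftrightarrow> (\<forall>i j. [A $ i $ j = B $ i $ j] (mod q))"

lemma mcong_refl [simp]: "mcong q A A"
  and mcong_sym: "mcong q A B \<Longrightarrow> mcong q B A"
  and mcong_trans: "mcong q A B \<Longrightarrow> mcong q B C \<Longrightarrow> mcong q A C"
  unfolding mcong_def by (blast intro: cong_refl cong_sym cong_trans)+

lemma mcong_mult: "mcong q A B \<Longrightarrow> mcong q C D \<Longrightarrow> mcong q (A ** C) (B ** D)"
  by (simp add: mcong_def matrix_matrix_mult_def cong_sum cong_mult)

lemma mcong_transpose: "mcong q A B \<Longrightarrow> mcong q (transpose A) (transpose B)"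
  by (simp add: mcong_def transpose_def)

lemma mcong_scale: "mcong q A B \<Longrightarrow> mcong q (mscale c A) (mscale c B)"
  by (simp add: mcong_def cong_scalar_left)

text \<open>An alternating \<open>4 \<times> 4\<close> matrix is inverted, up to its Pfaffian, by a rearrangement of its
  entries; this turns a right inverse modulo \<open>q\<close> into a left inverse without dividing.\<close>

lemma symplectic_mod_transpose:
  fixes U :: "int mat4"
  assumes U: "mcong q (U ** Jmat ** transpose U) Jmat" and q: "q > 1"
  shows "mcong q (transpose U ** Jmat ** U) Jmat"
proof -
  define s where "s i j = sp (U $ i) (U $ j)" for i j
  define Pf where "Pf = s (Inl 1) (Inl 2) * s (Inr 1) (Inr 2) - s (Inl 1) (Inr 1) * s (Inl 2) (Inr 2)
     + s (Inl 1) (Inr 2) * s (Inl 2) (Inr 1)"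
  define H :: "int mat4" where "H = vec4
     (vec4 0 (- s (Inr 1) (Inr 2)) (s (Inl 2) (Inr 2)) (- s (Inl 2) (Inr 1)))
     (vec4 (s (Inr 1) (Inr 2)) 0 (- s (Inl 1) (Inr 2)) (s (Inl 1) (Inr 1)))
     (vec4 (- s (Inl 2) (Inr 2)) (s (Inl 1) (Inr 2)) 0 (- s (Inl 1) (Inl 2)))
     (vec4 (s (Inl 2) (Inr 1)) (- s (Inl 1) (Inr 1)) (s (Inl 1) (Inl 2)) 0)"
  have s_cong: "[s i j = Jmat $ i $ j] (mod q)" for i j
    using U by (simp add: mcong_def Jmat_sandwich_nth s_def)
  have swap: "s (Inl 2) (Inl 1) = - s (Inl 1) (Inl 2)" "s (Inr 1) (Inl 1) = - s (Inl 1) (Inr 1)"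
    "s (Inr 2) (Inl 1) = - s (Inl 1) (Inr 2)" "s (Inr 1) (Inl 2) = - s (Inl 2) (Inr 1)"
    "s (Inr 2) (Inl 2) = - s (Inl 2) (Inr 2)" "s (Inr 2) (Inr 1) = - s (Inr 1) (Inr 2)" "s i i = 0" for i
    unfolding s_def by (rule sp_swap sp_self)+
  have SH: "(U ** Jmat ** transpose U) ** H = mscale Pf (mat 1)"
    unfolding vec_eq_iff all_index4
    by (simp add: matrix_matrix_mult_def[of "U ** Jmat ** transpose U"] Jmat_sandwich_nth s_def[symmetric]
        sum_index4 mat_def H_def swap Pf_def algebra_simps)
  have "[Pf = Jmat $ Inl 1 $ Inl 2 * Jmat $ Inr 1 $ Inr 2 - Jmat $ Inl 1 $ Inr 1 * Jmat $ Inl 2 $ Inr 2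
     + Jmat $ Inl 1 $ Inr 2 * Jmat $ Inl 2 $ Inr 1] (mod q)"
    unfolding Pf_def by (intro cong_add cong_diff cong_mult s_cong)
  then have Pf: "[Pf = - 1] (mod q)" by (simp add: Jmat_nth)
  then have Pf0: "Pf \<noteq> 0" using q by (auto simp: cong_iff_dvd_diff)
  have HJ: "mcong q H Jmat"
    using s_cong[of "Inl 1" "Inl 2"] s_cong[of "Inl 1" "Inr 1"] s_cong[of "Inl 1" "Inr 2"]
      s_cong[of "Inl 2" "Inr 1"] s_cong[of "Inl 2" "Inr 2"] s_cong[of "Inr 1" "Inr 2"]
    unfolding mcong_def all_index4
    by (simp add: H_def Jmat_nth cong_minus_minus_iff[of _ 1, simplified] cong_minus_minus_iff[of _ 0, simplified])
  have "U ** (Jmat ** transpose U ** H) = mscale Pf (mat 1)"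
    using SH by (simp add: matrix_mul_assoc)
  moreover define Y where "Y = Jmat ** transpose U ** H"
  ultimately have UY: "U ** Y = mscale Pf (mat 1)" by simp
  have YU: "Y ** U = mscale Pf (mat 1)"
  proof -
    \<comment> \<open>Over the rationals a one-sided inverse is two-sided. Division by
      \<open>Pf\<close> is possible because it is congruent to -1 modulo \<open>q > 1\<close>, hence
      nonzero.\<close>
    let ?r = "map_matrix of_int :: int mat4 \<Rightarrow> rat mat4"
    have one: "?r (mat 1) = mat 1" by (simp add: vec_eq_iff mat_def)
    have "?r U ** ?r Y = mscale (of_int Pf) (mat 1)"
      using arg_cong[OF UY, of ?r] by (simp add: map_of_int_scale one)
    then have "?r U ** mscale (1 / of_int Pf) (?r Y) = mat 1"
      using Pf0 by (simp add: matrix_scale_right matrix_scale_scale)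
    then have "mscale (1 / of_int Pf) (?r Y) ** ?r U = mat 1"
      by (simp add: matrix_left_right_inverse)
    then have "mscale (of_int Pf) (mscale (1 / of_int Pf) (?r Y) ** ?r U) = mscale (of_int Pf) (mat 1)"
      by simp
    then have "?r (Y ** U) = ?r (mscale Pf (mat 1))"
      using Pf0 by (simp add: matrix_scale_left matrix_scale_scale map_of_int_scale one)
    then show ?thesis by (simp only: map_of_int_inj)
  qed
  have 1: "Jmat ** Y ** U = mscale Pf Jmat"
    using YU by (metis matrix_mul_assoc matrix_mul_rid matrix_scale_right)
  have "Jmat ** Y ** U = mscale (- 1) (transpose U ** H ** U)"
    unfolding Y_def by (simp add: matrix_mul_assoc Jmat_Jmat matrix_scale_left)
  then have 2: "transpose U ** H ** U = mscale (- Pf) Jmat"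
    using 1 by (simp add: vec_eq_iff)
  have "mcong q (transpose U ** Jmat ** U) (transpose U ** H ** U)"
    by (intro mcong_mult mcong_refl mcong_sym[OF HJ])
  moreover have "mcong q (mscale (- Pf) Jmat) Jmat"
  proof -
    have "[- Pf * x = 1 * x] (mod q)" for x
      using Pf by (intro cong_mult cong_refl) (metis cong_minus_minus_iff minus_minus)
    then show ?thesis by (simp add: mcong_def)
  qed
  ultimately show ?thesis unfolding 2 by (rule mcong_trans)
qed

abbreviation ratmat :: "int mat4 \<Rightarrow> rat mat4" where
  "ratmat \<equiv> map_matrix of_int"

lemma ratmat_one: "ratmat (mat 1) = mat 1"
  by (simp add: vec_eq_iff mat_def)

definition Jinv :: "'a::comm_ring_1 mat4 \<Rightarrow> 'a mat4" where
  "Jinv U = mscale (- 1) (Jmat ** transpose U ** Jmat)"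

lemma Sp4_Zp_iff: "U \<in> Sp4_Zp p \<longleftrightarrow> (\<forall>n. mcong (int p ^ n) (U (Suc n)) (U n) \<and>
    mcong (int p ^ n) (U n ** Jmat ** transpose (U n)) Jmat)"
  unfolding Sp4_Zp_def mcong_def by auto

context prime_level begin

lemma pow_gt_1: "n > 0 \<Longrightarrow> q ^ n > 1"
  using p_gt_1 by (simp add: one_less_power)

lemma Sp4_Zp_transpose:
  assumes "U \<in> Sp4_Zp p" shows "mcong (q ^ n) (transpose (U n) ** Jmat ** U n) Jmat"
proof (cases "n = 0")
  case True
  then show ?thesis by (simp add: mcong_def)
next
  case False
  then show ?thesis using assms pow_gt_1[of n] by (intro symplectic_mod_transpose) (auto simp: Sp4_Zp_iff)
qed

lemma Sp4_Zp_mult: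
  assumes "U \<in> Sp4_Zp p" "V \<in> Sp4_Zp p" shows "(\<lambda>n. U n ** V n) \<in> Sp4_Zp p"
proof -
  have "mcong (q ^ n) (U n ** V n ** Jmat ** transpose (U n ** V n)) Jmat" for n
  proof -
    have "U n ** V n ** Jmat ** transpose (U n ** V n) = U n ** (V n ** Jmat ** transpose (V n)) ** transpose (U n)"
      by (simp add: matrix_transpose_mul matrix_mul_assoc)
    moreover have "mcong (q ^ n) \<dots> (U n ** Jmat ** transpose (U n))"
      using assms by (intro mcong_mult mcong_refl) (auto simp: Sp4_Zp_iff)
    ultimately have "mcong (q ^ n) (U n ** V n ** Jmat ** transpose (U n ** V n)) (U n ** Jmat ** transpose (U n))"
      by simp
    moreover have "mcong (q ^ n) (U n ** Jmat ** transpose (U n)) Jmat" using assms by (simp add: Sp4_Zp_iff)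
    ultimately show ?thesis by (rule mcong_trans)
  qed
  then show ?thesis using assms by (auto simp: Sp4_Zp_iff intro: mcong_mult)
qed

lemma Jinv_mod:
  assumes "U \<in> Sp4_Zp p"
  shows "mcong (q ^ n) (Jinv (U n) ** U n) (mat 1)" "mcong (q ^ n) (U n ** Jinv (U n)) (mat 1)"
proof -
  have JJ: "mscale (- 1) (Jmat ** Jmat) = (mat 1 :: int mat4)"
    by (simp add: Jmat_Jmat matrix_scale_scale)
  have "Jinv (U n) ** U n = mscale (- 1) (Jmat ** (transpose (U n) ** Jmat ** U n))"
    by (simp add: Jinv_def matrix_scale_left matrix_mul_assoc)
  moreover have "mcong (q ^ n) \<dots> (mscale (- 1) (Jmat ** Jmat))"
    by (intro mcong_scale mcong_mult mcong_refl Sp4_Zp_transpose assms)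
  ultimately show "mcong (q ^ n) (Jinv (U n) ** U n) (mat 1)" unfolding JJ by simp
  have "U n ** Jinv (U n) = mscale (- 1) ((U n ** Jmat ** transpose (U n)) ** Jmat)"
    by (simp add: Jinv_def matrix_scale_right matrix_mul_assoc)
  moreover have "mcong (q ^ n) \<dots> (mscale (- 1) (Jmat ** Jmat))"
    using assms by (intro mcong_scale mcong_mult mcong_refl) (auto simp: Sp4_Zp_iff)
  ultimately show "mcong (q ^ n) (U n ** Jinv (U n)) (mat 1)" unfolding JJ by simp
qed

lemma Jinv_Sp4_Zp:
  assumes "U \<in> Sp4_Zp p" shows "(\<lambda>n. Jinv (U n)) \<in> Sp4_Zp p"
proof -
  have "mcong (q ^ n) (Jinv (U n) ** Jmat ** transpose (Jinv (U n))) Jmat" for n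
  proof -
    have "Jinv (U n) ** Jmat ** transpose (Jinv (U n)) =
        Jmat ** transpose (U n) ** Jmat ** Jmat ** (transpose Jmat ** U n ** transpose Jmat)"
      by (simp add: Jinv_def transpose_scale matrix_scale_left matrix_scale_right matrix_scale_scale
          matrix_transpose_mul matrix_mul_assoc)
    also have "\<dots> = Jmat ** (transpose (U n) ** (Jmat ** Jmat ** Jmat) ** U n) ** Jmat"
      by (simp add: transpose_Jmat matrix_scale_left matrix_scale_right matrix_scale_scale matrix_mul_assoc)
    also have "\<dots> = mscale (- 1) (Jmat ** (transpose (U n) ** Jmat ** U n) ** Jmat)"
      by (simp add: Jmat_Jmat matrix_scale_left matrix_scale_right)
    finally have "Jinv (U n) ** Jmat ** transpose (Jinv (U n)) =
      mscale (- 1) (Jmat ** (transpose (U n) ** Jmat ** U n) ** Jmat)" .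
    moreover have "mcong (q ^ n) \<dots> (mscale (- 1) (Jmat ** Jmat ** Jmat))"
      by (intro mcong_scale mcong_mult mcong_refl Sp4_Zp_transpose assms)
    moreover have "mscale (- 1) (Jmat ** Jmat ** Jmat) = (Jmat :: int mat4)"
      by (simp add: Jmat_Jmat matrix_scale_left matrix_scale_scale)
    ultimately show ?thesis by simp
  qed
  moreover have "mcong (q ^ n) (Jinv (U (Suc n))) (Jinv (U n))" for n
    using assms unfolding Jinv_def by (intro mcong_scale mcong_mult mcong_refl mcong_transpose) (auto simp: Sp4_Zp_iff)
  ultimately show ?thesis by (simp add: Sp4_Zp_iff)
qed

lemma const_Sp4_Zp: "U ** Jmat ** transpose U = Jmat \<Longrightarrow> (\<lambda>_. U) \<in> Sp4_Zp p"
  by (simp add: Sp4_Zp_iff)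


section \<open>Divisibility by powers of p among the rationals\<close>

lemma not_dvd_prod: "\<not> q dvd a \<Longrightarrow> \<not> q dvd b \<Longrightarrow> \<not> q dvd a * b"
  using prime_int by (simp add: prime_dvd_mult_iff)

lemma not_dvd_one: "\<not> q dvd 1"
  using p_gt_1 by simp

lemma pd_int: "q ^ n dvd a \<Longrightarrow> padic_divides p n (of_int a)"
proof -
  assume "q ^ n dvd a"
  then obtain c where "a = q ^ n * c" by (elim dvdE)
  then have "of_int a = (of_int (q ^ n * c) / of_int 1 :: rat)" by simp
  then show ?thesis using not_dvd_one unfolding padic_divides_def by blast
qed

lemma pd_add:
  assumes "padic_divides p n x" "padic_divides p n y" shows "padic_divides p n (x + y)"
proof -
  obtain a b c d where 1: "\<not> q dvd b" "x = of_int (q ^ n * a) / of_int b"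
    "\<not> q dvd d" "y = of_int (q ^ n * c) / of_int d"
    using assms unfolding padic_divides_def by blast
  have nz: "b \<noteq> 0" "d \<noteq> 0" using 1 by auto
  have "x + y = of_int (q ^ n * (a * d + c * b)) / of_int (b * d)"
    unfolding 1 using nz by (simp add: field_simps)
  then show ?thesis using not_dvd_prod[OF 1(1,3)] unfolding padic_divides_def by blast
qed

lemma pd_mult:
  assumes "padic_divides p n x" "padic_divides p m y" shows "padic_divides p (n + m) (x * y)"
proof -
  obtain a b c d where 1: "\<not> q dvd b" "x = of_int (q ^ n * a) / of_int b"
    "\<not> q dvd d" "y = of_int (q ^ m * c) / of_int d"
    using assms unfolding padic_divides_def by blast
  have "x * y = of_int (q ^ (n + m) * (a * c)) / of_int (b * d)"
    unfolding 1 by (simp add: power_add field_simps)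
  then show ?thesis using not_dvd_prod[OF 1(1,3)] unfolding padic_divides_def by blast
qed

lemma pd_zero [simp]: "padic_divides p n 0"
  using pd_int[of n 0] by simp

lemma pd_minus: "padic_divides p n x \<Longrightarrow> padic_divides p n (- x)"
  using pd_mult[of 0 "- 1" n x] pd_int[of 0 "- 1"] by simp

lemma pd_sum: "(\<And>i. i \<in> I \<Longrightarrow> padic_divides p n (f i)) \<Longrightarrow> padic_divides p n (\<Sum>i\<in>I. f i)"
  by (induction I rule: infinite_finite_induct) (auto intro: pd_add)

lemma pd_mono: "padic_divides p n x \<Longrightarrow> m \<le> n \<Longrightarrow> padic_divides p m x"
  unfolding padic_divides_def
  by (metis (no_types, opaque_lifting) le_add_diff_inverse mult.assoc power_add)

lemma pd_denominator: "\<exists>k. padic_divides p 0 (of_nat p ^ k * x)"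
proof -
  obtain u v :: int where uv: "x = of_int u / of_int v" "v > 0" 
    by (metis Fract_of_int_quotient Rat_cases)
  obtain k w where kw: "v = q ^ k * w" "\<not> q dvd w"
    using multiplicity_decompose'[of v "q"] uv(2) not_dvd_one p_gt_1
    by (metis int_one_le_iff_zero_less mult.commute not_prime_unit order_less_irrefl prime_int)
  have "of_nat p ^ k * x = of_int (q ^ 0 * u) / of_int w"
    unfolding uv(1) kw(1) using p_gt_0 by simp
  then show ?thesis using kw(2) unfolding padic_divides_def by blast
qed

lemma pd_all_zero:
  assumes "\<And>n. padic_divides p n x" shows "x = 0"
proof (rule ccontr)
  assume "x \<noteq> 0"
  obtain u v :: int where uv: "x = of_int u / of_int v" "v > 0" 
    by (metis Fract_of_int_quotient Rat_cases)
  have u0: "u \<noteq> 0" using \<open>x \<noteq> 0\<close> uv by auto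
  have "q ^ n dvd u" for n
  proof -
    obtain a b where ab: "\<not> q dvd b" "x = of_int (q ^ n * a) / of_int b"
      using assms[of n] unfolding padic_divides_def by blast
    have "b \<noteq> 0" using ab by auto
    have "of_int (u * b) = (of_int (q ^ n * a * v) :: rat)"
      using ab(2) uv \<open>b \<noteq> 0\<close> by (simp add: field_simps)
    then have "u * b = q ^ n * a * v" by (simp only: of_int_eq_iff)
    then have "q ^ n dvd u * b" by simp
    moreover have "coprime (q ^ n) b"
      using ab(1) prime_int by (simp add: prime_imp_coprime)
    ultimately show ?thesis by (simp add: coprime_dvd_mult_left_iff)
  qed
  then have "q ^ nat \<bar>u\<bar> \<le> \<bar>u\<bar>" using dvd_imp_le_int[OF u0, of "q ^ nat \<bar>u\<bar>"] by simp
  moreover have "int (nat \<bar>u\<bar>) < int (p ^ nat \<bar>u\<bar>)"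
    using p_gt_1 by (metis less_exp of_nat_less_iff order_less_le_trans power_mono nat_less_iff Suc_1 Suc_leI zero_le)
  ultimately show False by simp
qed

lemma Z_inv_p_closed:
  "x \<in> Z_inv_p p \<Longrightarrow> y \<in> Z_inv_p p \<Longrightarrow> x + y \<in> Z_inv_p p"
  "x \<in> Z_inv_p p \<Longrightarrow> y \<in> Z_inv_p p \<Longrightarrow> x * y \<in> Z_inv_p p"
  "of_int a \<in> Z_inv_p p" "of_nat p powi k \<in> Z_inv_p p"
proof -
  assume "x \<in> Z_inv_p p" "y \<in> Z_inv_p p"
  then obtain a b k l where xy: "x = of_int a / of_nat p ^ k" "y = of_int b / of_nat p ^ l"
    unfolding Z_inv_p_def by blast
  have "x + y = of_int (a * q ^ l + b * q ^ k) / of_nat p ^ (k + l)"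
    unfolding xy using p_gt_0 by (simp add: power_add field_simps)
  then show "x + y \<in> Z_inv_p p" unfolding Z_inv_p_def by blast
  have "x * y = of_int (a * b) / of_nat p ^ (k + l)"
    unfolding xy by (simp add: power_add)
  then show "x * y \<in> Z_inv_p p" unfolding Z_inv_p_def by blast
next
  have "of_int a = (of_int a / of_nat p ^ 0 :: rat)" by simp
  then show "of_int a \<in> Z_inv_p p" unfolding Z_inv_p_def by blast
  show "of_nat p powi k \<in> Z_inv_p p"
  proof (cases "k \<ge> 0")
    case True
    then have "of_nat p powi k = (of_int (q ^ nat k) / of_nat p ^ 0 :: rat)" by (simp add: power_int_def)
    then show ?thesis unfolding Z_inv_p_def by blast
  next
    case False
    then have "of_nat p powi k = (of_int 1 / of_nat p ^ nat (- k) :: rat)"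
      by (simp add: power_int_def inverse_eq_divide power_one_over)
    then show ?thesis unfolding Z_inv_p_def by blast
  qed
qed

text \<open>One denominator is a power of \<open>p\<close>, another is prime to \<open>p\<close>.
  This is the passage from p-adic integrality back to the integers.\<close>

lemma Z_inv_p_integral:
  assumes "x \<in> Z_inv_p p" "padic_divides p 0 x" shows "x \<in> \<int>"
proof -
  obtain a k where a: "x = of_int a / of_nat p ^ k" using assms unfolding Z_inv_p_def by blast
  obtain c b where c: "\<not> q dvd b" "x = of_int c / of_int b" using assms unfolding padic_divides_def by auto
  have "b \<noteq> 0" using c by auto
  then have "of_int (a * b) = (of_int (q ^ k * c) :: rat)"
    using a c(2) p_gt_0 by (simp add: field_simps)
  then have "a * b = q ^ k * c" by (simp only: of_int_eq_iff)
  then have "q ^ k dvd a * b" by simp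
  moreover have "coprime (q ^ k) b"
    using c(1) prime_int by (simp add: prime_imp_coprime)
  ultimately obtain d where "a = q ^ k * d" by (auto simp: coprime_dvd_mult_left_iff)
  then have "x = of_int d" using a p_gt_0 by simp
  then show ?thesis by simp
qed

section \<open>Null sequences of rational matrices for the p-adic topology\<close>

definition pnull :: "(nat \<Rightarrow> rat mat4) \<Rightarrow> bool" where
  "pnull X \<longleftrightarrow> (\<forall>n. \<exists>m0. \<forall>m\<ge>m0. \<forall>i j. padic_divides p n (X m $ i $ j))"

definition pbdd :: "rat mat4 \<Rightarrow> bool" where
  "pbdd A \<longleftrightarrow> (\<forall>i j. padic_divides p 0 (A $ i $ j))"

lemma tendsto_iff_pnull: "padic_tendsto p X L \<longleftrightarrow> pnull (\<lambda>m. X m - L)"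
  by (simp add: padic_tendsto_def pnull_def)

lemma pnull_add: "pnull X \<Longrightarrow> pnull Y \<Longrightarrow> pnull (\<lambda>m. X m + Y m)"
  unfolding pnull_def
proof
  fix n assume "\<forall>n. \<exists>m0. \<forall>m\<ge>m0. \<forall>i j. padic_divides p n (X m $ i $ j)"
    "\<forall>n. \<exists>m0. \<forall>m\<ge>m0. \<forall>i j. padic_divides p n (Y m $ i $ j)"
  then obtain a b where "\<forall>m\<ge>a. \<forall>i j. padic_divides p n (X m $ i $ j)" "\<forall>m\<ge>b. \<forall>i j. padic_divides p n (Y m $ i $ j)"
    by blast
  then show "\<exists>m0. \<forall>m\<ge>m0. \<forall>i j. padic_divides p n ((X m + Y m) $ i $ j)"
    by (intro exI[of _ "max a b"]) (auto intro: pd_add)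
qed

lemma pnull_minus: "pnull X \<Longrightarrow> pnull (\<lambda>m. - X m)"
  unfolding pnull_def using pd_minus by (metis vector_uminus_component)

lemma pnull_bdd_left:
  assumes X: "pnull X" and A: "\<And>m. pbdd (A m)" shows "pnull (\<lambda>m. A m ** X m)"
  unfolding pnull_def
proof
  fix n
  obtain m0 where m0: "\<forall>m\<ge>m0. \<forall>i j. padic_divides p n (X m $ i $ j)" using X unfolding pnull_def by blast
  have "padic_divides p n ((A m ** X m) $ i $ j)" if "m \<ge> m0" for m i j
    using A[of m] m0 that pd_mult[of 0 _ n] by (auto simp: matrix_matrix_mult_def pbdd_def intro!: pd_sum)
  then show "\<exists>m0. \<forall>m\<ge>m0. \<forall>i j. padic_divides p n ((A m ** X m) $ i $ j)" by blast
qed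

lemma pnull_transpose: "pnull X \<Longrightarrow> pnull (\<lambda>m. transpose (X m))"
  by (simp add: pnull_def transpose_def) blast

lemma pnull_bdd_right:
  assumes X: "pnull X" and A: "\<And>m. pbdd (A m)" shows "pnull (\<lambda>m. X m ** A m)"
proof -
  have "pnull (\<lambda>m. transpose (A m) ** transpose (X m))"
    using A by (intro pnull_bdd_left pnull_transpose X) (simp add: pbdd_def transpose_def)
  from pnull_transpose[OF this] show ?thesis by (simp add: matrix_transpose_mul)
qed

lemma pnull_scale: "pnull X \<Longrightarrow> pnull (\<lambda>m. mscale c (X m))"
  unfolding pnull_def
proof
  fix n assume X: "\<forall>n. \<exists>m0. \<forall>m\<ge>m0. \<forall>i j. padic_divides p n (X m $ i $ j)"
  obtain k where k: "padic_divides p 0 (of_nat p ^ k * c)" using pd_denominator by blast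
  \<comment> \<open>The denominator of \<open>c\<close> may cost \<open>k\<close> factors
    \<open>p\<close>, so \<open>k\<close> extra factors are demanded of \<open>X\<close>.\<close>
  obtain m0 where m0: "\<forall>m\<ge>m0. \<forall>i j. padic_divides p (n + k) (X m $ i $ j)" using X by blast
  have "padic_divides p n (c * x)" if x: "padic_divides p (n + k) x" for x
  proof -
    obtain a b where ab: "\<not> q dvd b" "x = of_int (q ^ (n + k) * a) / of_int b"
      using x unfolding padic_divides_def by blast
    have "padic_divides p n (of_int (q ^ n * a) / of_int b)" using ab(1) unfolding padic_divides_def by blast
    from pd_mult[OF k this] show ?thesis unfolding ab by (simp add: power_add mult_ac)
  qed
  then show "\<exists>m0. \<forall>m\<ge>m0. \<forall>i j. padic_divides p n (mscale c (X m) $ i $ j)"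
    using m0 by (intro exI[of _ m0]) simp
qed

lemma pbdd_multiple: "\<exists>c. c \<noteq> 0 \<and> pbdd (mscale c A)"
proof -
  have "\<forall>i j. \<exists>k. padic_divides p 0 (of_nat p ^ k * A $ i $ j)" using pd_denominator by blast
  then obtain k where k: "\<And>i j. padic_divides p 0 (of_nat p ^ k i j * A $ i $ j)" by metis
  let ?K = "\<Sum>i\<in>UNIV. \<Sum>j\<in>UNIV. k i j"
  have "padic_divides p 0 (of_nat p ^ ?K * A $ i $ j)" for i j
  proof -
    have "k i j \<le> (\<Sum>j\<in>UNIV. k i j)" by (rule member_le_sum) auto
    also have "\<dots> \<le> ?K" by (rule member_le_sum[where f = "\<lambda>i. \<Sum>j\<in>UNIV. k i j"]) auto
    finally have "?K = (?K - k i j) + k i j" by simp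
    then have "of_nat p ^ ?K * A $ i $ j = of_int (q ^ (?K - k i j)) * (of_nat p ^ k i j * A $ i $ j)"
      by (metis (no_types, lifting) mult.assoc of_int_of_nat_eq of_int_power power_add)
    then show ?thesis using pd_mult[OF pd_int[of 0] k] by (metis add_0 one_dvd power_0)
  qed
  then show ?thesis using p_gt_0 by (intro exI[of _ "of_nat p ^ ?K"]) (auto simp: pbdd_def)
qed

text \<open>A fixed matrix need not be p-integral; it is first scaled to be so, and the scalar is
  divided out of the null sequence again.\<close>

lemma pnull_const_left:
  assumes X: "pnull X" shows "pnull (\<lambda>m. A ** X m)"
proof -
  obtain c where c: "c \<noteq> 0" "pbdd (mscale c A)" using pbdd_multiple by blast
  have "pnull (\<lambda>m. mscale (1 / c) (mscale c A ** X m))"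
    by (intro pnull_scale pnull_bdd_left X c)
  then show ?thesis using c(1) by (simp add: matrix_scale_left matrix_scale_scale)
qed

lemma pnull_const_right:
  assumes X: "pnull X" shows "pnull (\<lambda>m. X m ** A)"
proof -
  have "pnull (\<lambda>m. transpose A ** transpose (X m))" by (intro pnull_const_left pnull_transpose X)
  from pnull_transpose[OF this] show ?thesis by (simp add: matrix_transpose_mul)
qed

lemma pnull_const: "pnull (\<lambda>_. A) \<Longrightarrow> A = 0"
  unfolding pnull_def vec_eq_iff using pd_all_zero by (metis order_refl zero_index)

lemma pnull_zero [simp]: "pnull (\<lambda>_. 0)"
  by (simp add: pnull_def)

lemma pnull_mcong:
  assumes "\<And>n. mcong (q ^ n) (X n) (Y n)" shows "pnull (\<lambda>n. ratmat (X n) - ratmat (Y n))"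
  unfolding pnull_def
proof
  fix n
  have "padic_divides p n ((ratmat (X m) - ratmat (Y m)) $ i $ j)" if "m \<ge> n" for m i j
  proof -
    have "q ^ m dvd X m $ i $ j - Y m $ i $ j" using assms by (simp add: mcong_def cong_iff_dvd_diff)
    then have "padic_divides p m (of_int (X m $ i $ j - Y m $ i $ j))" by (rule pd_int)
    then show ?thesis using pd_mono that by simp
  qed
  then show "\<exists>m0. \<forall>m\<ge>m0. \<forall>i j. padic_divides p n ((ratmat (X m) - ratmat (Y m)) $ i $ j)" by blast
qed

lemma pbdd_ratmat [simp]: "pbdd (ratmat A)"
  by (simp add: pbdd_def pd_int)

end

subsection \<open>Cosets and row lattices\<close>

lemma ratmat_sandwich: "ratmat (A ** Jmat ** transpose A) = ratmat A ** Jmat ** transpose (ratmat A)"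
  by (simp add: map_of_int_Jmat map_of_int_transpose)

lemma matrix_diff_left: "(A - B) ** C = A ** C - B ** (C :: 'a::comm_ring_1 ^ 'n ^ 'm)"
  by (simp add: vec_eq_iff matrix_matrix_mult_def left_diff_distrib sum_subtractf)

lemma matrix_diff_right: "A ** (B - C) = A ** B - A ** (C :: 'a::comm_ring_1 ^ 'n ^ 'm)"
  by (simp add: vec_eq_iff matrix_matrix_mult_def right_diff_distrib sum_subtractf)

lemma Jmat_mult_nth:
  "(Jmat ** A) $ Inl i $ k = A $ Inr i $ k" "(Jmat ** A) $ Inr i $ k = - A $ Inl i $ k"
  "(A ** Jmat) $ k $ Inl i = - A $ k $ Inr i" "(A ** Jmat) $ k $ Inr i = A $ k $ Inl i"
  for A :: "'a::comm_ring_1 mat4"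
  using exhaust_2[of i] by (auto simp: matrix_matrix_mult_def sum_index4 Jmat_nth)

lemma Jinv_nth:
  "Jinv A $ Inl i $ Inl j = A $ Inr j $ Inr i" "Jinv A $ Inl i $ Inr j = - A $ Inl j $ Inr i"
  "Jinv A $ Inr i $ Inl j = - A $ Inr j $ Inl i" "Jinv A $ Inr i $ Inr j = A $ Inl j $ Inl i"
  by (simp_all add: Jinv_def Jmat_mult_nth transpose_def)

lemma mult_Jinv:
  fixes A :: "'a::comm_ring_1 mat4"
  assumes "A ** Jmat ** transpose A = mscale e Jmat"
  shows "A ** Jinv A = mscale e (mat 1)"
proof -
  have "A ** Jinv A = mscale (- 1) ((A ** Jmat ** transpose A) ** Jmat)"
    by (simp add: Jinv_def matrix_scale_right matrix_mul_assoc)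
  then show ?thesis unfolding assms by (simp add: matrix_scale_left matrix_scale_scale Jmat_Jmat)
qed

lemma Jinv_mult:
  fixes A :: "int mat4"
  assumes "A ** Jmat ** transpose A = mscale e Jmat" "e \<noteq> 0"
  shows "Jinv A ** A = mscale e (mat 1)"
proof -
  have "Jinv A ** A = mscale (- 1) (Jmat ** (transpose A ** Jmat ** A))"
    by (simp add: Jinv_def matrix_scale_left matrix_mul_assoc)
  then show ?thesis unfolding similitude_transpose_int[OF assms]
    by (simp add: matrix_scale_right matrix_scale_scale Jmat_Jmat)
qed

context prime_level begin

section \<open>The similitude group over Z[1/p]\<close>

lemma hecke_groupE:
  assumes "M \<in> \<H>"
  obtains k where "M ** Jmat ** transpose M = mscale (of_nat p powi k) Jmat"
    "\<And>i j. M $ i $ j \<in> Z_inv_p p" "\<And>i j. \<exists>x\<in>Z_inv_p p. M $ Inr i $ Inl j = of_nat N * x"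
  using assms unfolding hecke_group_def blockC_def by auto

lemma hecke_groupI:
  assumes "M ** Jmat ** transpose M = mscale (of_nat p powi k) Jmat"
    "\<And>i j. M $ i $ j \<in> Z_inv_p p" "\<And>i j. \<exists>x\<in>Z_inv_p p. M $ Inr i $ Inl j = of_nat N * x"
  shows "M \<in> \<H>"
  using assms unfolding hecke_group_def blockC_def by auto

lemma Z_inv_p_minus: "x \<in> Z_inv_p p \<Longrightarrow> - x \<in> Z_inv_p p"
  using Z_inv_p_closed(2)[of "- 1" x] Z_inv_p_closed(3)[of "- 1"] by simp

lemma Z_inv_p_sum: "(\<And>i. i \<in> I \<Longrightarrow> f i \<in> Z_inv_p p) \<Longrightarrow> (\<Sum>i\<in>I. f i) \<in> Z_inv_p p"
  using Z_inv_p_closed(3)[of 0]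
  by (induction I rule: infinite_finite_induct) (auto intro: Z_inv_p_closed)

lemma hecke_mult:
  assumes A: "A \<in> \<H>" and B: "B \<in> \<H>" shows "A ** B \<in> \<H>"
proof -
  obtain k where a: "A ** Jmat ** transpose A = mscale (of_nat p powi k) Jmat"
    "\<And>i j. A $ i $ j \<in> Z_inv_p p" "\<And>i j. \<exists>x\<in>Z_inv_p p. A $ Inr i $ Inl j = of_nat N * x"
    by (rule hecke_groupE[OF A]) blast
  obtain l where b: "B ** Jmat ** transpose B = mscale (of_nat p powi l) Jmat"
    "\<And>i j. B $ i $ j \<in> Z_inv_p p" "\<And>i j. \<exists>x\<in>Z_inv_p p. B $ Inr i $ Inl j = of_nat N * x"
    by (rule hecke_groupE[OF B]) blast
  show ?thesis
  proof (rule hecke_groupI)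
    have "A ** B ** Jmat ** transpose (A ** B) = A ** (B ** Jmat ** transpose B) ** transpose A"
      by (simp add: matrix_transpose_mul matrix_mul_assoc)
    also have "\<dots> = mscale (of_nat p powi (k + l)) Jmat"
      using p_gt_0 unfolding b by (simp add: matrix_scale_left matrix_scale_right a matrix_scale_scale power_int_add mult.commute)
    finally show "A ** B ** Jmat ** transpose (A ** B) = mscale (of_nat p powi (k + l)) Jmat" .
    show "(A ** B) $ i $ j \<in> Z_inv_p p" for i j
      unfolding matrix_matrix_mult_def using a b by (auto intro!: Z_inv_p_sum Z_inv_p_closed)
    show "\<exists>x\<in>Z_inv_p p. (A ** B) $ Inr i $ Inl j = of_nat N * x" for i j
    proof -
      obtain x where x: "\<And>i j. x i j \<in> Z_inv_p p" "\<And>i j. A $ Inr i $ Inl j = of_nat N * x i j" using a(3) by metis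
      obtain y where y: "\<And>i j. y i j \<in> Z_inv_p p" "\<And>i j. B $ Inr i $ Inl j = of_nat N * y i j" using b(3) by metis
      have "(A ** B) $ Inr i $ Inl j = of_nat N * (x i 1 * B $ Inl 1 $ Inl j + x i 2 * B $ Inl 2 $ Inl j
          + A $ Inr i $ Inr 1 * y 1 j + A $ Inr i $ Inr 2 * y 2 j)"
        by (simp add: matrix_matrix_mult_def sum_index4 x y algebra_simps)
      moreover have "x i 1 * B $ Inl 1 $ Inl j + x i 2 * B $ Inl 2 $ Inl j
          + A $ Inr i $ Inr 1 * y 1 j + A $ Inr i $ Inr 2 * y 2 j \<in> Z_inv_p p"
        by (intro Z_inv_p_closed x y a b)
      ultimately show ?thesis by blast
    qed
  qed
qed

lemma hecke_inv:
  assumes M: "M \<in> \<H>"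
  obtains M' where "M' \<in> \<H>" "M ** M' = mat 1" "M' ** M = mat 1"
proof -
  obtain k where a: "M ** Jmat ** transpose M = mscale (of_nat p powi k) Jmat"
    "\<And>i j. M $ i $ j \<in> Z_inv_p p" "\<And>i j. \<exists>x\<in>Z_inv_p p. M $ Inr i $ Inl j = of_nat N * x"
    by (rule hecke_groupE[OF M]) blast
  let ?e = "of_nat p powi k :: rat" and ?f = "of_nat p powi (- k) :: rat"
  have e: "?e \<noteq> 0" "?f * ?e = 1" using p_gt_0 by (simp_all add: power_int_minus)
  let ?M' = "mscale ?f (Jinv M)"
  have 1: "M ** ?M' = mat 1" using e mult_Jinv[OF a(1)] by (simp add: matrix_scale_right matrix_scale_scale)
  then have 2: "?M' ** M = mat 1" by (simp add: matrix_left_right_inverse)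
  have "Jmat = (?M' ** M) ** Jmat ** transpose (?M' ** M)" unfolding 2 by (simp add: transpose_mat)
  also have "\<dots> = ?M' ** (M ** Jmat ** transpose M) ** transpose ?M'"
    by (simp only: matrix_transpose_mul matrix_mul_assoc)
  also have "\<dots> = mscale ?e (?M' ** Jmat ** transpose ?M')"
    unfolding a(1) matrix_scale_right matrix_scale_left[of ?e] ..
  finally have J: "Jmat = mscale ?e (?M' ** Jmat ** transpose ?M')" .
  have "?M' ** Jmat ** transpose ?M' = mscale ?f Jmat"
    by (subst J) (simp only: matrix_scale_scale e matrix_scale_one)
  moreover have "?M' $ i $ j \<in> Z_inv_p p" for i j
    by (cases i; cases j) (auto simp: Jinv_nth intro!: Z_inv_p_closed Z_inv_p_minus a(2) simp del: mult_minus_right)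
  moreover have "\<exists>x\<in>Z_inv_p p. ?M' $ Inr i $ Inl j = of_nat N * x" for i j
  proof -
    obtain x where "x \<in> Z_inv_p p" "M $ Inr j $ Inl i = of_nat N * x" using a(3) by blast
    then have "?M' $ Inr i $ Inl j = of_nat N * (- (?f * x))" "- (?f * x) \<in> Z_inv_p p"
      by (simp_all add: Jinv_nth Z_inv_p_closed Z_inv_p_minus)
    then show ?thesis by blast
  qed
  ultimately have "?M' \<in> \<H>" by (rule hecke_groupI)
  then show ?thesis using 1 2 by (rule that)
qed

lemma ratmat_in_hecke: "Y \<in> \<S> r \<Longrightarrow> ratmat Y \<in> \<H>"
proof (rule hecke_groupI[where k = "int r"])
  assume Y: "Y \<in> \<S> r"
  show "ratmat Y ** Jmat ** transpose (ratmat Y) = mscale (of_nat p powi int r) Jmat"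
    using Y unfolding simZ_def by (simp flip: ratmat_sandwich add: map_of_int_scale map_of_int_Jmat)
  show "ratmat Y $ i $ j \<in> Z_inv_p p" for i j by (simp add: Z_inv_p_closed)
  show "\<exists>x\<in>Z_inv_p p. ratmat Y $ Inr i $ Inl j = of_nat N * x" for i j
  proof -
    obtain c where "Y $ Inr i $ Inl j = int N * c" using Y by (auto simp: simZ_def dvd_def)
    then show ?thesis using Z_inv_p_closed(3)[of c] by (intro bexI[of _ "of_int c"]) auto
  qed
qed

text \<open>Over Z[1/p] divisibility by \<open>N\<close> holds up to a power of \<open>p\<close>,
  which can be removed because it is prime to \<open>N\<close>.\<close>

lemma int_hecke:
  assumes M: "M \<in> \<H>" and int: "\<And>i j. M $ i $ j \<in> \<int>"
    and mult: "M ** Jmat ** transpose M = mscale (of_nat p ^ r) Jmat"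
  shows "M \<in> ratmat ` \<S> r"
proof -
  have "\<forall>i j. \<exists>a. M $ i $ j = of_int a" using int by (meson Ints_cases)
  then obtain a where a: "\<And>i j. M $ i $ j = of_int (a i j)" by metis
  define Y where "Y = (\<chi> i j. a i j)"
  have MY: "M = ratmat Y" by (simp add: vec_eq_iff a Y_def)
  have "ratmat (Y ** Jmat ** transpose Y) = ratmat (mscale (q ^ r) Jmat)"
    using mult unfolding MY ratmat_sandwich by (simp add: map_of_int_scale map_of_int_Jmat)
  then have 1: "Y ** Jmat ** transpose Y = mscale (q ^ r) Jmat" by (simp only: map_of_int_inj)
  have "int N dvd Y $ Inr i $ Inl j" for i j
  proof -
    obtain x where x: "x \<in> Z_inv_p p" "M $ Inr i $ Inl j = of_nat N * x"
      using M by (metis hecke_groupE)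
    obtain b k where b: "x = of_int b / of_nat p ^ k" using x(1) unfolding Z_inv_p_def by blast
    have "of_int (Y $ Inr i $ Inl j * q ^ k) = (of_int (int N * b) :: rat)"
      using x(2) b p_gt_0 unfolding MY by simp
    then have "Y $ Inr i $ Inl j * q ^ k = int N * b" by (simp only: of_int_eq_iff)
    then have "int N dvd Y $ Inr i $ Inl j * q ^ k" by simp
    moreover have "algebraic_semidom_class.coprime (int N) (q ^ k)" using coprime by simp
    ultimately show ?thesis by (simp add: coprime_dvd_mult_left_iff)
  qed
  then show ?thesis using 1 MY by (auto simp: simZ_def)
qed

text \<open>T(p^r) prescribes the multiplier through \<open>M^T J M\<close>, the group through
  \<open>M J M^T\<close>. The two agree for similitudes, and the multiplier is read off from an
  entry of \<open>J\<close>.\<close>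

lemma simZ_transpose_iff:
  "{M \<in> \<H>. (\<forall>i j. M $ i $ j \<in> \<int>) \<and>
        transpose M ** Jmat ** M = mscale (of_nat p ^ r) Jmat} = ratmat ` \<S> r"
proof (intro equalityI subsetI)
  fix M assume M: "M \<in> {M \<in> \<H>. (\<forall>i j. M $ i $ j \<in> \<int>) \<and>
        transpose M ** Jmat ** M = mscale (of_nat p ^ r) Jmat}"
  obtain k where k: "M ** Jmat ** transpose M = mscale (of_nat p powi k) Jmat"
    using M by (metis (no_types, lifting) hecke_groupE mem_Collect_eq)
  have "of_nat p powi k \<noteq> (0::rat)" using p_gt_0 by simp
  then have "mscale (of_nat p powi k) Jmat = mscale (of_nat p ^ r :: rat) Jmat"
    using similitude_transpose[OF k] M by simp
  then have "of_nat p powi k = (of_nat p ^ r :: rat)" by (rule Jmat_scale_inj)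
  then show "M \<in> ratmat ` \<S> r" using M k by (intro int_hecke) auto
next
  fix M assume "M \<in> ratmat ` \<S> r"
  then obtain Y where Y: "Y \<in> \<S> r" "M = ratmat Y" by blast
  have "transpose Y ** Jmat ** Y = mscale (q ^ r) Jmat"
    using Y(1) p_gt_0 by (intro similitude_transpose_int) (auto simp: simZ_def)
  then have "ratmat (transpose Y ** Jmat ** Y) = ratmat (mscale (q ^ r) Jmat)" by simp
  then show "M \<in> {M \<in> \<H>. (\<forall>i j. M $ i $ j \<in> \<int>) \<and>
        transpose M ** Jmat ** M = mscale (of_nat p ^ r) Jmat}"
    using ratmat_in_hecke[OF Y(1)] Y(2) by (simp add: map_of_int_scale map_of_int_Jmat map_of_int_transpose)
qed

section \<open>From p-adic cosets to integral matrices\<close>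

lemma limit_similitude:
  assumes X: "pnull (\<lambda>n. X n - L)" and bdd: "\<And>n. pbdd (X n)"
    and mult: "pnull (\<lambda>n. X n ** Jmat ** transpose (X n) - E)"
  shows "L ** Jmat ** transpose L = E" and "pbdd L"
proof -
  show "pbdd L"
  proof -
    obtain m where m: "\<forall>i j. padic_divides p 0 ((X m - L) $ i $ j)" using X unfolding pnull_def by blast
    have "padic_divides p 0 (L $ i $ j)" for i j
    proof -
      have "L $ i $ j = X m $ i $ j + - ((X m - L) $ i $ j)" by simp
      then show ?thesis using m bdd[of m] unfolding pbdd_def by (metis pd_add pd_minus)
    qed
    then show ?thesis by (simp add: pbdd_def)
  qed
  have t: "pbdd (transpose (X n))" for n using bdd by (simp add: pbdd_def transpose_def)
  have "pnull (\<lambda>n. (X n - L) ** Jmat ** transpose (X n))"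
    by (rule pnull_bdd_right[OF pnull_const_right[OF X] t])
  moreover have "pnull (\<lambda>n. L ** Jmat ** transpose (X n - L))"
    by (rule pnull_const_left[OF pnull_transpose[OF X]])
  \<comment> \<open>The summands telescope to the defect of \<open>L\<close> in the similitude
    equation, which is independent of \<open>n\<close>; a constant null sequence is zero.\<close>
  ultimately have null: "pnull (\<lambda>n. ((X n - L) ** Jmat ** transpose (X n) + L ** Jmat ** transpose (X n - L))
      + - (X n ** Jmat ** transpose (X n) - E))"
    by (intro pnull_add pnull_minus mult)
  have eq: "((X n - L) ** Jmat ** transpose (X n) + L ** Jmat ** transpose (X n - L))
      + - (X n ** Jmat ** transpose (X n) - E) = E - L ** Jmat ** transpose L" for n
  proof -
    have tr: "transpose (X n - L) = transpose (X n) - transpose L" by (simp add: vec_eq_iff transpose_def)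
    show ?thesis by (simp add: matrix_diff_left matrix_diff_right tr)
  qed
  have "E - L ** Jmat ** transpose L = 0" using null unfolding eq by (rule pnull_const)
  then show "L ** Jmat ** transpose L = E" by simp
qed

text \<open>After right division by \<open>M\<close>, the p-adic symplectic matrices converge to
  \<open>M' M^{-1}\<close>. This limit is p-integral and lies in the similitude group over Z[1/p],
  so it is integral of multiplier 1 and level \<open>N\<close>.\<close>

lemma in_left_coset_iff:
  assumes M: "M \<in> \<H>" and M': "M' \<in> \<H>"
  shows "in_left_coset p M M' \<longleftrightarrow> (\<exists>U\<in>\<S> 0. M' = ratmat U ** M)"
proof
  assume "in_left_coset p M M'"
  then obtain U where U: "U \<in> Sp4_Zp p" "pnull (\<lambda>n. ratmat (U n) ** M - M')"
    unfolding in_left_coset_def tendsto_iff_pnull by blast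
  obtain I where I: "I \<in> \<H>" "M ** I = mat 1" "I ** M = mat 1" using hecke_inv[OF M] by blast
  have "pnull (\<lambda>n. (ratmat (U n) ** M - M') ** I)" by (rule pnull_const_right[OF U(2)])
  then have lim: "pnull (\<lambda>n. ratmat (U n) - M' ** I)"
    by (simp add: matrix_diff_left matrix_mul_assoc[symmetric] I)
  have null: "pnull (\<lambda>n. ratmat (U n) ** Jmat ** transpose (ratmat (U n)) - Jmat)"
    using pnull_mcong[of "\<lambda>n. U n ** Jmat ** transpose (U n)" "\<lambda>_. Jmat"] U(1)
    by (simp add: Sp4_Zp_iff ratmat_sandwich[symmetric] map_of_int_Jmat del: map_of_int_mult)
  have "(M' ** I) ** Jmat ** transpose (M' ** I) = mscale (of_nat p ^ 0) Jmat" "pbdd (M' ** I)"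
    using limit_similitude[OF lim _ null] by auto
  moreover have MI: "M' ** I \<in> \<H>" by (rule hecke_mult[OF M' I(1)])
  moreover have "(M' ** I) $ i $ j \<in> \<int>" for i j
    using MI \<open>pbdd (M' ** I)\<close> Z_inv_p_integral unfolding pbdd_def by (metis hecke_groupE)
  ultimately have "M' ** I \<in> ratmat ` \<S> 0" by (intro int_hecke) auto
  then obtain V where "V \<in> \<S> 0" "M' ** I = ratmat V" by blast
  then show "\<exists>U\<in>\<S> 0. M' = ratmat U ** M"
    using I(3) by (metis matrix_mul_assoc matrix_mul_rid)
next
  assume "\<exists>U\<in>\<S> 0. M' = ratmat U ** M"
  then obtain U where U: "U \<in> \<S> 0" "M' = ratmat U ** M" by blast
  then have "(\<lambda>_. U) \<in> Sp4_Zp p" by (intro const_Sp4_Zp) (simp add: simZ_def)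
  then show "in_left_coset p M M'"
    unfolding in_left_coset_def tendsto_iff_pnull using U(2) by (intro bexI[of _ "\<lambda>_. U"]) simp_all
qed

lemma one_Sp4_Zp: "(\<lambda>_. mat 1) \<in> Sp4_Zp p"
  by (intro const_Sp4_Zp) (simp add: transpose_mat)

lemma double_coset_refl: "in_double_coset p M M"
  unfolding in_double_coset_def tendsto_iff_pnull
  by (intro bexI[OF _ one_Sp4_Zp]) (simp add: ratmat_one)

lemma double_coset_trans:
  assumes "in_double_coset p M M'" "in_double_coset p M' M''" shows "in_double_coset p M M''"
proof -
  obtain U V where UV: "U \<in> Sp4_Zp p" "V \<in> Sp4_Zp p" "pnull (\<lambda>n. ratmat (U n) ** M ** ratmat (V n) - M')"
    using assms(1) unfolding in_double_coset_def tendsto_iff_pnull by blast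
  obtain A B where AB: "A \<in> Sp4_Zp p" "B \<in> Sp4_Zp p" "pnull (\<lambda>n. ratmat (A n) ** M' ** ratmat (B n) - M'')"
    using assms(2) unfolding in_double_coset_def tendsto_iff_pnull by blast
  have "pnull (\<lambda>n. ratmat (A n) ** (ratmat (U n) ** M ** ratmat (V n) - M') ** ratmat (B n)
      + (ratmat (A n) ** M' ** ratmat (B n) - M''))"
    by (intro pnull_add AB(3) pnull_bdd_right pnull_bdd_left UV(3)) simp_all
  then have lim: "pnull (\<lambda>n. ratmat (A n ** U n) ** M ** ratmat (V n ** B n) - M'')"
    by (simp add: matrix_diff_left matrix_diff_right matrix_mul_assoc)
  show ?thesis
    unfolding in_double_coset_def tendsto_iff_pnull
    by (rule bexI[where x = "\<lambda>n. A n ** U n"], rule bexI[where x = "\<lambda>n. V n ** B n"])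
      (rule lim, rule Sp4_Zp_mult[OF UV(2) AB(2)], rule Sp4_Zp_mult[OF AB(1) UV(1)])
qed

lemma double_coset_sym:
  assumes "in_double_coset p M M'" shows "in_double_coset p M' M"
proof -
  obtain U V where UV: "U \<in> Sp4_Zp p" "V \<in> Sp4_Zp p" "pnull (\<lambda>n. ratmat (U n) ** M ** ratmat (V n) - M')"
    using assms(1) unfolding in_double_coset_def tendsto_iff_pnull by blast
  let ?A = "\<lambda>n. Jinv (U n)" and ?B = "\<lambda>n. Jinv (V n)"
  have a: "pnull (\<lambda>n. ratmat (?A n ** U n) - mat 1)" and b: "pnull (\<lambda>n. ratmat (V n ** ?B n) - mat 1)"
    using pnull_mcong[of "\<lambda>n. ?A n ** U n" "\<lambda>_. mat 1"] pnull_mcong[of "\<lambda>n. V n ** ?B n" "\<lambda>_. mat 1"]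
      Jinv_mod(1)[OF UV(1)] Jinv_mod(2)[OF UV(2)] by (simp_all add: ratmat_one)
  \<comment> \<open>\<open>?A\<close> and \<open>?B\<close> are inverses of \<open>U\<close> and
    \<open>V\<close> modulo p^n. The three errors, from \<open>M'\<close> and from the two
    approximate inverses, add up to \<open>?A M' ?B - M\<close>.\<close>
  have "pnull (\<lambda>n. - (ratmat (?A n) ** (ratmat (U n) ** M ** ratmat (V n) - M') ** ratmat (?B n))
      + ((ratmat (?A n ** U n) - mat 1) ** M ** ratmat (V n ** ?B n) + M ** (ratmat (V n ** ?B n) - mat 1)))"
    by (intro pnull_add pnull_minus pnull_bdd_right pnull_bdd_left UV(3) pnull_const_left[OF b]
        pnull_const_right[OF a]) (simp_all del: map_of_int_mult)
  moreover have "- (ratmat (?A n) ** (ratmat (U n) ** M ** ratmat (V n) - M') ** ratmat (?B n))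
      + ((ratmat (?A n ** U n) - mat 1) ** M ** ratmat (V n ** ?B n) + M ** (ratmat (V n ** ?B n) - mat 1))
      = ratmat (?A n) ** M' ** ratmat (?B n) - M" for n
    by (simp add: matrix_diff_left matrix_diff_right matrix_mul_assoc)
  ultimately have lim: "pnull (\<lambda>n. ratmat (?A n) ** M' ** ratmat (?B n) - M)" by simp
  show ?thesis
    unfolding in_double_coset_def tendsto_iff_pnull
    by (rule bexI[where x = ?A], rule bexI[where x = ?B])
      (rule lim, rule Jinv_Sp4_Zp[OF UV(2)], rule Jinv_Sp4_Zp[OF UV(1)])
qed

text \<open>Multiplication by p-adic symplectic matrices preserves p-integrality and the multiplier,
  and both pass to the limit; entries in Z[1/p] are then integers.\<close>

lemma double_coset_integral:
  assumes Y: "Y \<in> \<S> r" and M': "M' \<in> \<H>" and d: "in_double_coset p (ratmat Y) M'"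
  shows "M' \<in> ratmat ` \<S> r"
proof -
  obtain U V where UV: "U \<in> Sp4_Zp p" "V \<in> Sp4_Zp p" "pnull (\<lambda>n. ratmat (U n) ** ratmat Y ** ratmat (V n) - M')"
    using d unfolding in_double_coset_def tendsto_iff_pnull by blast
  define X where "X n = U n ** Y ** V n" for n
  have lim: "pnull (\<lambda>n. ratmat (X n) - M')" using UV(3) by (simp add: X_def)
  have "mcong (q ^ n) (X n ** Jmat ** transpose (X n)) (mscale (q ^ r) Jmat)" for n
  proof -
    have "X n ** Jmat ** transpose (X n) = U n ** (Y ** (V n ** Jmat ** transpose (V n)) ** transpose Y) ** transpose (U n)"
      by (simp add: X_def matrix_transpose_mul matrix_mul_assoc)
    moreover have "mcong (q ^ n) \<dots> (U n ** (Y ** Jmat ** transpose Y) ** transpose (U n))"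
      using UV(2) by (intro mcong_mult mcong_refl) (auto simp: Sp4_Zp_iff)
    moreover have "U n ** (Y ** Jmat ** transpose Y) ** transpose (U n) =
        mscale (q ^ r) (U n ** Jmat ** transpose (U n))"
      using Y by (simp add: simZ_def matrix_scale_left matrix_scale_right)
    moreover have "mcong (q ^ n) (mscale (q ^ r) (U n ** Jmat ** transpose (U n)))
        (mscale (q ^ r) Jmat)"
      using UV(1) by (intro mcong_scale) (auto simp: Sp4_Zp_iff)
    ultimately show ?thesis using mcong_trans by simp
  qed
  from pnull_mcong[of "\<lambda>n. X n ** Jmat ** transpose (X n)", OF this]
  have null: "pnull (\<lambda>n. ratmat (X n) ** Jmat ** transpose (ratmat (X n)) - mscale (of_nat p ^ r) Jmat)"
    by (simp add: ratmat_sandwich map_of_int_scale map_of_int_Jmat del: map_of_int_mult)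
  have "M' ** Jmat ** transpose M' = mscale (of_nat p ^ r) Jmat" "pbdd M'"
    using limit_similitude[OF lim _ null] by auto
  moreover have "M' $ i $ j \<in> \<int>" for i j
    using M' \<open>pbdd M'\<close> Z_inv_p_integral unfolding pbdd_def by (metis hecke_groupE)
  ultimately show ?thesis using M' by (intro int_hecke) auto
qed

section \<open>The Hecke operator as a sum over left cosets\<close>

definition coset_of :: "nat \<Rightarrow> ivec set \<Rightarrow> rat mat4 set" where
  "coset_of r L = ratmat ` {Y \<in> \<S> r. lat Y = L}"

lemma simZ_0_lat: 
  assumes "U \<in> \<S> 0" shows "lat (U ** Y) = lat Y"
proof (intro equalityI)
  show "lat (U ** Y) \<subseteq> lat Y" by (auto simp: lat_subset_iff_factor)
  have "Jinv U ** (U ** Y) = Y"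
    using Jinv_mult[of U 1] assms by (simp add: simZ_def matrix_mul_assoc)
  then show "lat Y \<subseteq> lat (U ** Y)" by (metis lat_subset_iff_factor)
qed

lemma lat_eq_iff:
  assumes "Y \<in> \<S> r" "Y' \<in> \<S> r"
  shows "lat Y' = lat Y \<longleftrightarrow> (\<exists>U\<in>\<S> 0. Y' = U ** Y)"
proof
  assume "lat Y' = lat Y"
  then show "\<exists>U\<in>\<S> 0. Y' = U ** Y"
    using lat_subset_iff[of Y' N p 0 r Y] assms p_gt_0 coprime by simp
qed (use simZ_0_lat in auto)

lemma left_coset_eq:
  assumes Y: "Y \<in> \<S> r" shows "left_coset N p (ratmat Y) = coset_of r (lat Y)"
proof (intro equalityI subsetI)
  fix M assume "M \<in> left_coset N p (ratmat Y)"
  then obtain U where U: "U \<in> \<S> 0" "M = ratmat (U ** Y)"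
    using in_left_coset_iff[OF ratmat_in_hecke[OF Y]] by (auto simp: left_coset_def)
  then show "M \<in> coset_of r (lat Y)"
    using simZ_mult[OF U(1) Y] simZ_0_lat[OF U(1)] unfolding coset_of_def U(2) by (intro imageI) simp
next
  fix M assume "M \<in> coset_of r (lat Y)"
  then obtain Y' where Y': "Y' \<in> \<S> r" "lat Y' = lat Y" "M = ratmat Y'" by (auto simp: coset_of_def)
  then obtain U where "U \<in> \<S> 0" "Y' = U ** Y" using lat_eq_iff[OF Y] by blast
  then show "M \<in> left_coset N p (ratmat Y)"
    using in_left_coset_iff[OF ratmat_in_hecke[OF Y] ratmat_in_hecke[OF Y'(1)]] Y' ratmat_in_hecke[OF Y'(1)]
    by (auto simp: left_coset_def)
qed

lemma coset_of_inj: "inj_on (coset_of r) (\<L> r)"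
proof (rule inj_onI)
  fix L L' assume L: "L \<in> \<L> r" "L' \<in> \<L> r" "coset_of r L = coset_of r L'"
  then obtain Y where "Y \<in> \<S> r" "L = lat Y" by (auto simp: lats_def)
  then have "ratmat Y \<in> coset_of r L'" using L(3) by (auto simp: coset_of_def)
  then show "L = L'" using \<open>L = lat Y\<close> by (auto simp: coset_of_def map_of_int_inj)
qed

lemma left_cosets_eq: "left_coset N p ` ratmat ` \<S> r = coset_of r ` \<L> r"
  unfolding lats_def image_image by (rule image_cong) (auto simp: left_coset_eq)

text \<open>The double cosets partition the integral similitudes of multiplier p^r, and each is a
  union of left cosets. The double sum therefore visits every left coset once, and left cosets
  correspond to lattices.\<close>

lemma hecke_T_eq_sum_cosets:
  "hecke_T N p r l1 l2 \<rho> F z = (\<Sum>L\<in>\<L> r. slash l1 l2 \<rho> F (SOME M. M \<in> coset_of r L) z)"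
proof -
  let ?G = "ratmat ` \<S> r"
  let ?D = "integral_double_cosets N p r"
  let ?f = "\<lambda>X. slash l1 l2 \<rho> F (SOME M. M \<in> X) z"
  have D: "?D = double_coset N p ` ?G"
    unfolding integral_double_cosets_def simZ_transpose_iff ..
  have sub: "S \<subseteq> ?G" if "S \<in> ?D" for S
    using that double_coset_integral unfolding D double_coset_def by blast
  have un: "\<Union> ?D = ?G"
  proof (intro equalityI)
    show "?G \<subseteq> \<Union> ?D" 
      unfolding D double_coset_def using double_coset_refl ratmat_in_hecke by blast
  qed (use sub in blast)
  have finG: "finite (left_coset N p ` ?G)"
    unfolding left_cosets_eq using finite_lats[OF p_gt_0] by simp
  have cls: "S = double_coset N p M" if "S \<in> ?D" "M \<in> S" for S M
  proof -
    obtain M0 where "S = double_coset N p M0" using \<open>S \<in> ?D\<close> unfolding D by blast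
    then show ?thesis using \<open>M \<in> S\<close> double_coset_sym double_coset_trans unfolding double_coset_def by blast
  qed
  have left_in_double: "in_double_coset p M M'" if G: "M \<in> ?G" "M' \<in> ?G" "M' \<in> left_coset N p M" for M M'
  proof -
    obtain U where U: "U \<in> \<S> 0" "M' = ratmat U ** M"
      using G in_left_coset_iff ratmat_in_hecke unfolding left_coset_def by blast
    have "(\<lambda>_. U) \<in> Sp4_Zp p" using U(1) by (intro const_Sp4_Zp) (simp add: simZ_def)
    then show ?thesis
      unfolding in_double_coset_def tendsto_iff_pnull using U(2)
      by (intro bexI[of _ "\<lambda>_. U"] bexI[OF _ one_Sp4_Zp]) (simp_all add: ratmat_one)
  qed
  have self: "M \<in> left_coset N p M" if "M \<in> ?G" for M
    using that left_coset_eq unfolding coset_of_def by auto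
  have disj: "S = S'" if S: "S \<in> ?D" "S' \<in> ?D" and X: "X \<in> left_coset N p ` S" "X \<in> left_coset N p ` S'" for S S' X
  proof -
    obtain M M' where M: "M \<in> S" "M' \<in> S'" "left_coset N p M = left_coset N p M'" using X by blast
    have G: "M \<in> ?G" "M' \<in> ?G" using M sub S by blast+
    have "in_double_coset p M M'" using left_in_double[OF G] self[OF G(2)] M(3) by simp
    moreover have "M' \<in> \<H>" using G(2) ratmat_in_hecke by blast
    ultimately have "M' \<in> double_coset N p M" by (simp add: double_coset_def)
    then have "M' \<in> S" using cls[OF S(1) M(1)] by simp
    then show ?thesis using cls S M(2) by metis
  qed
  have "?D \<subseteq> Pow ?G" using sub by blast
  \<comment> \<open>A sum over an infinite index set would be 0 by convention. Finiteness comes from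
    embedding the double cosets into the subsets of the finite set of left cosets.\<close>
  have finD: "finite ?D"
  proof -
    have "inj_on (\<lambda>S. left_coset N p ` S) ?D"
    proof (rule inj_onI)
      fix S S' assume S: "S \<in> ?D" "S' \<in> ?D" "left_coset N p ` S = left_coset N p ` S'"
      obtain M where "M \<in> S" using S(1) double_coset_refl ratmat_in_hecke unfolding D double_coset_def by blast
      then show "S = S'" using disj[OF S(1,2), of "left_coset N p M"] S(3) by blast
    qed
    moreover have "(\<lambda>S. left_coset N p ` S) ` ?D \<subseteq> Pow (left_coset N p ` ?G)" using sub by blast
    ultimately show ?thesis using finG by (meson finite_Pow_iff finite_imageD finite_subset)
  qed
  have "hecke_T N p r l1 l2 \<rho> F z = (\<Sum>S\<in>?D. \<Sum>X\<in>left_coset N p ` S. ?f X)"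
    by (simp add: hecke_T_def hecke_coset_op_def)
  also have "\<dots> = (\<Sum>X\<in>(\<Union>S\<in>?D. left_coset N p ` S). ?f X)"
  proof (rule sum.UNION_disjoint[symmetric])
    show "\<forall>S\<in>?D. finite (left_coset N p ` S)"
      using sub finG by (meson finite_subset image_mono)
    show "\<forall>S\<in>?D. \<forall>S'\<in>?D. S \<noteq> S' \<longrightarrow> left_coset N p ` S \<inter> left_coset N p ` S' = {}"
      using disj by blast
  qed (rule finD)
  also have "(\<Union>S\<in>?D. left_coset N p ` S) = coset_of r ` \<L> r"
    using left_cosets_eq[of r] un by (metis image_Union)
  also have "(\<Sum>X\<in>coset_of r ` \<L> r. ?f X) = (\<Sum>L\<in>\<L> r. ?f (coset_of r L))"
    by (simp add: sum.reindex[OF coset_of_inj])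
  finally show ?thesis .
qed

end

subsection \<open>Hecke operators as sums over lattices\<close>

locale siegel_form = prime_level +
  fixes l1 l2 :: nat and \<rho> :: "complex mat2 \<Rightarrow> complex ^ 'd ^ 'd" and F :: "complex mat2 \<Rightarrow> complex ^ 'd"
  assumes modular: "siegel_modular_form N l1 l2 \<rho> F"
begin

abbreviation act where "act \<equiv> slash l1 l2 \<rho>"

lemma hw: "highest_weight_rep l1 l2 \<rho>" and rep: "GL2_rep \<rho>"
  using modular by (auto simp: siegel_modular_form_def highest_weight_rep_def polynomial_rep_def)

lemma ratmat_GSp_pos: "Y \<in> \<S> r \<Longrightarrow> ratmat Y \<in> GSp_pos"
proof -
  assume "Y \<in> \<S> r"
  then have "ratmat Y ** Jmat ** transpose (ratmat Y) = mscale (of_nat p ^ r) Jmat"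
    unfolding simZ_def by (simp flip: ratmat_sandwich add: map_of_int_scale map_of_int_Jmat)
  then show ?thesis using p_gt_0 unfolding GSp_pos_def by (auto intro!: exI[of _ "of_nat p ^ r"])
qed

lemma slash_Gamma0:
  assumes U: "U \<in> \<S> 0" and z: "z \<in> siegel_H2"
  shows "act F (ratmat U) z = F z"
proof -
  have G: "ratmat U \<in> GSp_pos" using U by (rule ratmat_GSp_pos)
  have UJ: "U ** Jmat ** transpose U = Jmat" using U by (simp add: simZ_def)
  then have "U \<in> Gamma0 N" using U by (simp add: Gamma0_def Sp4_Z_def simZ_def blockC_def)
  then have F: "F (moebius4 (map_matrix of_int U) z) = \<rho> (cocycle (map_matrix of_int U) z) *v F z"
    using modular z unfolding siegel_modular_form_def by blast
  have C: "cmat (ratmat U) = map_matrix of_int U" by (simp add: vec_eq_iff)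
  have "ratmat U ** Jmat ** transpose (ratmat U) = mscale 1 Jmat"
    using UJ by (simp flip: ratmat_sandwich add: map_of_int_Jmat)
  then have sim: "similitude (ratmat U) = 1" by (rule similitude_eq)
  have "invertible (\<rho> (cocycle (map_matrix of_int U) z))"
    using rep_invertible[OF rep cocycle_invertible[OF G z]] by (simp only: C)
  then show ?thesis
    unfolding slash_def C F sim by (simp add: matrix_vector_mul_assoc matrix_inv_cancel)
qed

definition phi :: "int mat4 \<Rightarrow> complex mat2 \<Rightarrow> complex ^ 'd" where
  "phi Y z = act F (ratmat Y) z"

lemma phi_lat:
  assumes "Y \<in> \<S> r" "Y' \<in> \<S> r" "lat Y' = lat Y" and z: "z \<in> siegel_H2"
  shows "phi Y' z = phi Y z"
proof -
  obtain U where U: "U \<in> \<S> 0" "Y' = U ** Y" using lat_eq_iff assms by blast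
  have "phi Y' z = act (act F (ratmat U)) (ratmat Y) z"
    unfolding phi_def U(2) map_of_int_mult
    by (rule slash_mult[OF rep ratmat_GSp_pos[OF U(1)] ratmat_GSp_pos[OF assms(1)] z, symmetric])
  also have "\<dots> = phi Y z"
    unfolding phi_def by (rule slash_cong[OF ratmat_GSp_pos[OF assms(1)] z slash_Gamma0[OF U(1)]])
  finally show ?thesis .
qed

definition rep_of :: "nat \<Rightarrow> ivec set \<Rightarrow> int mat4" where
  "rep_of r L = (SOME Y. Y \<in> \<S> r \<and> lat Y = L)"

lemma rep_of:
  assumes "L \<in> \<L> r" shows "rep_of r L \<in> \<S> r" "lat (rep_of r L) = L"
  using someI_ex[of "\<lambda>Y. Y \<in> \<S> r \<and> lat Y = L"] assms unfolding rep_of_def lats_def by auto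

text \<open>The slash of \<open>F\<close> by a lattice, through a chosen representative; on the half
  space the choice is immaterial by \<open>phi_lat\<close>.\<close>

definition psi :: "nat \<Rightarrow> complex mat2 \<Rightarrow> ivec set \<Rightarrow> complex ^ 'd" where
  "psi r z L = phi (rep_of r L) z"

lemma psi_eq:
  assumes "Y \<in> \<S> r" "z \<in> siegel_H2" shows "psi r z (lat Y) = phi Y z"
proof -
  have "lat Y \<in> \<L> r" using assms by (simp add: lats_def)
  then show ?thesis unfolding psi_def using rep_of assms by (intro phi_lat[OF assms(1)]) auto
qed

lemma hecke_T_eq_sum:
  assumes z: "z \<in> siegel_H2"
  shows "hecke_T N p r l1 l2 \<rho> F z = (\<Sum>L\<in>\<L> r. psi r z L)"
  unfolding hecke_T_eq_sum_cosets
proof (rule sum.cong[OF refl])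
  fix L assume L: "L \<in> \<L> r"
  have "ratmat (rep_of r L) \<in> coset_of r L" using rep_of[OF L] by (simp add: coset_of_def)
  then have "(SOME M. M \<in> coset_of r L) \<in> coset_of r L" by (rule someI[of "\<lambda>M. M \<in> coset_of r L"])
  then obtain Y where Y: "Y \<in> \<S> r" "lat Y = L" "(SOME M. M \<in> coset_of r L) = ratmat Y"
    by (auto simp: coset_of_def)
  show "act F (SOME M. M \<in> coset_of r L) z = psi r z L"
    using psi_eq[OF Y(1) z] unfolding Y(2,3) phi_def by simp
qed

text \<open>The eigenvalue equation for T(p^r) is slashed by a representative of each lattice in the
  second sum. The result runs over pairs of a lattice \<open>Z\<close> of multiplier p^(r+s) and an
  intermediate lattice \<open>L\<close>; summing over \<open>Z\<close> first yields the count as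
  coefficient.\<close>

lemma compose_sum:
  assumes eig: "\<And>z. z \<in> siegel_H2 \<Longrightarrow> (\<Sum>L\<in>\<L> r. psi r z L) = a *s F z"
    and sub: "\<Y> \<subseteq> \<L> s" and z: "z \<in> siegel_H2"
  shows "a *s (\<Sum>L\<in>\<Y>. psi s z L) =
    (\<Sum>Z\<in>\<L> (r + s). of_nat (card {L \<in> \<Y>. Z \<subseteq> L}) *s psi (r + s) z Z)"
proof -
  have finY: "finite \<Y>" using sub finite_lats[OF p_gt_0] finite_subset by blast
  have fin: "finite (\<L> k)" for k by (rule finite_lats[OF p_gt_0])
  have inner: "a *s psi s z L = (\<Sum>Z\<in>{Z \<in> \<L> (r + s). Z \<subseteq> L}. psi (r + s) z Z)" if L: "L \<in> \<Y>" for L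
  proof -
    have L': "L \<in> \<L> s" using L sub by blast
    let ?Y = "rep_of s L"
    note Y = rep_of[OF L']
    have G: "ratmat ?Y \<in> GSp_pos" by (rule ratmat_GSp_pos[OF Y(1)])
    have "a *s psi s z L = act (\<lambda>z. a *s F z) (ratmat ?Y) z"
      by (simp add: psi_def phi_def slash_smult)
    also have "\<dots> = act (\<lambda>z. \<Sum>K\<in>\<L> r. psi r z K) (ratmat ?Y) z"
      by (rule slash_cong[OF G z]) (simp add: eig)
    also have "\<dots> = (\<Sum>K\<in>\<L> r. act (\<lambda>z. psi r z K) (ratmat ?Y) z)"
      by (rule slash_sum)
    also have "\<dots> = (\<Sum>K\<in>\<L> r. psi (r + s) z (lat (rep_of r K ** ?Y)))"
    proof (rule sum.cong[OF refl])
      fix K assume K: "K \<in> \<L> r"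
      note X = rep_of[OF K]
      have "act (\<lambda>z. psi r z K) (ratmat ?Y) z = act (act F (ratmat (rep_of r K))) (ratmat ?Y) z"
        by (simp add: psi_def phi_def)
      also have "\<dots> = phi (rep_of r K ** ?Y) z"
        unfolding phi_def map_of_int_mult by (rule slash_mult[OF rep ratmat_GSp_pos[OF X(1)] G z])
      also have "\<dots> = psi (r + s) z (lat (rep_of r K ** ?Y))"
        by (rule psi_eq[OF simZ_mult[OF X(1) Y(1)] z, symmetric])
      finally show "act (\<lambda>z. psi r z K) (ratmat ?Y) z = psi (r + s) z (lat (rep_of r K ** ?Y))" .
    qed
    \<comment> \<open>Right multiplication by the representative of \<open>L\<close> is injective on
      lattices since the representative cancels, and reaches every sublattice of the right
      multiplier by \<open>lat_subset_iff\<close>.\<close>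
    also have "\<dots> = (\<Sum>Z\<in>{Z \<in> \<L> (r + s). Z \<subseteq> L}. psi (r + s) z Z)"
    proof (rule sum.reindex_bij_betw[where g = "psi (r + s) z" and h = "\<lambda>K. lat (rep_of r K ** rep_of s L)"])
      show "bij_betw (\<lambda>K. lat (rep_of r K ** ?Y)) (\<L> r) {Z \<in> \<L> (r + s). Z \<subseteq> L}"
        unfolding bij_betw_def
      proof (intro conjI inj_onI, rule_tac [2] equalityI, rule_tac [2] subsetI, rule_tac [3] subsetI)
        fix K K' assume K: "K \<in> \<L> r" "K' \<in> \<L> r"
          and eq: "lat (rep_of r K ** ?Y) = lat (rep_of r K' ** ?Y)"
        obtain U where U: "U \<in> \<S> 0" "rep_of r K ** ?Y = U ** (rep_of r K' ** ?Y)"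
          using eq lat_eq_iff[OF simZ_mult[OF rep_of(1)[OF K(2)] Y(1)] simZ_mult[OF rep_of(1)[OF K(1)] Y(1)]] by blast
        have c: "A = B" if "A ** ?Y = B ** ?Y" for A B :: "int mat4"
        proof -
          have "A ** ?Y ** Jinv ?Y = B ** ?Y ** Jinv ?Y" using that by simp
          moreover have "?Y ** Jinv ?Y = mscale (q ^ s) (mat 1)"
            using Y(1) by (intro mult_Jinv) (simp add: simZ_def)
          ultimately have "mscale (q ^ s) A = mscale (q ^ s) B"
            by (simp add: matrix_mul_assoc[symmetric] matrix_scale_right)
          then show ?thesis using p_gt_0 by (simp add: vec_eq_iff)
        qed
        have "rep_of r K = U ** rep_of r K'" by (rule c) (simp add: U(2) matrix_mul_assoc)
        then show "K = K'" using simZ_0_lat[OF U(1)] rep_of(2)[OF K(1)] rep_of(2)[OF K(2)] by metis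
      next
        fix Z assume "Z \<in> (\<lambda>K. lat (rep_of r K ** ?Y)) ` \<L> r"
        then obtain K where K: "K \<in> \<L> r" "Z = lat (rep_of r K ** ?Y)" by blast
        have "Z \<subseteq> lat ?Y" unfolding K(2) lat_subset_iff_factor by blast
        then show "Z \<in> {Z \<in> \<L> (r + s). Z \<subseteq> L}"
          using simZ_mult[OF rep_of(1)[OF K(1)] Y(1)] Y(2) K(2) by (auto simp: lats_def)
      next
        fix Z assume Z: "Z \<in> {Z \<in> \<L> (r + s). Z \<subseteq> L}"
        then obtain B where B: "B \<in> \<S> (r + s)" "Z = lat B" by (auto simp: lats_def)
        then obtain X where X: "X \<in> \<S> r" "B = X ** ?Y"
          using lat_subset_iff[OF B(1) Y(1) p_gt_0 coprime] Z Y(2) by blast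
        have K: "lat X \<in> \<L> r" using X(1) by (simp add: lats_def)
        obtain U where U: "U \<in> \<S> 0" "rep_of r (lat X) = U ** X"
          using lat_eq_iff[OF X(1) rep_of(1)[OF K]] rep_of(2)[OF K] by blast
        have "Z = lat (rep_of r (lat X) ** ?Y)"
          unfolding B(2) X(2) U(2) matrix_mul_assoc[symmetric] simZ_0_lat[OF U(1)] ..
        then show "Z \<in> (\<lambda>K. lat (rep_of r K ** ?Y)) ` \<L> r" using K by blast
      qed
    qed
    finally show ?thesis .
  qed
  have "a *s (\<Sum>L\<in>\<Y>. psi s z L) = (\<Sum>L\<in>\<Y>. a *s psi s z L)"
    by (simp add: vec_eq_iff sum_distrib_left)
  also have "\<dots> = (\<Sum>L\<in>\<Y>. \<Sum>Z\<in>{Z \<in> \<L> (r + s). Z \<subseteq> L}. psi (r + s) z Z)"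
    by (rule sum.cong[OF refl inner])
  also have "\<dots> = (\<Sum>Z\<in>\<L> (r + s). \<Sum>L\<in>{L \<in> \<Y>. Z \<subseteq> L}. psi (r + s) z Z)"
    by (rule sum.swap_restrict[OF finY fin])
  also have "\<dots> = (\<Sum>Z\<in>\<L> (r + s). of_nat (card {L \<in> \<Y>. Z \<subseteq> L}) *s psi (r + s) z Z)"
    by (simp add: vec_eq_iff of_nat_index)
  finally show ?thesis .
qed

section \<open>Splitting the sums by rank modulo p\<close>

definition delta :: complex where
  "delta = of_nat p powi (int l1 + int l2 - 6)"

lemma psi_stretch:
  assumes Z: "Z \<in> \<L> s" and z: "z \<in> siegel_H2"
  shows "psi (s + 2) z (stretch Z) = delta *s psi s z Z"
proof -
  obtain Y where Y: "Y \<in> \<S> s" "Z = lat Y" using Z by (auto simp: lats_def)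
  have "psi (s + 2) z (stretch Z) = phi (mscale q Y) z"
    using Y simZ_stretch_iff z by (simp add: stretch_lat psi_eq)
  also have "\<dots> = act F (mscale (of_nat p) (ratmat Y)) z"
    by (simp add: phi_def map_of_int_scale)
  also have "\<dots> = delta *s phi Y z"
    using slash_scale(2)[OF hw ratmat_GSp_pos[OF Y(1)] z, of "of_nat p"] p_gt_0
    by (simp add: delta_def phi_def)
  finally show ?thesis using psi_eq[OF Y(1) z] Y(2) by simp
qed

definition Tsum :: "nat \<Rightarrow> complex mat2 \<Rightarrow> complex ^ 'd" where
  "Tsum r z = (\<Sum>L\<in>\<L> r. psi r z L)"

definition Rsum :: "nat \<Rightarrow> complex mat2 \<Rightarrow> complex ^ 'd" where
  "Rsum r z = (\<Sum>L\<in>{L \<in> \<L> r. rank_le1 p L}. psi r z L)"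

text \<open>The contribution of the lattices inside p Z^4. For \<open>r \<ge> 2\<close> these are
  the stretched lattices of multiplier p^(r-2), so it reduces to an earlier
  \<open>Tsum\<close>.\<close>

definition Osum :: "nat \<Rightarrow> complex mat2 \<Rightarrow> complex ^ 'd" where
  "Osum r z = (\<Sum>L\<in>{L \<in> \<L> r. rank0 p L}. psi r z L)"

lemma sum_smult: "(\<Sum>i\<in>I. c *s f i) = c *s (\<Sum>i\<in>I. f i :: complex ^ 'd)"
  by (simp add: vec_eq_iff sum_distrib_left)

lemma sum_of_bool:
  assumes "finite A"
  shows "(\<Sum>L\<in>A. of_bool (P L) *s f L) = (\<Sum>L\<in>{L \<in> A. P L}. f L :: complex ^ 'd)"
  using assms by (simp add: sum.inter_filter[symmetric] of_bool_def if_distrib[where f = "\<lambda>c. c *s _"] cong: if_cong)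

lemma Osum_stretch:
  assumes z: "z \<in> siegel_H2" shows "Osum (s + 2) z = delta *s Tsum s z"
proof -
  have "Osum (s + 2) z = (\<Sum>Z\<in>stretch ` \<L> s. psi (s + 2) z Z)"
    unfolding Osum_def rank0_lats_eq ..
  also have "\<dots> = (\<Sum>Z\<in>\<L> s. psi (s + 2) z (stretch Z))"
    by (simp add: sum.reindex[OF inj_on_subset[OF inj_stretch]])
  also have "\<dots> = (\<Sum>Z\<in>\<L> s. delta *s psi s z Z)"
    by (rule sum.cong[OF refl]) (rule psi_stretch[OF _ z])
  finally show ?thesis by (simp add: Tsum_def vec_eq_iff sum_distrib_left)
qed

lemma Rsum_1: "Rsum 1 z = 0" and Osum_1: "Osum 1 z = 0"
  unfolding Rsum_def Osum_def rank0_lats_1 by simp_all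

text \<open>With all lattices of multiplier \<open>p\<close> as second factor, the nested indicators
  of \<open>card_lagrangians_above\<close> separate into \<open>Tsum\<close>, \<open>Rsum\<close>
  and \<open>Osum\<close>.\<close>

lemma Tsum_compose:
  assumes eig: "\<And>z. z \<in> siegel_H2 \<Longrightarrow> Tsum (s + 1) z = a *s F z" and z: "z \<in> siegel_H2"
  shows "a *s Tsum 1 z = Tsum (s + 2) z + of_nat p *s Rsum (s + 2) z
     + (of_nat p ^ 2 + of_nat p ^ 3) *s (delta *s Tsum s z)"
proof -
  have fin: "finite (\<L> k)" for k by (rule finite_lats[OF p_gt_0])
  have "a *s Tsum 1 z = (\<Sum>Z\<in>\<L> (s + 1 + 1). of_nat (card {L \<in> \<L> 1. Z \<subseteq> L}) *s psi (s + 1 + 1) z Z)"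
    unfolding Tsum_def using eig unfolding Tsum_def by (intro compose_sum z) auto
  also have "\<dots> = (\<Sum>Z\<in>\<L> (s + 2). psi (s + 2) z Z + of_nat p *s (of_bool (rank_le1 p Z) *s psi (s + 2) z Z)
       + (of_nat p ^ 2 + of_nat p ^ 3) *s (of_bool (rank0 p Z) *s psi (s + 2) z Z))"
  proof (rule sum.cong)
    fix Z assume Z: "Z \<in> \<L> (s + 2)"
    have "(of_nat (card {L \<in> \<L> 1. Z \<subseteq> L}) :: complex) =
        1 + of_nat p * of_bool (rank_le1 p Z) + (of_nat p ^ 2 + of_nat p ^ 3) * of_bool (rank0 p Z)"
      by (subst card_lagrangians_above[OF Z]) (simp_all del: One_nat_def)
    then show "of_nat (card {L \<in> \<L> 1. Z \<subseteq> L}) *s psi (s + 1 + 1) z Z =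
       psi (s + 2) z Z + of_nat p *s (of_bool (rank_le1 p Z) *s psi (s + 2) z Z)
       + (of_nat p ^ 2 + of_nat p ^ 3) *s (of_bool (rank0 p Z) *s psi (s + 2) z Z)"
      by (simp only: vector_sadd_rdistrib vector_smult_assoc vector_smult_lid add.assoc one_add_one)
  qed simp
  also have "\<dots> = Tsum (s + 2) z + of_nat p *s (\<Sum>Z\<in>\<L> (s + 2). of_bool (rank_le1 p Z) *s psi (s + 2) z Z)
       + (of_nat p ^ 2 + of_nat p ^ 3) *s (\<Sum>Z\<in>\<L> (s + 2). of_bool (rank0 p Z) *s psi (s + 2) z Z)"
    by (simp only: Tsum_def sum.distrib sum_smult)
  also have "\<dots> = Tsum (s + 2) z + of_nat p *s Rsum (s + 2) z + (of_nat p ^ 2 + of_nat p ^ 3) *s Osum (s + 2) z"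
    by (simp only: sum_of_bool[OF fin] Rsum_def Osum_def)
  finally show ?thesis by (simp only: Osum_stretch[OF z])
qed

text \<open>With the line lattices as second factor, a lattice outside p Z^4 is counted by its
  rank-one indicator alone. A lattice \<open>p Z\<close> carries an excess that depends on the rank
  of \<open>Z\<close>, which brings back the three sums at multiplier p^s with a factor
  \<open>delta\<close>.\<close>

lemma Rsum_compose:
  assumes s: "s > 0" and eig: "\<And>z. z \<in> siegel_H2 \<Longrightarrow> Tsum s z = a *s F z" and z: "z \<in> siegel_H2"
  shows "a *s Rsum 2 z = Rsum (s + 2) z + delta *s ((of_nat p + of_nat p ^ 2) *s Tsum s z
     + of_nat p ^ 3 *s Rsum s z + of_nat p ^ 4 *s Osum s z)"
proof -
  have fin: "finite (\<L> k)" for k by (rule finite_lats[OF p_gt_0])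
  \<comment> \<open>The excess over the rank-one indicator. The truncated subtraction is exact where
    it is used, for \<open>Z\<close> in p Z^4, since p Z^4 is then one of the line lattices
    counted.\<close>
  let ?c = "\<lambda>Z. card {L \<in> line_lats. Z \<subseteq> L} - of_bool (rank_le1 p Z)"
  have split: "card {L \<in> line_lats. Z \<subseteq> L} = of_bool (rank_le1 p Z) + of_bool (rank0 p Z) * ?c Z"
    if Z: "Z \<in> \<L> (s + 2)" for Z
  proof (cases "rank0 p Z")
    case True
    then obtain Z0 where "Z0 \<in> \<L> s" "Z = stretch Z0" using rank0_lats[OF Z] by blast
    then show ?thesis using True card_lines_above_stretch[OF _ s, of Z0] rank0_imp_rank_le1[OF True] by simp
  next
    case False
    then show ?thesis using card_lines_above[OF Z _ False] by simp
  qed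
  have "a *s Rsum 2 z = a *s (\<Sum>L\<in>line_lats. psi 2 z L)" by (simp add: Rsum_def line_lats_def)
  also have "\<dots> = (\<Sum>Z\<in>\<L> (s + 2). of_nat (card {L \<in> line_lats. Z \<subseteq> L}) *s psi (s + 2) z Z)"
    using eig unfolding Tsum_def by (intro compose_sum z) (auto simp: line_lats_def)
  also have "\<dots> = (\<Sum>Z\<in>\<L> (s + 2). of_bool (rank_le1 p Z) *s psi (s + 2) z Z
       + of_bool (rank0 p Z) *s (of_nat (?c Z) *s psi (s + 2) z Z))"
  proof (rule sum.cong[OF refl])
    fix Z assume Z: "Z \<in> \<L> (s + 2)"
    have "(of_nat (card {L \<in> line_lats. Z \<subseteq> L}) :: complex) = of_bool (rank_le1 p Z) + of_bool (rank0 p Z) * of_nat (?c Z)"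
      by (subst split[OF Z]) (simp only: of_nat_add of_nat_mult of_nat_of_bool)
    then show "of_nat (card {L \<in> line_lats. Z \<subseteq> L}) *s psi (s + 2) z Z = of_bool (rank_le1 p Z) *s psi (s + 2) z Z
       + of_bool (rank0 p Z) *s (of_nat (?c Z) *s psi (s + 2) z Z)"
      by (simp only: vector_sadd_rdistrib vector_smult_assoc)
  qed
  also have "\<dots> = Rsum (s + 2) z + (\<Sum>Z\<in>{Z \<in> \<L> (s + 2). rank0 p Z}. of_nat (?c Z) *s psi (s + 2) z Z)"
    by (simp only: sum.distrib sum_of_bool[OF fin] Rsum_def)
  also have "(\<Sum>Z\<in>{Z \<in> \<L> (s + 2). rank0 p Z}. of_nat (?c Z) *s psi (s + 2) z Z)
      = (\<Sum>Z\<in>\<L> s. of_nat (?c (stretch Z)) *s psi (s + 2) z (stretch Z))"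
    unfolding rank0_lats_eq by (simp add: sum.reindex[OF inj_on_subset[OF inj_stretch]])
  also have "\<dots> = (\<Sum>Z\<in>\<L> s. delta *s ((of_nat p + of_nat p ^ 2) *s psi s z Z
     + of_nat p ^ 3 *s (of_bool (rank_le1 p Z) *s psi s z Z) + of_nat p ^ 4 *s (of_bool (rank0 p Z) *s psi s z Z)))"
  proof (rule sum.cong[OF refl])
    fix Z assume Z: "Z \<in> \<L> s"
    have "?c (stretch Z) = p + p ^ 2 + p ^ 3 * of_bool (rank_le1 p Z) + p ^ 4 * of_bool (rank0 p Z)"
      using card_lines_above_stretch[OF Z s] rank0_imp_rank_le1[OF rank0_stretch] by simp
    then show "of_nat (?c (stretch Z)) *s psi (s + 2) z (stretch Z) = delta *s ((of_nat p + of_nat p ^ 2) *s psi s z Z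
     + of_nat p ^ 3 *s (of_bool (rank_le1 p Z) *s psi s z Z) + of_nat p ^ 4 *s (of_bool (rank0 p Z) *s psi s z Z))"
      unfolding psi_stretch[OF Z z] by (simp add: vec_eq_iff algebra_simps)
  qed
  also have "\<dots> = delta *s ((of_nat p + of_nat p ^ 2) *s Tsum s z
     + of_nat p ^ 3 *s (\<Sum>Z\<in>\<L> s. of_bool (rank_le1 p Z) *s psi s z Z)
     + of_nat p ^ 4 *s (\<Sum>Z\<in>\<L> s. of_bool (rank0 p Z) *s psi s z Z))"
    by (simp only: Tsum_def sum.distrib sum_smult)
  finally show ?thesis by (simp only: sum_of_bool[OF fin] Rsum_def Osum_def)
qed

lemma Tsum_0:
  assumes z: "z \<in> siegel_H2" shows "Tsum 0 z = F z"
proof -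
  have one: "mat 1 \<in> \<S> 0" by (simp add: simZ_iff_sp all_index4 all_index2 mat_def sp_def Jmat_nth)
  have "lat Y = lat (mat 1)" if "Y \<in> \<S> 0" for Y using simZ_0_lat[OF that, of "mat 1"] by simp
  then have "\<L> 0 = {lat (mat 1)}" using one unfolding lats_def by blast
  then have "Tsum 0 z = phi (mat 1) z" using psi_eq[OF one z] by (simp add: Tsum_def)
  then show ?thesis using slash_Gamma0[OF one z] by (simp add: phi_def)
qed

end

subsection \<open>Relations between eigenvalues\<close>

text \<open>Multiplied by \<open>P\<close>, relation \<open>e3\<close> carries exactly the
  \<open>d\<close> term of \<open>e2\<close>, so both cancel and
  \<open>a3 = a1 * (a2 - P * R2)\<close>. Thus \<open>d\<close> survives only through
  \<open>R2\<close> in \<open>e1\<close>.\<close>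

lemma third_eigenvalue_identity:
  fixes P d a1 a2 a3 R2 R3 :: complex
  assumes e1: "a1 ^ 2 = a2 + P * R2 + (P ^ 2 + P ^ 3) * d"
    and e2: "a2 * a1 = a3 + P * R3 + (P ^ 2 + P ^ 3) * (d * a1)"
    and e3: "a1 * R2 = R3 + d * ((P + P ^ 2) * a1)"
  shows "a3 = a1 * (2 * a2 - a1 ^ 2 + (P ^ 2 + P ^ 3) * d)"
proof -
  have R3: "R3 = a1 * R2 - d * ((P + P ^ 2) * a1)" using e3 by simp
  have "a3 = a2 * a1 - P * R3 - (P ^ 2 + P ^ 3) * (d * a1)" using e2 by (simp add: algebra_simps)
  also have "\<dots> = a1 * (a2 - P * R2)"
    unfolding R3 by (simp add: algebra_simps power2_eq_square power3_eq_cube)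
  also have "P * R2 = a1 ^ 2 - a2 - (P ^ 2 + P ^ 3) * d" using e1 by (simp add: algebra_simps)
  finally show ?thesis by (simp add: algebra_simps)
qed

text \<open>When the first eigenvalue is zero, the even ones obey a three-term recurrence with
  characteristic polynomial \<open>X^2 - (a2 + P^2 d) X + P^6 d^2\<close>, starting from the values
  1 and \<open>a2\<close>.\<close>

lemma even_eigenvalue_identities:
  fixes P d a2 a4 a6 R2 R4 R6 :: complex
  assumes f2: "0 = a2 + P * R2 + (P ^ 2 + P ^ 3) * d"
    and f4: "0 = a4 + P * R4 + (P ^ 2 + P ^ 3) * (d * a2)"
    and f6: "0 = a6 + P * R6 + (P ^ 2 + P ^ 3) * (d * a4)"
    and g4: "a2 * R2 = R4 + d * ((P + P ^ 2) * a2 + P ^ 3 * R2 + P ^ 4 * d)"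
    and g6: "a4 * R2 = R6 + d * ((P + P ^ 2) * a4 + P ^ 3 * R4 + P ^ 4 * (d * a2))"
  shows "a4 = (a2 + P ^ 2 * d) * a2 - P ^ 6 * d ^ 2"
    and "a6 = (a2 + P ^ 2 * d) * a4 - P ^ 6 * d ^ 2 * a2"
proof -
  have R4: "R4 = a2 * R2 - d * ((P + P ^ 2) * a2 + P ^ 3 * R2 + P ^ 4 * d)" using g4 by simp
  have R6: "R6 = a4 * R2 - d * ((P + P ^ 2) * a4 + P ^ 3 * R4 + P ^ 4 * (d * a2))" using g6 by simp
  have PR2: "P * R2 = - a2 - (P ^ 2 + P ^ 3) * d" using f2 by (simp add: eq_neg_iff_add_eq_0 algebra_simps)
  have PR4: "P * R4 = - a4 - (P ^ 2 + P ^ 3) * (d * a2)" using f4 by (simp add: eq_neg_iff_add_eq_0 algebra_simps)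
  have "a4 = - (P * R4) - (P ^ 2 + P ^ 3) * (d * a2)" unfolding PR4 by simp
  also have "P * R4 = a2 * (P * R2) - d * ((P ^ 2 + P ^ 3) * a2 + P ^ 3 * (P * R2) + P ^ 5 * d)"
    unfolding R4 by (simp add: algebra_simps eval_nat_numeral)
  finally show "a4 = (a2 + P ^ 2 * d) * a2 - P ^ 6 * d ^ 2"
    unfolding PR2 by (simp add: algebra_simps eval_nat_numeral)
  have "P * R6 = - a6 - (P ^ 2 + P ^ 3) * (d * a4)" using f6 by (simp add: eq_neg_iff_add_eq_0 algebra_simps)
  then have "a6 = - (P * R6) - (P ^ 2 + P ^ 3) * (d * a4)" by simp
  also have "P * R6 = a4 * (P * R2) - d * ((P ^ 2 + P ^ 3) * a4 + P ^ 3 * (P * R4) + P ^ 5 * d * a2)"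
    unfolding R6 by (simp add: algebra_simps eval_nat_numeral)
  finally show "a6 = (a2 + P ^ 2 * d) * a4 - P ^ 6 * d ^ 2 * a2"
    unfolding PR2 PR4 by (simp add: algebra_simps eval_nat_numeral)
qed

context siegel_form begin

text \<open>The operator identities are evaluated in a coordinate of \<open>F z0\<close> that does
  not vanish; dividing by it turns them into scalar relations in which the unknown
  \<open>R r\<close> can be eliminated.\<close>

lemma eigenvalue_relations:
  assumes nz: "z0 \<in> siegel_H2" "F z0 \<noteq> 0"
    and a: "\<And>r z. z \<in> siegel_H2 \<Longrightarrow> hecke_T N p r l1 l2 \<rho> F z = a (p ^ r) *s F z"
  shows "a (p ^ 3) = a p * (2 * a (p ^ 2) - a p ^ 2 + (of_nat p ^ 2 + of_nat p ^ 3) * delta)"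
    and "a p = 0 \<Longrightarrow> a (p ^ 4) = (a (p ^ 2) + of_nat p ^ 2 * delta) * a (p ^ 2) - of_nat p ^ 6 * delta ^ 2"
    and "a p = 0 \<Longrightarrow> a (p ^ 6) = (a (p ^ 2) + of_nat p ^ 2 * delta) * a (p ^ 4) - of_nat p ^ 6 * delta ^ 2 * a (p ^ 2)"
proof -
  let ?p = "of_nat p :: complex"
  have T: "Tsum r z = a (p ^ r) *s F z" if "z \<in> siegel_H2" for r z
    using a[OF that] hecke_T_eq_sum[OF that] by (simp add: Tsum_def)
  obtain i where i: "F z0 $ i \<noteq> 0" using nz(2) by (auto simp: vec_eq_iff)
  \<comment> \<open>Only a ratio at the single point \<open>z0\<close>: \<open>Rsum r\<close> has
    not been shown to be a multiple of \<open>F\<close>.\<close>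
  define R where "R r = Rsum r z0 $ i / F z0 $ i" for r
  define S where "S r = Osum r z0 $ i / F z0 $ i" for r
  have RS: "Rsum r z0 $ i = R r * F z0 $ i" "Osum r z0 $ i = S r * F z0 $ i" for r
    using i by (simp_all add: R_def S_def)
  have Tc: "a (p ^ (s + 1)) * a p = a (p ^ (s + 2)) + ?p * R (s + 2) + (?p ^ 2 + ?p ^ 3) * (delta * a (p ^ s))" for s
  proof -
    have "a (p ^ (s + 1)) *s Tsum 1 z0 = Tsum (s + 2) z0 + ?p *s Rsum (s + 2) z0
       + (?p ^ 2 + ?p ^ 3) *s (delta *s Tsum s z0)"
      by (rule Tsum_compose[OF T nz(1)])
    from arg_cong[OF this, of "\<lambda>v. v $ i"]
    have "(a (p ^ (s + 1)) * a p) * F z0 $ i =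
        (a (p ^ (s + 2)) + ?p * R (s + 2) + (?p ^ 2 + ?p ^ 3) * (delta * a (p ^ s))) * F z0 $ i"
      by (simp add: T[OF nz(1)] RS algebra_simps)
    then show ?thesis using i by (simp only: mult_cancel_right) simp
  qed
  have Rc: "a (p ^ s) * R 2 = R (s + 2) + delta * ((?p + ?p ^ 2) * a (p ^ s) + ?p ^ 3 * R s + ?p ^ 4 * S s)"
    if s: "s > 0" for s
  proof -
    have "a (p ^ s) *s Rsum 2 z0 = Rsum (s + 2) z0 + delta *s ((?p + ?p ^ 2) *s Tsum s z0
     + ?p ^ 3 *s Rsum s z0 + ?p ^ 4 *s Osum s z0)"
      by (rule Rsum_compose[OF s T nz(1)])
    from arg_cong[OF this, of "\<lambda>v. v $ i"]
    have "(a (p ^ s) * R 2) * F z0 $ i =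
        (R (s + 2) + delta * ((?p + ?p ^ 2) * a (p ^ s) + ?p ^ 3 * R s + ?p ^ 4 * S s)) * F z0 $ i"
      by (simp add: T[OF nz(1)] RS algebra_simps)
    then show ?thesis using i by (simp only: mult_cancel_right) simp
  qed
  have a0: "a 1 = 1"
  proof -
    have "a 1 * F z0 $ i = F z0 $ i"
      using arg_cong[OF T[OF nz(1), of 0], of "\<lambda>v. v $ i"] Tsum_0[OF nz(1)] by simp
    then show ?thesis using i by simp
  qed
  have S2: "S (s + 2) = delta * a (p ^ s)" for s
    using i Osum_stretch[OF nz(1), of s] by (simp add: S_def T[OF nz(1)])
  \<comment> \<open>Lattices of multiplier \<open>p\<close> have rank two modulo \<open>p\<close>,
    so both partial sums are empty.\<close>
  have RS1: "R 1 = 0" "S 1 = 0" by (simp_all add: R_def S_def Rsum_1[simplified] Osum_1[simplified])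
  have e1: "a p ^ 2 = a (p ^ 2) + ?p * R 2 + (?p ^ 2 + ?p ^ 3) * delta"
    using Tc[of 0] a0 by (simp add: numeral_2_eq_2)
  have e2: "a (p ^ 2) * a p = a (p ^ 3) + ?p * R 3 + (?p ^ 2 + ?p ^ 3) * (delta * a p)"
    using Tc[of 1] by (simp add: numeral_2_eq_2 numeral_3_eq_3)
  have e3: "a p * R 2 = R 3 + delta * ((?p + ?p ^ 2) * a p)"
    using Rc[of 1] RS1 by (simp add: numeral_3_eq_3 numeral_2_eq_2)
  show "a (p ^ 3) = a p * (2 * a (p ^ 2) - a p ^ 2 + (?p ^ 2 + ?p ^ 3) * delta)"
    using e1 e2 e3 by (rule third_eigenvalue_identity)
  assume ap: "a p = 0"
  have f2: "0 = a (p ^ 2) + ?p * R 2 + (?p ^ 2 + ?p ^ 3) * delta" using e1 ap by simp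
  have f4: "0 = a (p ^ 4) + ?p * R 4 + (?p ^ 2 + ?p ^ 3) * (delta * a (p ^ 2))"
    using Tc[of 2] ap by simp
  have f6: "0 = a (p ^ 6) + ?p * R 6 + (?p ^ 2 + ?p ^ 3) * (delta * a (p ^ 4))"
    using Tc[of 4] ap by simp
  have g4: "a (p ^ 2) * R 2 = R 4 + delta * ((?p + ?p ^ 2) * a (p ^ 2) + ?p ^ 3 * R 2 + ?p ^ 4 * delta)"
  proof -
    have "S 2 = delta" using S2[of 0] a0 by (simp add: numeral_2_eq_2)
    then show ?thesis using Rc[of 2] by simp
  qed
  have g6: "a (p ^ 4) * R 2 = R 6 + delta * ((?p + ?p ^ 2) * a (p ^ 4) + ?p ^ 3 * R 4 + ?p ^ 4 * (delta * a (p ^ 2)))"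
    using Rc[of 4] S2[of 2] by simp
  show "a (p ^ 4) = (a (p ^ 2) + ?p ^ 2 * delta) * a (p ^ 2) - ?p ^ 6 * delta ^ 2"
    "a (p ^ 6) = (a (p ^ 2) + ?p ^ 2 * delta) * a (p ^ 4) - ?p ^ 6 * delta ^ 2 * a (p ^ 2)"
    using even_eigenvalue_identities[OF f2 f4 f6 g4 g6] by simp_all
qed

end

section \<open>Comparison of two eigenforms of different weight\<close>

theorem theorem5p2:
  fixes N p l1 l2 m1 m2 :: nat
    and \<rho> :: "complex mat2 \<Rightarrow> complex ^ 'd ^ 'd"
    and \<sigma> :: "complex mat2 \<Rightarrow> complex ^ 'e ^ 'e"
    and F :: "complex mat2 \<Rightarrow> complex ^ 'd"
    and G :: "complex mat2 \<Rightarrow> complex ^ 'e"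
    and aF aG :: "nat \<Rightarrow> complex"
  assumes F: "hecke_eigenform N l1 l2 \<rho> F"
    and G: "hecke_eigenform N m1 m2 \<sigma> G"
    and weights: "l1 + l2 \<noteq> m1 + m2"
    and p: "prime p" "\<not> p dvd N"
    and aF: "\<And>r z. z \<in> siegel_H2 \<Longrightarrow> hecke_T N p r l1 l2 \<rho> F z = aF (p ^ r) *s F z"
    and aG: "\<And>r z. z \<in> siegel_H2 \<Longrightarrow> hecke_T N p r m1 m2 \<sigma> G z = aG (p ^ r) *s G z"
  shows "(\<not> (aF p = 0 \<and> aG p = 0) \<longrightarrow>
            (aF p, aF (p ^ 2), aF (p ^ 3)) \<noteq> (aG p, aG (p ^ 2), aG (p ^ 3))) \<and>
         (aF p = 0 \<and> aG p = 0 \<longrightarrow>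
            (aF (p ^ 2), aF (p ^ 4), aF (p ^ 6)) \<noteq> (aG (p ^ 2), aG (p ^ 4), aG (p ^ 6)))"
proof -
  have cop: "coprime N p" using p by (metis coprime_commute prime_imp_coprime)
  interpret F: siegel_form N p l1 l2 \<rho> F
    using F p cop by unfold_locales (auto simp: hecke_eigenform_def)
  interpret G: siegel_form N p m1 m2 \<sigma> G
    using G p cop by unfold_locales (auto simp: hecke_eigenform_def)
  let ?p = "of_nat p :: complex"
  \<comment> \<open>In this normalisation the coefficient in \<open>a(p^3)\<close> becomes
    \<open>1 + p\<close> and the quadratic term in \<open>a(p^4)\<close> becomes
    \<open>p^2 t^2\<close>.\<close>
  define t where "t = ?p ^ 2 * F.delta"
  define t' where "t' = ?p ^ 2 * G.delta"
  have p0: "?p \<noteq> 0" using F.p_gt_0 by simp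
  have p1: "1 + ?p \<noteq> 0" by (metis of_nat_Suc of_nat_eq_0_iff nat.distinct(1))
  obtain z where z: "z \<in> siegel_H2" "F z \<noteq> 0" using F by (auto simp: hecke_eigenform_def)
  obtain z' where z': "z' \<in> siegel_H2" "G z' \<noteq> 0" using G by (auto simp: hecke_eigenform_def)
  note rF = F.eigenvalue_relations[OF z aF] and rG = G.eigenvalue_relations[OF z' aG]
  have rF1: "aF (p ^ 3) = aF p * (2 * aF (p ^ 2) - aF p ^ 2 + (1 + ?p) * t)"
    using rF(1) by (simp add: t_def algebra_simps power2_eq_square power3_eq_cube)
  have rG1: "aG (p ^ 3) = aG p * (2 * aG (p ^ 2) - aG p ^ 2 + (1 + ?p) * t')"
    using rG(1) by (simp add: t'_def algebra_simps power2_eq_square power3_eq_cube)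
  have t6: "?p ^ 6 * F.delta ^ 2 = ?p ^ 2 * t ^ 2" "?p ^ 6 * G.delta ^ 2 = ?p ^ 2 * t' ^ 2"
    by (simp_all add: t_def t'_def eval_nat_numeral)
  have t0: "t \<noteq> 0" "t' \<noteq> 0" using p0 by (simp_all add: t_def t'_def F.delta_def G.delta_def)
  have tt': "t \<noteq> t'"
  proof
    assume "t = t'"
    then have "F.delta = G.delta" using p0 by (simp add: t_def t'_def)
    \<comment> \<open>The exponents differ because the weight sums do, and powers of a real number
      above 1 determine their exponents.\<close>
    then have "complex_of_real (real p powi (int l1 + int l2 - 6)) = complex_of_real (real p powi (int m1 + int m2 - 6))"
      by (simp add: F.delta_def G.delta_def)
    then have "real p powi (int l1 + int l2 - 6) = real p powi (int m1 + int m2 - 6)"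
      by (simp only: of_real_eq_iff)
    moreover have "int l1 + int l2 - 6 < int m1 + int m2 - 6 \<or> int m1 + int m2 - 6 < int l1 + int l2 - 6"
      using weights by linarith
    moreover have "real p > 1" using F.p_gt_1 by simp
    ultimately show False
      using power_int_strict_increasing[of _ _ "real p"] by (metis order_less_irrefl)
  qed
  show ?thesis
  proof (intro conjI impI notI)
    assume nz: "\<not> (aF p = 0 \<and> aG p = 0)"
      and eq: "(aF p, aF (p ^ 2), aF (p ^ 3)) = (aG p, aG (p ^ 2), aG (p ^ 3))"
    have "aF p * ((1 + ?p) * (t - t')) = aF p * (2 * aF (p ^ 2) - aF p ^ 2 + (1 + ?p) * t)
        - aF p * (2 * aF (p ^ 2) - aF p ^ 2 + (1 + ?p) * t')"
      by (simp add: algebra_simps)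
    also have "\<dots> = aF (p ^ 3) - aG (p ^ 3)" using eq rF1 rG1 by simp
    also have "\<dots> = 0" using eq by simp
    finally show False using nz eq p1 tt' by simp
  next
    assume z: "aF p = 0 \<and> aG p = 0"
      and eq: "(aF (p ^ 2), aF (p ^ 4), aF (p ^ 6)) = (aG (p ^ 2), aG (p ^ 4), aG (p ^ 6))"
    define x where "x = aF (p ^ 2)"
    have F4: "aF (p ^ 4) = (x + t) * x - ?p ^ 2 * t ^ 2"
      using rF(2) z by (simp add: x_def t6 flip: t_def)
    have G4: "aF (p ^ 4) = (x + t') * x - ?p ^ 2 * t' ^ 2"
      using rG(2) z eq by (simp add: x_def t6 flip: t'_def)
    have F6: "aF (p ^ 6) = (x + t) * aF (p ^ 4) - ?p ^ 2 * t ^ 2 * x"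
      using rF(3) z by (simp add: x_def t6 flip: t_def)
    have G6: "aF (p ^ 6) = (x + t') * aF (p ^ 4) - ?p ^ 2 * t' ^ 2 * x"
      using rG(3) z eq by (simp add: x_def t6 flip: t'_def)
    have "(t - t') * (x - ?p ^ 2 * (t + t')) = ((x + t) * x - ?p ^ 2 * t ^ 2) - ((x + t') * x - ?p ^ 2 * t' ^ 2)"
      by (simp add: algebra_simps power2_eq_square)
    then have "(t - t') * (x - ?p ^ 2 * (t + t')) = 0" by (simp only: F4[symmetric] G4[symmetric] diff_self)
    then have x: "x = ?p ^ 2 * (t + t')" using tt' by simp
    \<comment> \<open>The same subtraction for \<open>a(p^6)\<close>, with the common
      \<open>a(p^4)\<close> treated as a constant, gives \<open>a(p^4) = p^2 (t + t') x\<close>, and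
      this is \<open>x * x\<close> by the value of \<open>x\<close>.\<close>
    have "(t - t') * (aF (p ^ 4) - ?p ^ 2 * (t + t') * x) =
        ((x + t) * aF (p ^ 4) - ?p ^ 2 * t ^ 2 * x) - ((x + t') * aF (p ^ 4) - ?p ^ 2 * t' ^ 2 * x)"
      by (simp add: algebra_simps power2_eq_square)
    then have "(t - t') * (aF (p ^ 4) - ?p ^ 2 * (t + t') * x) = 0" by (simp only: F6[symmetric] G6[symmetric] diff_self)
    then have a4: "aF (p ^ 4) = x * x" using tt' x by simp
    \<comment> \<open>Now \<open>F4\<close> reads \<open>x * x = x * x + t * x - p^2 t^2\<close>;
      inserting \<open>x = p^2 (t + t')\<close> leaves only the mixed term
      \<open>p^2 t t'\<close>.\<close>
    have "t * x = ?p ^ 2 * t ^ 2" using F4 unfolding a4 by (simp add: algebra_simps)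
    then have "?p ^ 2 * t * t' = 0" unfolding x by (simp add: algebra_simps power2_eq_square)
    then show False using p0 t0 by simp
  qed
qed

end
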